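(* Let $t>1$ be an integer, let $b$ be an odd prime, and let $a$ be an integer with $0\leq a<b$. Then, as $n\to\infty$, $$ p_t(a,b;n)\sim \frac{c_t(a,b;n)}{4\sqrt{3}\,n}\cdot e^{\pi\sqrt{\frac{2n}{3}}}. $$
   Context: For a partition $\lambda$ of $n$ (written $\lambda\vdash n$), the node in row $k$ and column $j$ of its Ferrers–Young diagram has hook length $h(k,j)=(\lambda_k-k)+(\lambda'_j-j)+1$, where $\lambda'_j$ is the number of nodes in column $j$. For a positive integer $t$, $\mathcal{H}_t(\lambda)$ denotes the multiset of hook lengths of $\lambda$ that are divisible by $t$ (the $t$-hooks). Define $p_t(a,b;n):=\#\{\lambda\vdash n:\ \#\mathcal{H}_t(\lambda)\equiv a\pmod b\}$. Define $$\mathbb{I}(a,b,t,n):=\begin{cases} b-1 & \text{if } \tfrac{1}{24}(1-t^2)(1-b^2)+at-n\equiv 0\pmod b,\\ -1&\text{otherwise,}\end{cases}$$ and $$c_t(a,b;n):=\frac1b+\begin{cases}0 & \text{if } b\mid t,\\ (-1)^{\frac{(1-t)(b-1)}{4}}\,\mathbb{I}(a,b,t,n)\, b^{-\frac{t+1}{2}}\left(\frac{t}{b}\right) & \text{if } b\nmid t,\ t \text{ odd},\\ i^{\frac{(1-t)(b-1)}{2}}\,\varepsilon_b\, b^{-\frac t2}\left(\frac{\frac{1}{24}(1-t^2)(1-b^2)+at-n}{b}\right) & \text{if } b\nmid t,\ t\text{ even},\end{cases}$$ where $\left(\frac{\cdot}{b}\right)$ is the Legendre symbol (the quantity $\frac{1}{24}(1-t^2)(1-b^2)+at-n$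 is an integer in the cases where it is used), and $\varepsilon_b=1$ if $b\equiv1\pmod 4$, $\varepsilon_b=i$ if $b\equiv 3\pmod 4$. *)

theory Defs
  imports "HOL-Analysis.Analysis" "HOL-Number_Theory.Number_Theory"
begin

text \<open>A partition is the list of its parts in weakly decreasing order.\<close>

definition partition_of :: "nat \<Rightarrow> nat list \<Rightarrow> bool" where
  "partition_of n xs \<longleftrightarrow> sorted_wrt (\<ge>) xs \<and> 0 \<notin> set xs \<and> sum_list xs = n"

text \<open>Rows and columns are numbered from 1, so row \<open>k\<close> is the list entry with index \<open>k - 1\<close>.\<close>

definition diagram :: "nat list \<Rightarrow> (nat \<times> nat) set" where
  "diagram xs = {(k, j). 1 \<le> k \<and> k \<le> length xs \<and> 1 \<le> j \<and> j \<le> xs ! (k - 1)}"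

definition column_length :: "nat list \<Rightarrow> nat \<Rightarrow> nat" where
  "column_length xs j = card {k. (k, j) \<in> diagram xs}"

definition hook_length :: "nat list \<Rightarrow> nat \<Rightarrow> nat \<Rightarrow> int" where
  "hook_length xs k j =
     (int (xs ! (k - 1)) - int k) + (int (column_length xs j) - int j) + 1"

definition t_hooks :: "int \<Rightarrow> nat list \<Rightarrow> int multiset" where
  "t_hooks t xs =
     filter_mset (\<lambda>h. t dvd h) (image_mset (\<lambda>(k, j). hook_length xs k j) (mset_set (diagram xs)))"

definition p_hooks :: "int \<Rightarrow> int \<Rightarrow> int \<Rightarrow> nat \<Rightarrow> nat" where
  "p_hooks t a b n = card {xs. partition_of n xs \<and> [int (size (t_hooks t xs)) = a] (mod b)}"

text \<open>The quantity \<open>(1 - t\<^sup>2) (1 - b\<^sup>2) / 24 + a t - n\<close>. The integer division is exact when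
  \<open>b\<close> is an odd prime not dividing \<open>t\<close> (lemma below), which is the only case in which
  \<open>hook_shift\<close> enters \<open>c_hooks\<close>.\<close>

definition hook_shift :: "int \<Rightarrow> int \<Rightarrow> int \<Rightarrow> nat \<Rightarrow> int" where
  "hook_shift t a b n = (1 - t\<^sup>2) * (1 - b\<^sup>2) div 24 + a * t - int n"

definition I_hooks :: "int \<Rightarrow> int \<Rightarrow> int \<Rightarrow> nat \<Rightarrow> int" where
  "I_hooks a b t n = (if [hook_shift t a b n = 0] (mod b) then b - 1 else -1)"

definition eps :: "int \<Rightarrow> complex" where
  "eps b = (if [b = 1] (mod 4) then 1 else \<i>)"

text \<open>The integer exponents below are exact quotients for odd \<open>b\<close>. The value is complex by type
  only because of the powers of \<open>\<i>\<close>.\<close>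

definition c_hooks :: "int \<Rightarrow> int \<Rightarrow> int \<Rightarrow> nat \<Rightarrow> complex" where
  "c_hooks t a b n = 1 / of_int b +
     (if b dvd t then 0
      else if odd t then
        (- 1) powi ((1 - t) * (b - 1) div 4) * of_int (I_hooks a b t n)
          * of_real (of_int b powr (- (of_int t + 1) / 2)) * of_int (Legendre t b)
      else
        \<i> powi ((1 - t) * (b - 1) div 2) * eps b
          * of_real (of_int b powr (- of_int t / 2)) * of_int (Legendre (hook_shift t a b n) b))"

lemma hook_shift_exact:
  fixes t b :: int
  assumes "prime b" "odd b" "\<not> b dvd t"
  shows "24 dvd (1 - t\<^sup>2) * (1 - b\<^sup>2)"
proof -
  have sq3: "3 dvd 1 - x\<^sup>2" if "\<not> 3 dvd x" for x :: int
  proof -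
    have "x mod 3 = 1 \<or> x mod 3 = 2" using that by presburger
    then have "x\<^sup>2 mod 3 = 1" by (auto simp: power2_eq_square mod_mult_eq[of x 3 x, symmetric])
    then show ?thesis by presburger
  qed
  obtain k where k: "b = 2 * k + 1" using assms(2) by (elim oddE)
  have "even (k * (k + 1))" by simp
  then obtain m where "k * (k + 1) = 2 * m" by (elim evenE)
  then have "1 - b\<^sup>2 = 8 * (- m)" by (simp add: k power2_eq_square algebra_simps)
  then have 8: "8 dvd 1 - b\<^sup>2" by simp
  have "3 dvd (1 - t\<^sup>2) * (1 - b\<^sup>2)"
  proof (cases "3 dvd b")
    case True
    then have "b = 3" using assms(1) by (auto simp: prime_int_iff dest!: spec[of _ 3])
    then show ?thesis using sq3[of t] \<open>b = 3\<close> assms(3) by (intro dvd_mult2) simp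
  next
    case False
    then show ?thesis using sq3[of b] by (intro dvd_mult) simp
  qed
  moreover have "8 dvd (1 - t\<^sup>2) * (1 - b\<^sup>2)" using 8 by simp
  ultimately show ?thesis by presburger
qed

end

theory Submission
  imports Defs "HOL-Probability.Probability" "HOL-Real_Asymp.Real_Asymp"
begin

text \<open>
  Reading a partition \<open>\<lambda>\<close> as the set of beads \<open>{\<lambda>\<^sub>k - k}\<close> turns hooks of length \<open>h\<close> into pairs of a
  bead and a gap at distance \<open>h\<close>. Splitting the beads into residue classes modulo \<open>t\<close> (the runners)
  shows that the partitions of \<open>n\<close> with \<open>w\<close> \<open>t\<close>-hooks correspond to a charge vector
  \<open>c \<in> \<int>\<^sup>t\<close> with sum zero and a \<open>t\<close>-tuple of partitions of total size \<open>w\<close>, where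
  \<open>n = Q(c) + t w\<close> for an explicit quadratic polynomial \<open>Q\<close>. Hence no circle method with many cusps
  is needed: \<open>p\<^sub>t(a,b;n)\<close> is the sum of \<open>P\<^sub>t((n - Q(c)) / t)\<close> over the charge vectors \<open>c\<close> with
  \<open>(n - Q(c)) / t \<equiv> a\<close> modulo \<open>b\<close>, where \<open>P\<^sub>t\<close> counts \<open>t\<close>-tuples of partitions.

  A saddle point at \<open>q = 1\<close> alone gives the asymptotics of \<open>P\<^sub>t\<close>, in particular of
  \<open>p(n) = P\<^sub>1(n)\<close>; its constant comes from the case \<open>t = 2\<close> of the correspondence, which is Gauss's
  identity \<open>f(q) = (\<Sum>j. q\<^bsup>j(j+1)/2\<^esup>) f(q\<^sup>2)\<^sup>2\<close> for \<open>f = \<Sum> p(n) q\<^sup>n\<close>. As \<open>P\<^sub>t\<close>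
  varies slowly, translating the charge vectors by a fixed vector in \<open>t \<int>\<^sup>t\<close> changes the sum only by \<open>o(p(n))\<close>. If \<open>b\<close> divides \<open>t\<close>, such translations permute
  the residue classes \<open>a\<close> and the proportion is \<open>1/b\<close>. Otherwise they permute the classes of charge
  vectors modulo \<open>b\<close> transitively, so the proportion is the density of solutions of
  \<open>Q(c) \<equiv> n - t a\<close> modulo \<open>b\<close>, which Gauss sums evaluate to \<open>c\<^sub>t(a,b;n)\<close>. If that density is zero, there
  are no such partitions at all.
\<close>

subsection \<open>Bead sets and hooks\<close>

text \<open>The point q = 1 dominates because \<open>log_gf\<close> has positive terms on the
  positive axis, and its first term alone forces a loss of order 1/s away from it. On the axis
  Gauss's identity relates \<open>log_gf s\<close> to \<open>log_gf (2 * s)\<close>; passing to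
  smaller s halves the error each time, so the relation and the leading order pi^2/(6 s) fix the
  constant without a transformation law of the eta function. Translations by vectors in t Z^t are
  used because they change Q(c) by t times an integer of size O(1 + sqrt(Q(c))). Divisibility of n -
  Q(c) by t is kept, and w moves by a small multiple of sqrt(w) when Q(c) is small against n; the
  other c are polynomially many and exponentially light. Since p(n) is the same sum over all c,
  comparing classes with each other suffices: of the asymptotics of P_t only an upper bound and the
  slow variation enter there. The density depends on n and may vanish for some n. It takes finitely
  many values, so its nonzero values are bounded below and an additive error o(p(n)) is a relative
  one; where it vanishes, the count must be exactly zero.\<close>

definition maya :: "int set \<Rightarrow> bool" where
  "maya S \<longleftrightarrow> finite (S \<inter> {0..}) \<and> finite ({..<0} - S)"

definition charge :: "int set \<Rightarrow> int" where
  "charge S = int (card (S \<inter> {0..})) - int (card ({..<0} - S))"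

text \<open>The sum of the bead positions, renormalised by the vacuum \<open>{..<0}\<close> because
  the bead set is infinite. At charge 0 it is the size of the partition, which is how n enters the
  abacus.\<close>

definition moment :: "int set \<Rightarrow> int" where
  "moment S = (\<Sum>x\<in>S \<inter> {0..}. x) - (\<Sum>x\<in>{..<0} - S. x)"

definition inversions :: "int set \<Rightarrow> (int \<times> int) set" where
  "inversions S = {(x, y). x \<in> S \<and> y \<notin> S \<and> y < x}"

text \<open>The rows of length zero beyond the list fill the half-line at the bottom. A general
  charge \<open>c\<close> is allowed because the runners of a partition carry nonzero
  charges.\<close>

primrec beads :: "int \<Rightarrow> nat list \<Rightarrow> int set" where
  "beads c [] = {..<c}"
| "beads c (x # xs) = insert (c + int x - 1) (beads (c - 1) xs)"

lemma maya_bounds: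
  assumes "maya S"
  obtains L U where "{..<L} \<subseteq> S" "S \<subseteq> {..<U}"
proof -
  have f: "finite (S \<inter> {0..})" "finite ({..<0} - S)" using assms by (auto simp: maya_def)
  define U where "U = Max (insert 0 (S \<inter> {0..})) + 1"
  define L where "L = Min (insert 0 ({..<0} - S))"
  have "S \<subseteq> {..<U}"
  proof
    fix x assume "x \<in> S"
    have "0 \<le> Max (insert 0 (S \<inter> {0..}))" using f by (intro Max_ge) auto
    moreover have "x \<le> Max (insert 0 (S \<inter> {0..}))" if "x \<ge> 0"
      using f that \<open>x \<in> S\<close> by (intro Max_ge) auto
    ultimately have "x \<le> Max (insert 0 (S \<inter> {0..}))" by linarith
    then show "x \<in> {..<U}" by (simp add: U_def)
  qed
  moreover have "{..<L} \<subseteq> S"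
  proof
    fix x assume x: "x \<in> {..<L}"
    have "L \<le> 0" using f by (simp add: L_def)
    show "x \<in> S"
    proof (rule ccontr)
      assume "x \<notin> S"
      then have "L \<le> x" using f x \<open>L \<le> 0\<close> unfolding L_def by (intro Min_le) auto
      then show False using x by simp
    qed
  qed
  ultimately show ?thesis using that by blast
qed

lemma maya_insert: "maya S \<Longrightarrow> maya (insert z S)"
  by (auto simp: maya_def Int_insert_left intro: finite_subset[of "{..<0} - insert z S" "{..<0} - S"])

lemma insert_facts:
  assumes "maya S" "z \<notin> S"
  shows charge_insert: "charge (insert z S) = charge S + 1"
    and moment_insert: "moment (insert z S) = moment S + z"
proof -
  have f: "finite (S \<inter> {0..})" "finite ({..<0} - S)" using assms by (auto simp: maya_def)
  have "charge (insert z S) = charge S + 1 \<and> moment (insert z S) = moment S + z"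
  proof (cases "z \<ge> 0")
    case True
    then have "insert z S \<inter> {0..} = insert z (S \<inter> {0..})" "{..<0} - insert z S = {..<0} - S" by auto
    then show ?thesis using f assms(2) by (simp add: charge_def moment_def)
  next
    case False
    then have e: "insert z S \<inter> {0..} = S \<inter> {0..}"
      and d: "{..<0} - S = insert z ({..<0} - insert z S)" using assms(2) by auto
    have "card ({..<0} - S) = Suc (card ({..<0} - insert z S))"
      by (subst d, subst card_insert_disjoint) (use f in \<open>auto intro: finite_subset[OF _ f(2)]\<close>)
    moreover have "(\<Sum>x\<in>{..<0} - S. x) = z + (\<Sum>x\<in>{..<0} - insert z S. x)"
      by (subst d, subst sum.insert) (use f in \<open>auto intro: finite_subset[OF _ f(2)]\<close>)
    ultimately show ?thesis by (simp add: charge_def moment_def e)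
  qed
  then show "charge (insert z S) = charge S + 1" "moment (insert z S) = moment S + z" by auto
qed

lemma maya_lessThan [simp]: "maya {..<c}"
  by (auto simp: maya_def intro: finite_subset[of _ "{0..c}"] finite_subset[of _ "{c..0}"])

lemma charge_moment_lessThan: "charge {..<c} = c \<and> 2 * moment {..<c} = c * (c - 1)"
proof (induction c rule: int_induct[where k = 0])
  case base
  have e: "{..<0} \<inter> {0..} = ({} :: int set)" by auto
  show ?case by (simp add: charge_def moment_def e)
next
  case (step1 i)
  have "{..<i + 1} = insert i {..<i}" by auto
  then show ?case using step1 by (simp add: charge_insert moment_insert algebra_simps)
next
  case (step2 i)
  have e: "{..<i} = insert (i - 1) {..<i - 1}" by auto
  have "charge {..<i} = charge {..<i - 1} + 1" "moment {..<i} = moment {..<i - 1} + (i - 1)"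
    unfolding e by (rule charge_insert moment_insert; simp)+
  then show ?case using step2 by (simp add: algebra_simps)
qed

lemma charge_Un:
  assumes "finite D" "maya S" "D \<inter> S = {}"
  shows "maya (S \<union> D) \<and> charge (S \<union> D) = charge S + int (card D)"
  using assms
proof (induction D rule: finite_induct)
  case (insert x D)
  then show ?case by (auto simp: maya_insert charge_insert)
qed simp

text \<open>Filling every gap below z turns S into \<open>{..<z}\<close>, whose charge is z, and
  each filled gap raises the charge by one.\<close>

lemma gaps_below:
  assumes "maya S" "S \<subseteq> {..<z}"
  shows finite_gaps_below: "finite ({..<z} - S)"
    and card_gaps_below: "int (card ({..<z} - S)) = z - charge S"
proof -
  obtain L U where L: "{..<L} \<subseteq> S" using maya_bounds[OF assms(1)] .
  show f: "finite ({..<z} - S)" by (rule finite_subset[of _ "{L..<z}"]) (use L in \<open>auto simp: subset_iff not_less[symmetric]\<close>)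
  have e: "S \<union> ({..<z} - S) = {..<z}" using assms by auto
  have "charge (S \<union> ({..<z} - S)) = charge S + int (card ({..<z} - S))"
    using charge_Un[OF f assms(1)] by blast
  then show "int (card ({..<z} - S)) = z - charge S"
    unfolding e using charge_moment_lessThan[of z] by linarith
qed

lemma beads_subset: "\<forall>x\<in>set xs. x \<le> m \<Longrightarrow> beads c xs \<subseteq> {..<c + int m}"
proof (induction xs arbitrary: c)
  case (Cons x xs)
  have "beads (c - 1) xs \<subseteq> {..<c - 1 + int m}" using Cons by auto
  then show ?case using Cons.prems by auto
qed auto

lemma inversions_insert:
  assumes "S \<subseteq> {..<z}"
  shows "inversions (insert z S) = inversions S \<union> {z} \<times> ({..<z} - S)"
  using assms by (auto simp: inversions_def)

text \<open>The largest part x is added last and puts a bead above all others; by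
  \<open>card_gaps_below\<close> exactly x gaps lie below it. So every row adds as many inversions
  as it has cells.\<close>

lemma beads_props:
  assumes "sorted_wrt (\<ge>) xs"
  shows "maya (beads c xs) \<and> charge (beads c xs) = c \<and>
    2 * moment (beads c xs) = 2 * int (sum_list xs) + c * (c - 1) \<and>
    finite (inversions (beads c xs)) \<and> card (inversions (beads c xs)) = sum_list xs"
  using assms
proof (induction xs arbitrary: c)
  case Nil
  have "inversions {..<c} = {}" by (auto simp: inversions_def)
  then show ?case using charge_moment_lessThan[of c] by simp
next
  case (Cons x xs)
  define S where "S = beads (c - 1) xs"
  define z where "z = c + int x - 1"
  have IH: "maya S" "charge S = c - 1" "2 * moment S = 2 * int (sum_list xs) + (c - 1) * (c - 2)"
    "finite (inversions S)" "card (inversions S) = sum_list xs"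
    using Cons.IH[of "c - 1"] Cons.prems by (auto simp: S_def algebra_simps)
  have sub: "S \<subseteq> {..<z}"
    using beads_subset[of xs x "c - 1"] Cons.prems by (auto simp: S_def z_def)
  then have z: "z \<notin> S" by auto
  have "int (card ({..<z} - S)) = int x" using card_gaps_below[OF IH(1) sub] IH by (simp add: z_def)
  then have cx: "card ({..<z} - S) = x" by simp
  have "card (inversions (insert z S)) = card (inversions S) + card ({z} \<times> ({..<z} - S))"
    unfolding inversions_insert[OF sub]
    by (rule card_Un_disjoint) (use IH finite_gaps_below[OF IH(1) sub] z in \<open>auto simp: inversions_def\<close>)
  moreover have "finite (inversions (insert z S))"
    unfolding inversions_insert[OF sub] using IH finite_gaps_below[OF IH(1) sub] by auto
  moreover have "beads c (x # xs) = insert z S" by (simp add: z_def S_def)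
  ultimately show ?case
    using IH cx charge_insert[OF IH(1) z] moment_insert[OF IH(1) z] maya_insert[OF IH(1)]
    by (auto simp: card_cartesian_product algebra_simps z_def)
qed

definition is_partition :: "nat list \<Rightarrow> bool" where
  "is_partition xs \<longleftrightarrow> sorted_wrt (\<ge>) xs \<and> 0 \<notin> set xs"

lemma partition_of_iff: "partition_of n xs \<longleftrightarrow> is_partition xs \<and> sum_list xs = n"
  by (auto simp: partition_of_def is_partition_def)

text \<open>The top bead is stripped off and the number of gaps below it becomes the first part. If
  there is no such gap, the whole set is a half-line and the partition is empty, so a part 0 never
  arises. The window from L to U supplies the induction measure, S being infinite.\<close>

lemma beads_surj_aux:
  assumes "{..<L} \<subseteq> S" "S \<subseteq> {..<U}" "L \<le> U" "maya S"
  shows "\<exists>xs. is_partition xs \<and> S = beads (charge S) xs"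
  using assms
proof (induction "nat (U - L)" arbitrary: U S)
  case 0
  then have "S = {..<L}" by auto
  then show ?case using charge_moment_lessThan[of L] by (intro exI[of _ "[]"]) (auto simp: is_partition_def)
next
  case (Suc n)
  then have LU: "n = nat (U - 1 - L)" "L \<le> U - 1" by auto
  show ?case
  proof (cases "U - 1 \<in> S")
    case False
    have "S \<subseteq> {..<U - 1}"
    proof
      fix x assume x: "x \<in> S"
      then have "x < U" "x \<noteq> U - 1" using Suc.prems False by auto
      then show "x \<in> {..<U - 1}" by simp
    qed
    then show ?thesis using Suc.hyps(1)[OF LU(1)] Suc.prems LU by auto
  next
    case True
    define S' where "S' = S - {U - 1}"
    have sub: "S' \<subseteq> {..<U - 1}" using Suc.prems by (force simp: S'_def)
    have m: "maya S'" using \<open>maya S\<close>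
      by (auto simp: maya_def S'_def Diff_Int_distrib2 Diff_Diff_Int intro: finite_subset[of _ "insert (U - 1) ({..<0} - S)"])
    have SS: "S = insert (U - 1) S'" using True by (auto simp: S'_def)
    obtain xs where xs: "is_partition xs" "S' = beads (charge S') xs"
      using Suc.hyps(1)[OF LU(1) _ sub LU(2) m] Suc.prems(1) LU(2) unfolding S'_def by force
    have ch: "charge S = charge S' + 1" unfolding SS by (rule charge_insert[OF m]) (auto simp: S'_def)
    define x where "x = card ({..<U - 1} - S')"
    have x: "int x = U - 1 - charge S'" using card_gaps_below[OF m sub] by (simp add: x_def)
    show ?thesis
    proof (cases "x = 0")
      case True
      then have "S' = {..<U - 1}" using finite_gaps_below[OF m sub] sub by (auto simp: x_def)
      then have "S = {..<U}" using SS by auto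
      then show ?thesis using charge_moment_lessThan[of U]
        by (intro exI[of _ "[]"]) (auto simp: is_partition_def)
    next
      case False
      have "\<forall>y\<in>set xs. y \<le> x"
      proof (cases xs)
        case (Cons h ys)
        have "charge S' + int h - 1 \<in> S'" by (subst xs(2)) (simp add: Cons)
        then have "h \<le> x" using sub x by auto
        then show ?thesis using xs(1) by (auto simp: is_partition_def Cons)
      qed auto
      then have "is_partition (x # xs)" using xs(1) False by (auto simp: is_partition_def)
      moreover have "S = beads (charge S) (x # xs)"
        using SS xs(2) x ch by simp
      ultimately show ?thesis by blast
    qed
  qed
qed

lemma beads_surj: "maya S \<Longrightarrow> \<exists>xs. is_partition xs \<and> S = beads (charge S) xs"
proof -
  assume m: "maya S"
  obtain L U where LU: "{..<L} \<subseteq> S" "S \<subseteq> {..<U}" using maya_bounds[OF m] .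
  have "{..<L} \<subseteq> {..<U}" using LU by (rule order_trans)
  then have "L \<le> U" by auto
  then show ?thesis using beads_surj_aux[OF LU _ m] by auto
qed

lemma beads_inj:
  assumes "is_partition xs" "is_partition ys" "beads c xs = beads c ys"
  shows "xs = ys"
  using assms
proof (induction xs arbitrary: c ys)
  case Nil
  show ?case
  proof (cases ys)
    case (Cons y ys')
    then have "c + int y - 1 \<in> {..<c}" using Nil by auto
    then show ?thesis using Nil Cons by (auto simp: is_partition_def)
  qed simp
next
  case (Cons x xs)
  show ?case
  proof (cases ys)
    case Nil
    have "c + int x - 1 \<in> beads c (x # xs)" by simp
    then have "c + int x - 1 \<in> {..<c}" unfolding Cons.prems(3) Nil by simp
    then show ?thesis using Cons by (auto simp: is_partition_def)
  next
    case ys: (Cons y ys')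
    have sx: "beads (c - 1) xs \<subseteq> {..<c - 1 + int x}" and sy: "beads (c - 1) ys' \<subseteq> {..<c - 1 + int y}"
      using Cons.prems ys by (auto simp: is_partition_def intro!: beads_subset)
    have "c + int x - 1 \<in> insert (c + int y - 1) (beads (c - 1) ys')"
         "c + int y - 1 \<in> insert (c + int x - 1) (beads (c - 1) xs)"
      using Cons.prems(3) ys by auto
    then have "c + int x - 1 \<le> c + int y - 1" "c + int y - 1 \<le> c + int x - 1" using sx sy by force+
    then have xy: "x = y" by simp
    then have "beads (c - 1) xs = beads (c - 1) ys'"
    proof -
      have "c + int x - 1 \<notin> beads (c - 1) xs" "c + int x - 1 \<notin> beads (c - 1) ys'"
        using sx sy xy by force+
      moreover have "insert (c + int x - 1) (beads (c - 1) xs) = insert (c + int x - 1) (beads (c - 1) ys')"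
        using Cons.prems(3) ys xy by simp
      ultimately show ?thesis by (metis insert_ident)
    qed
    then show ?thesis using Cons.IH[of ys' "c - 1"] Cons.prems ys xy by (auto simp: is_partition_def)
  qed
qed

lemma beads_explicit:
  "beads c xs = {..<c - int (length xs)} \<union> (\<lambda>i. c - int i - 1 + int (xs ! i)) ` {..<length xs}"
proof (induction xs arbitrary: c)
  case (Cons x xs)
  have "{..<length (x # xs)} = insert 0 (Suc ` {..<length xs})"
    by (simp add: lessThan_Suc_eq_insert_0)
  then show ?case using Cons[of "c - 1"] by (simp add: image_image algebra_simps)
qed simp



section \<open>Cells of the diagram as pairs of a bead and a gap\<close>

lemma initial_segment:
  fixes A :: "nat set"
  assumes "finite A" "0 \<notin> A" "\<And>k k'. k \<in> A \<Longrightarrow> 1 \<le> k' \<Longrightarrow> k' \<le> k \<Longrightarrow> k' \<in> A"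
  shows "A = {1..card A}"
proof (cases "A = {}")
  case False
  have "A = {1..Max A}"
  proof
    show "A \<subseteq> {1..Max A}" using assms(1,2) by (auto simp: Suc_le_eq intro: gr0I)
    show "{1..Max A} \<subseteq> A" using assms(3)[OF Max_in[OF assms(1) False]] by auto
  qed
  then show ?thesis by (metis card_atLeastAtMost diff_Suc_1)
qed simp

lemma sorted_nth_mono:
  assumes "sorted_wrt (\<ge>) (xs :: nat list)" "i \<le> j" "j < length xs"
  shows "xs ! j \<le> xs ! i"
  using assms sorted_wrt_nth_less[OF assms(1), of i j] by (cases "i = j") auto

lemma finite_diagram_column: "finite {k. (k, j) \<in> diagram xs}"
  by (rule finite_subset[of _ "{..length xs}"]) (auto simp: diagram_def)

lemma diagram_iff_column:
  assumes "sorted_wrt (\<ge>) xs"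
  shows "(k, j) \<in> diagram xs \<longleftrightarrow> 1 \<le> k \<and> k \<le> column_length xs j"
proof -
  have "{k. (k, j) \<in> diagram xs} = {1..card {k. (k, j) \<in> diagram xs}}"
  proof (rule initial_segment)
    fix k k' assume k: "k \<in> {k. (k, j) \<in> diagram xs}" "1 \<le> k'" "k' \<le> k"
    then have "xs ! (k - 1) \<le> xs ! (k' - 1)"
      by (intro sorted_nth_mono[OF assms]) (auto simp: diagram_def)
    then show "k' \<in> {k. (k, j) \<in> diagram xs}" using k by (auto simp: diagram_def)
  qed (auto simp: finite_diagram_column, auto simp: diagram_def)
  then show ?thesis by (auto simp: column_length_def)
qed

lemma column_length_le: "column_length xs j \<le> length xs"
proof -
  have "{k. (k, j) \<in> diagram xs} \<subseteq> {1..length xs}" by (auto simp: diagram_def)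
  from card_mono[OF _ this] show ?thesis by (simp add: column_length_def)
qed

lemma column_length_antimono:
  assumes "1 \<le> j" "j \<le> j'" shows "column_length xs j' \<le> column_length xs j"
  unfolding column_length_def
  by (rule card_mono[OF finite_diagram_column]) (use assms in \<open>auto simp: diagram_def\<close>)

text \<open>Along the boundary path of the diagram a row ends in a vertical step, the bead, and a
  column in a horizontal step, the gap. The difference of the two positions is the hook length of
  the cell.\<close>

definition cell_inversion :: "nat list \<Rightarrow> nat \<times> nat \<Rightarrow> int \<times> int" where
  "cell_inversion xs = (\<lambda>(k, j). (int (xs ! (k - 1)) - int k, int j - 1 - int (column_length xs j)))"

lemma diagram_Sigma: "diagram xs = (SIGMA k:{1..length xs}. {1..xs ! (k - 1)})"
  by (auto simp: diagram_def)

lemma card_diagram: "card (diagram xs) = sum_list xs"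
proof -
  have "card (diagram xs) = (\<Sum>k\<in>{1..length xs}. xs ! (k - 1))" by (simp add: diagram_Sigma)
  also have "\<dots> = (\<Sum>k\<in>{0..<length xs}. xs ! k)"
    by (rule sum.reindex_bij_witness[of _ Suc "\<lambda>k. k - 1"]) auto
  finally show ?thesis by (simp add: sum_list_sum_nth)
qed

text \<open>Compare the gap of column j with the bead of a row. If their common cell is in the
  diagram, bead minus gap is positive; otherwise both inequalities reverse and the bead lies
  strictly below the gap. The half-line of empty rows is too low because a column has at most
  \<open>length xs\<close> cells.\<close>

lemma gap_not_bead:
  assumes "sorted_wrt (\<ge>) xs" "1 \<le> j"
  shows "int j - 1 - int (column_length xs j) \<notin> beads 0 xs"
proof
  assume "int j - 1 - int (column_length xs j) \<in> beads 0 xs"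
  then consider "int j - 1 - int (column_length xs j) < - int (length xs)" |
    i where "i < length xs" "int j - 1 - int (column_length xs j) = - int i - 1 + int (xs ! i)"
    unfolding beads_explicit by auto
  then show False
  proof cases
    case 1
    then show False using column_length_le[of xs j] assms(2) by linarith
  next
    case 2
    show False
    proof (cases "(Suc i, j) \<in> diagram xs")
      case True
      then have "j \<le> xs ! i" "Suc i \<le> column_length xs j"
        using diagram_iff_column[OF assms(1), of "Suc i" j] by (auto simp: diagram_def)
      then show False using 2 by linarith
    next
      case False
      then have "j > xs ! i" "Suc i > column_length xs j"
        using diagram_iff_column[OF assms(1), of "Suc i" j] 2 assms by (auto simp: diagram_def)
      then show False using 2 by linarith
    qed
  qed
qed

lemma bij_betw_cell_inversion:
  assumes "sorted_wrt (\<ge>) xs"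
  shows "bij_betw (cell_inversion xs) (diagram xs) (inversions (beads 0 xs))"
proof -
  have inj: "inj_on (cell_inversion xs) (diagram xs)"
  proof (rule inj_onI, clarify)
    fix k j k' j' assume a: "(k, j) \<in> diagram xs" "(k', j') \<in> diagram xs"
      "cell_inversion xs (k, j) = cell_inversion xs (k', j')"
    have x: "int (xs ! (k - 1)) - int k = int (xs ! (k' - 1)) - int k'"
      and y: "int j - int (column_length xs j) = int j' - int (column_length xs j')"
      using a by (auto simp: cell_inversion_def)
    have "k = k'"
    proof (cases k k' rule: linorder_cases)
      case less
      then have "xs ! (k' - 1) \<le> xs ! (k - 1)"
        by (intro sorted_nth_mono[OF assms]) (use a in \<open>auto simp: diagram_def\<close>)
      then show ?thesis using x less by linarith
    next
      case greater
      then have "xs ! (k - 1) \<le> xs ! (k' - 1)"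
        by (intro sorted_nth_mono[OF assms]) (use a in \<open>auto simp: diagram_def\<close>)
      then show ?thesis using x greater by linarith
    qed
    moreover have "j = j'"
      using column_length_antimono[of j j' xs] column_length_antimono[of j' j xs] a y
      by (cases j j' rule: linorder_cases) (auto simp: diagram_def)
    ultimately show "k = k' \<and> j = j'" by simp
  qed
  have fin: "finite (diagram xs)" by (simp add: diagram_Sigma)
  have sub: "cell_inversion xs ` diagram xs \<subseteq> inversions (beads 0 xs)"
  proof (rule image_subsetI)
    fix p assume "p \<in> diagram xs"
    then obtain k j where p: "p = (k, j)" and kj: "(k, j) \<in> diagram xs" by (cases p) auto
    then have b: "k - 1 < length xs" "1 \<le> k" "1 \<le> j" "j \<le> xs ! (k - 1)" by (auto simp: diagram_def)
    then have "int (xs ! (k - 1)) - int k \<in> (\<lambda>i. 0 - int i - 1 + int (xs ! i)) ` {..<length xs}"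
      by (intro image_eqI[of _ _ "k - 1"]) auto
    then have 1: "int (xs ! (k - 1)) - int k \<in> beads 0 xs" unfolding beads_explicit by blast
    have 2: "int j - 1 - int (column_length xs j) \<notin> beads 0 xs"
      using gap_not_bead[OF assms b(3)] .
    have "k \<le> column_length xs j" using kj diagram_iff_column[OF assms] by blast
    then have 3: "int j - 1 - int (column_length xs j) < int (xs ! (k - 1)) - int k" using b by linarith
    show "cell_inversion xs p \<in> inversions (beads 0 xs)"
      unfolding p cell_inversion_def inversions_def using 1 2 3 by simp
  qed
  \<comment> \<open>Surjectivity by counting: both sides have \<open>sum_list xs\<close> elements,
    by \<open>card_diagram\<close> and \<open>beads_props\<close>.\<close>
  have "cell_inversion xs ` diagram xs = inversions (beads 0 xs)"
    by (rule card_subset_eq) (use sub beads_props[OF assms, of 0] inj in \<open>auto simp: card_image card_diagram\<close>)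
  then show ?thesis using inj by (simp add: bij_betw_def)
qed

definition inversions_mod :: "nat \<Rightarrow> int set \<Rightarrow> (int \<times> int) set" where
  "inversions_mod t S = {(x, y) \<in> inversions S. int t dvd x - y}"

lemma size_t_hooks:
  assumes "sorted_wrt (\<ge>) xs"
  shows "size (t_hooks (int t) xs) = card (inversions_mod t (beads 0 xs))"
proof -
  have fin: "finite (diagram xs)" by (simp add: diagram_Sigma)
  define D where "D = {p \<in> diagram xs. int t dvd (case p of (k, j) \<Rightarrow> hook_length xs k j)}"
  have "size (t_hooks (int t) xs) = card D"
    using fin by (simp add: t_hooks_def D_def filter_mset_image_mset filter_mset_mset_set)
  also have "bij_betw (cell_inversion xs) D (inversions_mod t (beads 0 xs))"
  proof -
    have "bij_betw (cell_inversion xs) D (cell_inversion xs ` D)"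
      using bij_betw_cell_inversion[OF assms] by (auto simp: bij_betw_def D_def intro: inj_on_subset)
    moreover have "cell_inversion xs ` D = inversions_mod t (beads 0 xs)"
    proof -
      have h: "(case p of (k, j) \<Rightarrow> hook_length xs k j) = fst (cell_inversion xs p) - snd (cell_inversion xs p)" for p
        by (cases p) (simp add: hook_length_def cell_inversion_def)
      have "inversions (beads 0 xs) = cell_inversion xs ` diagram xs"
        using bij_betw_cell_inversion[OF assms] by (simp add: bij_betw_def)
      moreover have "{(x, y). (x, y) \<in> A \<and> int t dvd x - y} = {q \<in> A. int t dvd fst q - snd q}" for A
        by auto
      ultimately have "inversions_mod t (beads 0 xs) = {q \<in> cell_inversion xs ` diagram xs. int t dvd fst q - snd q}"
        unfolding inversions_mod_def by simp
      also have "\<dots> = cell_inversion xs ` D" unfolding D_def h by blast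
      finally show ?thesis by simp
    qed
    ultimately show ?thesis by simp
  qed
  then have "card D = card (inversions_mod t (beads 0 xs))" by (rule bij_betw_same_card)
  finally show ?thesis .
qed

subsection \<open>Cores and quotients\<close>

text \<open>The r-th runner of the t-abacus, rescaled so that it is a bead set again.\<close>

definition runner :: "nat \<Rightarrow> int set \<Rightarrow> nat \<Rightarrow> int set" where
  "runner t S r = {k. k * int t + int r \<in> S}"

lemma runner_Int: "runner t (S \<inter> A) r = runner t S r \<inter> runner t A r"
  and runner_Diff: "runner t (S - A) r = runner t S r - runner t A r"
  by (auto simp: runner_def)

lemma divmod_runner:
  assumes "r < t"
  shows "(k * int t + int r) div int t = k" "(k * int t + int r) mod int t = int r"
  using assms by auto

lemma runner_halfline:
  assumes "r < t" shows "runner t {0..} r = {0..}" "runner t {..<0} r = {..<0}"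
proof -
  have *: "0 \<le> k * int t + int r \<longleftrightarrow> 0 \<le> k" for k
  proof
    assume "0 \<le> k * int t + int r"
    then have "0 div int t \<le> (k * int t + int r) div int t" by (intro zdiv_mono1) (use assms in auto)
    then show "0 \<le> k" using divmod_runner[OF assms] by simp
  qed auto
  have "k * int t + int r < 0 \<longleftrightarrow> k < 0" for k
    using *[of k] by linarith
  with * show "runner t {0..} r = {0..}" "runner t {..<0} r = {..<0}"
    by (simp_all add: runner_def set_eq_iff)
qed

lemma bij_betw_runner:
  assumes "t > 0"
  shows "bij_betw (\<lambda>(r, k). k * int t + int r) (SIGMA r:{..<t}. runner t S r) S"
proof (rule bij_betw_byWitness[of _ "\<lambda>x. (nat (x mod int t), x div int t)"])
  show "\<forall>x\<in>S. (case (nat (x mod int t), x div int t) of (r, k) \<Rightarrow> k * int t + int r) = x"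
    using assms by simp
  show "(\<lambda>x. (nat (x mod int t), x div int t)) ` S \<subseteq> (SIGMA r:{..<t}. runner t S r)"
    using assms by (auto simp: runner_def nat_less_iff)
qed (auto simp: runner_def)

lemma finite_runner_iff:
  assumes "t > 0"
  shows "finite S \<longleftrightarrow> (\<forall>r<t. finite (runner t S r))"
proof -
  have "finite (SIGMA r:{..<t}. runner t S r) \<longleftrightarrow> (\<forall>r<t. finite (runner t S r))"
  proof
    assume f: "finite (SIGMA r:{..<t}. runner t S r)"
    show "\<forall>r<t. finite (runner t S r)"
    proof (intro allI impI)
      fix r assume "r < t"
      then have "Pair r ` runner t S r \<subseteq> (SIGMA r:{..<t}. runner t S r)" by auto
      then have "finite (Pair r ` runner t S r)" using f finite_subset by blast
      then show "finite (runner t S r)" by (rule finite_imageD) (auto simp: inj_on_def)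
    qed
  qed auto
  then show ?thesis using bij_betw_finite[OF bij_betw_runner[OF assms, of S]] by simp
qed

lemma sum_runner:
  fixes f :: "int \<Rightarrow> int"
  assumes "t > 0" "finite S"
  shows "sum f S = (\<Sum>r<t. \<Sum>k\<in>runner t S r. f (k * int t + int r))"
proof -
  have "sum f S = (\<Sum>p\<in>(SIGMA r:{..<t}. runner t S r). f (case p of (r, k) \<Rightarrow> k * int t + int r))"
    by (rule sum.reindex_bij_betw[OF bij_betw_runner[OF assms(1)], symmetric])
  also have "\<dots> = (\<Sum>r<t. \<Sum>k\<in>runner t S r. f (k * int t + int r))"
    using assms finite_runner_iff[OF assms(1), of S]
    by (subst sum.Sigma) (auto simp: case_prod_beta)
  finally show ?thesis .
qed

lemma maya_runner_iff:
  assumes "t > 0"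
  shows "maya S \<longleftrightarrow> (\<forall>r<t. maya (runner t S r))"
proof -
  have "finite (S \<inter> {0..}) \<longleftrightarrow> (\<forall>r<t. finite (runner t S r \<inter> {0..}))"
    unfolding finite_runner_iff[OF assms, of "S \<inter> {0..}"]
    by (intro all_cong1 imp_cong refl) (simp add: runner_Int runner_halfline)
  moreover have "finite ({..<0} - S) \<longleftrightarrow> (\<forall>r<t. finite ({..<0} - runner t S r))"
    unfolding finite_runner_iff[OF assms, of "{..<0} - S"]
    by (intro all_cong1 imp_cong refl) (simp add: runner_Diff runner_halfline)
  ultimately show ?thesis unfolding maya_def by blast
qed

lemma card_eq_sum_int: "int (card A) = (\<Sum>x\<in>A. 1)"
  by simp

text \<open>Substitution of k t + r for the positions. The half-line at 0 splits into the half-lines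
  at 0 of all the runners, so the vacuum corrections split along with the beads.\<close>

lemma runner_sums:
  assumes "t > 0" "maya S"
  shows charge_runner: "charge S = (\<Sum>r<t. charge (runner t S r))"
    and moment_runner: "moment S = (\<Sum>r<t. int t * moment (runner t S r) + int r * charge (runner t S r))"
proof -
  have f: "finite (S \<inter> {0..})" "finite ({..<0} - S)" using assms by (auto simp: maya_def)
  have P: "sum g (S \<inter> {0..}) = (\<Sum>r<t. \<Sum>k\<in>runner t S r \<inter> {0..}. g (k * int t + int r))" for g :: "int \<Rightarrow> int"
    unfolding sum_runner[OF assms(1) f(1)]
    by (intro sum.cong refl) (auto simp: runner_Int runner_halfline)
  have N: "sum g ({..<0} - S) = (\<Sum>r<t. \<Sum>k\<in>{..<0} - runner t S r. g (k * int t + int r))" for g :: "int \<Rightarrow> int"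
    unfolding sum_runner[OF assms(1) f(2)]
    by (intro sum.cong refl) (auto simp: runner_Diff runner_halfline)
  show "charge S = (\<Sum>r<t. charge (runner t S r))"
    unfolding charge_def card_eq_sum_int P N by (simp add: sum_subtractf)
  show "moment S = (\<Sum>r<t. int t * moment (runner t S r) + int r * charge (runner t S r))"
  proof -
    have "moment S = (\<Sum>r<t. (\<Sum>k\<in>runner t S r \<inter> {0..}. k * int t + int r) -
        (\<Sum>k\<in>{..<0} - runner t S r. k * int t + int r))"
      unfolding moment_def P N by (simp add: sum_subtractf)
    also have "\<dots> = (\<Sum>r<t. int t * moment (runner t S r) + int r * charge (runner t S r))"
    proof (rule sum.cong[OF refl])
      fix r
      have "(\<Sum>k\<in>B. k * int t + int r) = int t * \<Sum>B + int r * int (card B)" for B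
        by (simp add: sum.distrib sum_distrib_left mult.commute)
      then show "(\<Sum>k\<in>runner t S r \<inter> {0..}. k * int t + int r) - (\<Sum>k\<in>{..<0} - runner t S r. k * int t + int r)
        = int t * moment (runner t S r) + int r * charge (runner t S r)"
        by (simp add: moment_def charge_def algebra_simps)
    qed
    finally show ?thesis .
  qed
qed

text \<open>A bead and a gap at a distance divisible by t lie on the same runner, where their
  distance is an arbitrary positive integer. Thus the t-hooks are all the hooks of the runner
  partitions.\<close>

lemma inversions_mod_runner:
  assumes "t > 0"
  shows "bij_betw (\<lambda>(r, k, l). (k * int t + int r, l * int t + int r))
           (SIGMA r:{..<t}. inversions (runner t S r)) (inversions_mod t S)"
proof (rule bij_betw_byWitness[of _ "\<lambda>(x, y). (nat (x mod int t), x div int t, y div int t)"])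
  show "\<forall>p\<in>inversions_mod t S. (\<lambda>(r, k, l). (k * int t + int r, l * int t + int r))
     (case p of (x, y) \<Rightarrow> (nat (x mod int t), x div int t, y div int t)) = p"
  proof (rule ballI)
    fix p assume p: "p \<in> inversions_mod t S"
    obtain x y where [simp]: "p = (x, y)" by (cases p)
    have "x mod int t = y mod int t" using p by (simp add: inversions_mod_def mod_eq_dvd_iff)
    then show "(\<lambda>(r, k, l). (k * int t + int r, l * int t + int r))
        (case p of (x, y) \<Rightarrow> (nat (x mod int t), x div int t, y div int t)) = p"
      using assms div_mult_mod_eq[of x "int t"] div_mult_mod_eq[of y "int t"] by simp
  qed
  show "(\<lambda>(r, k, l). (k * int t + int r, l * int t + int r)) ` (SIGMA r:{..<t}. inversions (runner t S r))
      \<subseteq> inversions_mod t S"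
  proof clarify
    fix r k l assume r: "r < t" and kl: "(k, l) \<in> inversions (runner t S r)"
    have "(k * int t + int r) - (l * int t + int r) = int t * (k - l)" by (simp add: algebra_simps)
    then have "int t dvd (k * int t + int r) - (l * int t + int r)" by simp
    moreover have "l * int t < k * int t" using kl assms by (simp add: inversions_def)
    ultimately show "(k * int t + int r, l * int t + int r) \<in> inversions_mod t S"
      using kl by (simp add: inversions_mod_def inversions_def runner_def)
  qed
  show "(\<lambda>(x, y). (nat (x mod int t), x div int t, y div int t)) ` inversions_mod t S
    \<subseteq> (SIGMA r:{..<t}. inversions (runner t S r))"
  proof clarify
    fix x y assume "(x, y) \<in> inversions_mod t S"
    then have xy: "x \<in> S" "y \<notin> S" "y < x" "x mod int t = y mod int t"
      by (auto simp: inversions_mod_def inversions_def mod_eq_dvd_iff)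
    have "y div int t \<le> x div int t" using xy assms by (intro zdiv_mono1) auto
    moreover have "y div int t \<noteq> x div int t"
      using xy div_mult_mod_eq[of x "int t"] div_mult_mod_eq[of y "int t"] by metis
    ultimately have "y div int t < x div int t" by simp
    moreover have "x div int t * int t + x mod int t \<in> S" "y div int t * int t + x mod int t \<notin> S"
      using xy div_mult_mod_eq[of x "int t"] div_mult_mod_eq[of y "int t"] by simp_all
    ultimately show "nat (x mod int t) \<in> {..<t} \<and> (x div int t, y div int t) \<in> inversions (runner t S (nat (x mod int t)))"
      using assms by (simp add: inversions_def runner_def nat_less_iff)
  qed
qed auto

lemma card_inversions_mod:
  assumes "t > 0" "maya S"
  shows "card (inversions_mod t S) = (\<Sum>r<t. card (inversions (runner t S r)))"
proof -
  have fin: "finite (inversions (runner t S r))" if "r < t" for r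
  proof -
    have "maya (runner t S r)" using maya_runner_iff[OF assms(1)] assms(2) that by blast
    then obtain xs where "is_partition xs" "runner t S r = beads (charge (runner t S r)) xs" using beads_surj by blast
    then show ?thesis using beads_props[of xs "charge (runner t S r)"] by (auto simp: is_partition_def)
  qed
  have "card (inversions_mod t S) = card (SIGMA r:{..<t}. inversions (runner t S r))"
    by (rule bij_betw_same_card[OF inversions_mod_runner[OF assms(1)], symmetric])
  then show ?thesis using fin by simp
qed

definition merge_runners :: "nat \<Rightarrow> (nat \<Rightarrow> int set) \<Rightarrow> int set" where
  "merge_runners t R = {x. x div int t \<in> R (nat (x mod int t))}"

lemma runner_merge: "r < t \<Longrightarrow> runner t (merge_runners t R) r = R r"
  by (simp add: runner_def merge_runners_def)

lemma merge_runner: "t > 0 \<Longrightarrow> merge_runners t (runner t S) = S"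
  by (simp add: runner_def merge_runners_def)

lemma merge_cong: "t > 0 \<Longrightarrow> (\<And>r. r < t \<Longrightarrow> R r = R' r) \<Longrightarrow> merge_runners t R = merge_runners t R'"
  by (simp add: merge_runners_def nat_less_iff)

definition charge_vectors :: "nat \<Rightarrow> (nat \<Rightarrow> int) set" where
  "charge_vectors t = {c \<in> {..<t} \<rightarrow>\<^sub>E UNIV. sum c {..<t} = 0}"

text \<open>The size of the \<open>t\<close>-core with charge vector \<open>c\<close>.\<close>

definition core_size :: "nat \<Rightarrow> (nat \<Rightarrow> int) \<Rightarrow> int" where
  "core_size t c = (\<Sum>r<t. int t * (c r * (c r - 1) div 2) + int r * c r)"

definition partition_tuples :: "nat \<Rightarrow> nat \<Rightarrow> (nat \<Rightarrow> nat list) set" where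
  "partition_tuples t w = {X \<in> {..<t} \<rightarrow>\<^sub>E Collect is_partition. (\<Sum>r<t. sum_list (X r)) = w}"

lemma bij_betw_beads:
  "bij_betw (beads 0) {xs. partition_of n xs \<and> size (t_hooks (int t) xs) = w}
     {S. maya S \<and> charge S = 0 \<and> moment S = int n \<and> card (inversions_mod t S) = w}"
  (is "bij_betw _ ?X ?Z")
proof -
  have "inj_on (beads 0) ?X"
    by (rule inj_onI) (auto simp: partition_of_iff dest: beads_inj)
  moreover have "beads 0 ` ?X = ?Z"
  proof (intro equalityI subsetI)
    fix S assume "S \<in> beads 0 ` ?X"
    then show "S \<in> ?Z" using beads_props[of _ 0] size_t_hooks
      by (auto simp: partition_of_def)
  next
    fix S assume S: "S \<in> ?Z"
    then obtain xs where xs: "is_partition xs" "S = beads 0 xs" using beads_surj[of S] by auto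
    then show "S \<in> beads 0 ` ?X"
      using S beads_props[of xs 0] size_t_hooks[of xs t] by (auto simp: partition_of_iff is_partition_def)
  qed
  ultimately show ?thesis by (simp add: bij_betw_def)
qed

lemma two_core_size:
  "2 * core_size t c = (\<Sum>r<t. int t * (c r * (c r - 1)) + 2 * int r * c r)"
proof -
  have "2 * (x * (x - 1) div 2) = x * (x - 1)" for x :: int by simp
  then show ?thesis unfolding core_size_def sum_distrib_left
    by (intro sum.cong refl) (simp add: distrib_left mult.left_commute[of 2])
qed

text \<open>The core and quotient bijection: the charges of the runners encode the core, the
  partitions on them the quotient. The equation for n is \<open>moment_runner\<close>, in which a
  runner contributes t times the size of its partition plus the moment of its half-line.\<close>

lemma bij_betw_quotient:
  assumes t: "t > 0"
  shows "bij_betw (\<lambda>(c, X). merge_runners t (\<lambda>r. beads (c r) (X r)))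
     ({c \<in> charge_vectors t. core_size t c + int (t * w) = int n} \<times> partition_tuples t w)
     {S. maya S \<and> charge S = 0 \<and> moment S = int n \<and> card (inversions_mod t S) = w}"
  (is "bij_betw ?f ?Y ?Z")
proof -
  have bp: "maya (beads c xs)" "charge (beads c xs) = c" "card (inversions (beads c xs)) = sum_list xs"
    "moment (beads c xs) = int (sum_list xs) + c * (c - 1) div 2" if "is_partition xs" for c xs
    using beads_props[of xs c] that by (auto simp: is_partition_def)
  have props: "maya S \<and> charge S = sum c {..<t} \<and> card (inversions_mod t S) = (\<Sum>r<t. sum_list (X r)) \<and>
     moment S = core_size t c + int (t * (\<Sum>r<t. sum_list (X r)))"
    if X: "\<And>r. r < t \<Longrightarrow> is_partition (X r)" and S: "\<And>r. r < t \<Longrightarrow> runner t S r = beads (c r) (X r)" for S c X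
  proof -
    have m: "maya S" using maya_runner_iff[OF t, of S] S bp(1) X by simp
    have "moment S = (\<Sum>r<t. int t * (int (sum_list (X r)) + c r * (c r - 1) div 2) + int r * c r)"
      unfolding moment_runner[OF t m] by (intro sum.cong refl) (simp add: S bp X)
    also have "\<dots> = core_size t c + int (t * (\<Sum>r<t. sum_list (X r)))"
      by (simp add: core_size_def sum.distrib sum_distrib_left algebra_simps)
    finally show ?thesis using m charge_runner[OF t m] card_inversions_mod[OF t m] S bp X by simp
  qed
  have "inj_on ?f ?Y"
  proof (rule inj_onI, clarify)
    fix c X d Y assume a: "c \<in> charge_vectors t" "d \<in> charge_vectors t" "X \<in> partition_tuples t w" "Y \<in> partition_tuples t w"
      and e: "merge_runners t (\<lambda>r. beads (c r) (X r)) = merge_runners t (\<lambda>r. beads (d r) (Y r))"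
    have *: "c r = d r \<and> X r = Y r" if "r < t" for r
    proof -
      have p: "is_partition (X r)" "is_partition (Y r)" using a that by (auto simp: partition_tuples_def)
      have "beads (c r) (X r) = beads (d r) (Y r)"
        using runner_merge[OF that, of "\<lambda>r. beads (c r) (X r)"] runner_merge[OF that, of "\<lambda>r. beads (d r) (Y r)"] e by simp
      then show ?thesis using bp(2)[OF p(1), of "c r"] bp(2)[OF p(2), of "d r"] beads_inj[OF p] by metis
    qed
    show "c = d \<and> X = Y"
    proof
      show "c = d" by (rule PiE_ext[of _ "{..<t}" "\<lambda>_. UNIV"]) (use a * in \<open>auto simp: charge_vectors_def\<close>)
      show "X = Y" by (rule PiE_ext[of _ "{..<t}" "\<lambda>_. Collect is_partition"])
        (use a * in \<open>auto simp: partition_tuples_def\<close>)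
    qed
  qed
  moreover have "?f ` ?Y = ?Z"
  proof (intro equalityI subsetI)
    fix S assume "S \<in> ?f ` ?Y"
    then obtain c X where cX: "c \<in> charge_vectors t" "core_size t c + int (t * w) = int n" "X \<in> partition_tuples t w"
      "S = merge_runners t (\<lambda>r. beads (c r) (X r))" by auto
    have "maya S \<and> charge S = sum c {..<t} \<and> card (inversions_mod t S) = (\<Sum>r<t. sum_list (X r)) \<and>
       moment S = core_size t c + int (t * (\<Sum>r<t. sum_list (X r)))"
      by (rule props) (use cX(3) in \<open>auto simp: cX(4) runner_merge partition_tuples_def\<close>)
    moreover have "sum c {..<t} = 0" "(\<Sum>r<t. sum_list (X r)) = w"
      using cX by (auto simp: charge_vectors_def partition_tuples_def)
    ultimately show "S \<in> ?Z" using cX(2) by simp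
  next
    fix S assume S: "S \<in> ?Z"
    then have "\<forall>r<t. \<exists>xs. is_partition xs \<and> runner t S r = beads (charge (runner t S r)) xs"
      using maya_runner_iff[OF t, of S] beads_surj by blast
    then obtain X where X: "\<And>r. r < t \<Longrightarrow> is_partition (X r) \<and> runner t S r = beads (charge (runner t S r)) (X r)" by metis
    define c where "c = restrict (\<lambda>r. charge (runner t S r)) {..<t}"
    have S2: "runner t S r = beads (c r) (restrict X {..<t} r)" "is_partition (restrict X {..<t} r)" if "r < t" for r
      using X[OF that] that by (auto simp: c_def)
    have "S = merge_runners t (runner t S)" using merge_runner[OF t] by simp
    also have "\<dots> = ?f (c, restrict X {..<t})" unfolding prod.case by (rule merge_cong[OF t]) (use S2 in auto)
    finally have "S = ?f (c, restrict X {..<t})" .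
    moreover have "(c, restrict X {..<t}) \<in> ?Y"
    proof -
      define Y where "Y = restrict X {..<t}"
      have "maya S \<and> charge S = sum c {..<t} \<and> card (inversions_mod t S) = (\<Sum>r<t. sum_list (Y r)) \<and>
         moment S = core_size t c + int (t * (\<Sum>r<t. sum_list (Y r)))"
        by (rule props) (use S2 in \<open>auto simp: Y_def\<close>)
      then have *: "sum c {..<t} = 0" "(\<Sum>r<t. sum_list (Y r)) = w" "core_size t c + int (t * w) = int n"
        using S by auto
      have "c \<in> charge_vectors t" using *(1) by (simp add: charge_vectors_def c_def)
      moreover have "Y \<in> partition_tuples t w" using *(2) X by (auto simp: partition_tuples_def Y_def)
      ultimately show ?thesis using *(3) by (simp add: Y_def)
    qed
    ultimately show "S \<in> ?f ` ?Y" by (rule image_eqI)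
  qed
  ultimately show ?thesis by (simp add: bij_betw_def)
qed

theorem card_partitions_t_hooks:
  assumes "t > 0"
  shows "card {xs. partition_of n xs \<and> size (t_hooks (int t) xs) = w} =
     card {c \<in> charge_vectors t. core_size t c + int (t * w) = int n} * card (partition_tuples t w)"
  using bij_betw_same_card[OF bij_betw_beads[of n t w]] bij_betw_same_card[OF bij_betw_quotient[OF assms, of w n]]
  by (simp add: card_cartesian_product)

subsection \<open>The generating function of partitions\<close>

definition npart :: "nat \<Rightarrow> nat" where
  "npart n = card {xs. partition_of n xs}"

definition npart_le :: "nat \<Rightarrow> nat \<Rightarrow> nat" where
  "npart_le m n = card {xs. partition_of n xs \<and> (\<forall>x\<in>set xs. x \<le> m)}"

lemma finite_partitions: "finite {xs. partition_of n xs}"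
proof (rule finite_subset)
  show "{xs. partition_of n xs} \<subseteq> {xs. set xs \<subseteq> {..n} \<and> length xs \<le> n}"
  proof clarify
    fix xs assume p: "partition_of n xs"
    have "length xs \<le> sum_list xs" if "0 \<notin> set xs" for xs :: "nat list"
      using that by (induction xs) auto
    then show "set xs \<subseteq> {..n} \<and> length xs \<le> n"
      using p by (auto simp: partition_of_def intro: member_le_sum_list)
  qed
qed (simp add: finite_lists_length_le)

lemma npart_le_0: "npart_le 0 n = (if n = 0 then 1 else 0)"
proof -
  have "partition_of n xs \<and> (\<forall>x\<in>set xs. x \<le> 0) \<longleftrightarrow> n = 0 \<and> xs = []" for xs
    by (cases xs) (auto simp: partition_of_def)
  then have "{xs. partition_of n xs \<and> (\<forall>x\<in>set xs. x \<le> 0)} = (if n = 0 then {[]} else {})"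
    by auto
  then show ?thesis by (simp add: npart_le_def)
qed

text \<open>Either no part equals m + 1, or the first part does and is removed. In generating
  functions this is division by 1 - q^(m+1).\<close>

lemma npart_le_Suc:
  "npart_le (Suc m) n = npart_le m n + (if Suc m \<le> n then npart_le (Suc m) (n - Suc m) else 0)"
proof -
  let ?A = "\<lambda>m n. {xs. partition_of n xs \<and> (\<forall>x\<in>set xs. x \<le> m)}"
  have fin: "finite (?A m n)" for m n by (rule finite_subset[OF _ finite_partitions[of n]]) auto
  have "?A (Suc m) n = ?A m n \<union> (if Suc m \<le> n then (#) (Suc m) ` ?A (Suc m) (n - Suc m) else {})"
    (is "?L = ?R")
  proof (intro equalityI subsetI)
    fix xs assume xs: "xs \<in> ?L"
    show "xs \<in> ?R"
    proof (cases "\<forall>x\<in>set xs. x \<le> m")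
      case False
      then obtain y ys where ys: "xs = y # ys" by (cases xs) auto
      then have y: "y = Suc m" using False xs by (force simp: partition_of_def)
      then have n: "n = Suc m + sum_list ys" using xs ys by (simp add: partition_of_def)
      then have "Suc m \<le> n" "ys \<in> ?A (Suc m) (n - Suc m)" using xs ys by (auto simp: partition_of_def)
      then show ?thesis using ys y by auto
    qed (use xs in auto)
  next
    fix xs assume "xs \<in> ?R"
    then show "xs \<in> ?L" by (auto simp: partition_of_def split: if_splits)
  qed
  moreover have "?A m n \<inter> (#) (Suc m) ` B = {}" for B by auto
  ultimately show ?thesis unfolding npart_le_def
    by (simp add: card_Un_disjoint fin card_image)
qed

lemma npart_le_eq: "n \<le> m \<Longrightarrow> npart_le m n = npart n"
proof -
  assume "n \<le> m"
  then have "{xs. partition_of n xs \<and> (\<forall>x\<in>set xs. x \<le> m)} = {xs. partition_of n xs}"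
    by (auto simp: partition_of_def dest!: member_le_sum_list)
  then show ?thesis by (simp add: npart_le_def npart_def)
qed

lemma npart_le_le: "npart_le m n \<le> npart n"
  unfolding npart_le_def npart_def by (rule card_mono[OF finite_partitions]) auto

lemma power_Suc_lt_one: "0 \<le> q \<Longrightarrow> q < 1 \<Longrightarrow> q ^ Suc m < (1 :: real)"
  using power_decreasing[of 1 "Suc m" q] by simp

text \<open>Formulated with finite sums of nonnegative terms, so that no convergence is presupposed:
  it is the source of the convergence of the partition series.\<close>

lemma npart_le_partial_sum:
  fixes q :: real
  assumes "0 \<le> q" "q < 1"
  shows "(\<Sum>n<M. real (npart_le m n) * q ^ n) \<le> (\<Prod>k=1..m. 1 / (1 - q ^ k))"
proof (induction m)
  case 0
  have "(\<Sum>n<M. real (npart_le 0 n) * q ^ n) = (\<Sum>n<M. if n = 0 then 1 else 0)"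
    by (rule sum.cong) (auto simp: npart_le_0)
  also have "\<dots> \<le> 1" by (subst sum.delta) auto
  finally show ?case by simp
next
  case (Suc m)
  let ?S = "\<lambda>m. \<Sum>n<M. real (npart_le m n) * q ^ n"
  have q: "q ^ Suc m < 1" using power_Suc_lt_one[OF assms] .
  have "?S (Suc m) = ?S m + (\<Sum>n<M. if Suc m \<le> n then real (npart_le (Suc m) (n - Suc m)) * q ^ n else 0)"
    unfolding sum.distrib[symmetric]
    by (rule sum.cong[OF refl], subst npart_le_Suc) (simp add: distrib_right)
  also have "(\<Sum>n<M. if Suc m \<le> n then real (npart_le (Suc m) (n - Suc m)) * q ^ n else 0) =
     (\<Sum>n\<in>{Suc m..<M}. real (npart_le (Suc m) (n - Suc m)) * q ^ n)"
    by (subst sum.inter_filter[symmetric]) (auto intro!: sum.cong)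
  also have "\<dots> = (\<Sum>n<M - Suc m. real (npart_le (Suc m) n) * q ^ (n + Suc m))"
    by (rule sum.reindex_bij_witness[of _ "\<lambda>n. n + Suc m" "\<lambda>n. n - Suc m"]) auto
  also have "\<dots> \<le> (\<Sum>n<M. real (npart_le (Suc m) n) * q ^ (n + Suc m))"
    by (rule sum_mono2) (use assms in auto)
  also have "\<dots> = q ^ Suc m * ?S (Suc m)"
    by (simp add: sum_distrib_left power_add algebra_simps)
  finally have "?S (Suc m) \<le> ?S m / (1 - q ^ Suc m)"
    using q by (simp add: field_simps)
  also have "\<dots> \<le> (\<Prod>k=1..m. 1 / (1 - q ^ k)) / (1 - q ^ Suc m)"
    using Suc q by (intro divide_right_mono) auto
  finally show ?case by (simp add: mult.commute)
qed

text \<open>From 1/(1 - y) = 1 + y/(1 - y) <= exp(y/(1 - y)) with y = q^k, where 1 - q^k >= 1 - q,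
  and a geometric series for the exponents.\<close>

lemma euler_product_bound:
  fixes q :: real
  assumes "0 \<le> q" "q < 1"
  shows "(\<Prod>k=1..m. 1 / (1 - q ^ k)) \<le> exp (1 / (1 - q)\<^sup>2)"
proof -
  have qk: "0 \<le> q ^ k" "q ^ k \<le> q" if "k \<ge> 1" for k
    using assms that power_decreasing[of 1 k q] by auto
  have "(\<Prod>k=1..m. 1 / (1 - q ^ k)) \<le> (\<Prod>k=1..m. exp (q ^ k / (1 - q)))"
  proof (rule prod_mono, safe)
    fix k assume k: "k \<in> {1..m}"
    have "q ^ k < 1" using qk[of k] k assms by simp
    then have "1 / (1 - q ^ k) = 1 + q ^ k / (1 - q ^ k)" by (simp add: field_simps)
    also have "\<dots> \<le> exp (q ^ k / (1 - q ^ k))" by (rule exp_ge_add_one_self)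
    also have "\<dots> \<le> exp (q ^ k / (1 - q))"
      using qk[of k] k assms by (auto intro!: divide_left_mono mult_pos_pos)
    finally show "1 / (1 - q ^ k) \<le> exp (q ^ k / (1 - q))" .
    show "0 \<le> 1 / (1 - q ^ k)" using \<open>q ^ k < 1\<close> by simp
  qed
  also have "\<dots> = exp ((\<Sum>k=1..m. q ^ k) / (1 - q))"
    by (simp add: exp_sum sum_divide_distrib)
  also have "\<dots> \<le> exp ((1 / (1 - q)) / (1 - q))"
  proof -
    have "(\<Sum>k=1..m. q ^ k) \<le> (\<Sum>k. q ^ k)"
      by (rule sum_le_suminf) (use assms in \<open>auto intro: summable_geometric\<close>)
    then show ?thesis unfolding exp_le_cancel_iff using assms
      by (intro divide_right_mono) (simp_all add: suminf_geometric)
  qed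
  finally show ?thesis by (simp add: power2_eq_square)
qed

lemma summable_npart_real:
  fixes q :: real
  assumes "0 \<le> q" "q < 1"
  shows "summable (\<lambda>n. real (npart n) * q ^ n)"
proof (rule bounded_imp_summable)
  fix M
  have "(\<Sum>n\<le>M. real (npart n) * q ^ n) = (\<Sum>n<Suc M. real (npart_le M n) * q ^ n)"
    by (rule sum.cong) (auto simp: npart_le_eq)
  also have "\<dots> \<le> (\<Prod>k=1..M. 1 / (1 - q ^ k))" by (rule npart_le_partial_sum[OF assms])
  also have "\<dots> \<le> exp (1 / (1 - q)\<^sup>2)" by (rule euler_product_bound[OF assms])
  finally show "(\<Sum>n\<le>M. real (npart n) * q ^ n) \<le> exp (1 / (1 - q)\<^sup>2)" .
qed (use assms in simp)

text \<open>Generic in the field: the contour integral needs complex arguments, the analysis on the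
  axis real ones, and \<open>part_gf_of_real\<close> links the two.\<close>

definition part_gf :: "'a :: {real_normed_field, banach} \<Rightarrow> 'a" where
  "part_gf q = (\<Sum>n. of_nat (npart n) * q ^ n)"

context
  fixes q :: "'a :: {real_normed_field, banach}"
  assumes q: "norm q < 1"
begin

lemma norm_summable_npart: "summable (\<lambda>n. norm (of_nat (npart n) * q ^ n))"
  using summable_npart_real[of "norm q"] q by (simp add: norm_mult norm_power)

lemma norm_summable_npart_le: "summable (\<lambda>n. norm (of_nat (npart_le m n) * q ^ n))"
  by (rule summable_comparison_test'[OF norm_summable_npart, of 0])
     (auto simp: norm_mult npart_le_le intro!: mult_right_mono)

lemma pow_neq_1: "1 - q ^ Suc m \<noteq> 0"
proof
  assume "1 - q ^ Suc m = 0"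
  then have "q ^ Suc m = 1" by (metis right_minus_eq)
  then have "norm (q ^ Suc m) = 1" by (simp only: norm_one)
  then show False using q power_Suc_lt_one[of "norm q" m] by (simp add: norm_power norm_mult)
qed

lemma npart_le_gf: "(\<Sum>n. of_nat (npart_le m n) * q ^ n) = (\<Prod>k=1..m. 1 / (1 - q ^ k))"
proof (induction m)
  case 0
  have "(\<Sum>n. of_nat (npart_le 0 n) * q ^ n) = (\<Sum>n\<in>{0}. of_nat (npart_le 0 n) * q ^ n)"
    by (rule suminf_finite) (auto simp: npart_le_0)
  then show ?case by (simp add: npart_le_0)
next
  case (Suc m)
  let ?f = "\<lambda>m n. of_nat (npart_le m n) * q ^ n"
  have s: "summable (?f m)" for m using norm_summable_npart_le by (rule summable_norm_cancel)
  define g where "g = (\<lambda>n. if Suc m \<le> n then of_nat (npart_le (Suc m) (n - Suc m)) * q ^ n else 0)"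
  have fg: "?f (Suc m) n = ?f m n + g n" for n
    by (subst npart_le_Suc) (simp add: g_def distrib_right)
  have sg: "summable g"
  proof -
    have "g = (\<lambda>n. ?f (Suc m) n - ?f m n)" using fg by (auto simp: fun_eq_iff)
    then show ?thesis using s by (simp add: summable_diff)
  qed
  have "suminf g = (\<Sum>n. g (n + Suc m)) + (\<Sum>n<Suc m. g n)"
    by (rule suminf_split_initial_segment[OF sg])
  also have "(\<Sum>n<Suc m. g n) = 0" by (rule sum.neutral) (auto simp: g_def)
  also have "(\<Sum>n. g (n + Suc m)) = (\<Sum>n. q ^ Suc m * ?f (Suc m) n)"
    by (rule suminf_cong) (simp add: g_def power_add algebra_simps)
  also have "\<dots> = q ^ Suc m * suminf (?f (Suc m))" by (rule suminf_mult[OF s])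
  finally have "suminf g = q ^ Suc m * suminf (?f (Suc m))" by simp
  moreover have "suminf (?f (Suc m)) = suminf (?f m) + suminf g"
    unfolding fg by (rule suminf_add[OF s sg, symmetric])
  ultimately have "suminf (?f (Suc m)) * (1 - q ^ Suc m) = suminf (?f m)"
    by (simp add: algebra_simps)
  then have "suminf (?f (Suc m)) = suminf (?f m) / (1 - q ^ Suc m)"
    using pow_neq_1[of m] by (simp add: field_simps)
  then show ?case using Suc by (simp add: mult.commute)
qed

text \<open>Each coefficient \<open>npart_le m k\<close> is eventually equal to
  \<open>npart k\<close> and never exceeds it, so the partition series itself is the majorant for
  passing to the limit in m.\<close>

lemma euler_product: "(\<lambda>m. \<Prod>k=1..m. 1 / (1 - q ^ k)) \<longlonglongrightarrow> part_gf q"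
proof -
  have "((\<lambda>m. \<Sum>n. of_nat (npart_le m n) * q ^ n) \<longlonglongrightarrow> (\<Sum>n. of_nat (npart n) * q ^ n))"
  proof (rule tannerys_theorem[THEN conjunct2, THEN conjunct2])
    fix k
    show "(\<lambda>m. of_nat (npart_le m k) * q ^ k) \<longlonglongrightarrow> of_nat (npart k) * q ^ k"
      by (rule tendsto_eventually) (auto simp: npart_le_eq intro!: eventually_sequentiallyI[of k])
    show "\<forall>\<^sub>F (k, n) in sequentially \<times>\<^sub>F sequentially.
      norm (of_nat (npart_le n k) * q ^ k) \<le> norm (of_nat (npart k) * q ^ k)"
      by (rule always_eventually) (auto simp: norm_mult npart_le_le intro!: mult_right_mono)
  qed (simp_all add: norm_summable_npart)
  then show ?thesis by (simp add: npart_le_gf part_gf_def)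
qed

end

section \<open>The logarithm of the Euler product\<close>

lemma neg_Ln_sums:
  fixes z :: complex
  assumes "norm z < 1"
  shows "(\<lambda>k. z ^ Suc k / of_nat (Suc k)) sums (- Ln (1 - z))"
proof -
  have "(\<lambda>n. - (z ^ n) / of_nat n) sums Ln (1 - z)" using Ln_series'[of "-z"] assms by simp
  then have "(\<lambda>n. z ^ n / of_nat n) sums (- Ln (1 - z))"
    using sums_minus by fastforce
  then show ?thesis by (subst sums_Suc_iff) simp
qed

lemma geometric_sums_Suc:
  fixes z :: "'a :: {real_normed_field, banach}"
  assumes "norm z < 1"
  shows "(\<lambda>j. z ^ Suc j) sums (z / (1 - z))"
  using sums_mult[OF geometric_sums[OF assms], of z] by simp

lemma sum_power_Suc:
  fixes z :: "'a :: {real_normed_field, banach}"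
  shows "(\<Sum>j=1..m. z ^ j) = (\<Sum>j<m. z ^ Suc j)"
  by (rule sum.reindex_bij_witness[of _ Suc "\<lambda>j. j - 1"]) auto

text \<open>The logarithms of the factors 1/(1 - q^j) are expanded and summed over j first, which
  gives the geometric series q^k/(1 - q^k). For a finite product this only exchanges a finite sum
  with a series; Tannery's theorem then lets the number of factors grow. Asserting the exponential
  of the series keeps the branches of \<open>Ln\<close> out of the result.\<close>

lemma exp_euler_series:
  fixes q :: complex
  assumes q: "norm q < 1"
  shows "summable (\<lambda>k. norm (q ^ Suc k / (1 - q ^ Suc k) / of_nat (Suc k)))"
    and "exp (\<Sum>k. q ^ Suc k / (1 - q ^ Suc k) / of_nat (Suc k)) = part_gf q"
proof -
  let ?a = "\<lambda>k m. (\<Sum>j=1..m. (q ^ Suc k) ^ j) / of_nat (Suc k)"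
  let ?b = "\<lambda>k. q ^ Suc k / (1 - q ^ Suc k) / of_nat (Suc k)"
  have qk: "norm (q ^ Suc k) < 1" for k
    using q power_Suc_lt_one[of "norm q" k] by (simp add: norm_power norm_mult)
  have T: "summable (\<lambda>k. norm (?b k)) \<and> (\<lambda>m. \<Sum>k. ?a k m) \<longlonglongrightarrow> suminf ?b"
  proof (rule tannerys_theorem[THEN conjunct2])
    fix k
    show "?a k \<longlonglongrightarrow> ?b k"
      using geometric_sums_Suc[OF qk[of k]] unfolding sums_def sum_power_Suc
      by (rule tendsto_divide[OF _ tendsto_const of_nat_neq_0])
    show "\<forall>\<^sub>F (k, n) in sequentially \<times>\<^sub>F sequentially. norm (?a k n) \<le> norm q ^ Suc k / (1 - norm q)"
    proof (rule always_eventually, clarify)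
      fix k n
      define x where "x = norm q ^ Suc k"
      have x: "0 \<le> x" "x < 1" "x \<le> norm q"
        using qk[of k] q power_decreasing[of 1 "Suc k" "norm q"] by (auto simp: x_def norm_power norm_mult)
      have "norm (?a k n) = norm (\<Sum>j=1..n. (q ^ Suc k) ^ j) / real (Suc k)"
        by (simp add: norm_divide del: of_nat_Suc)
      also have "\<dots> \<le> norm (\<Sum>j=1..n. (q ^ Suc k) ^ j)" by (simp add: divide_le_eq mult_le_cancel_left1)
      also have "\<dots> \<le> (\<Sum>j=1..n. norm ((q ^ Suc k) ^ j))" by (rule norm_sum)
      also have "\<dots> = (\<Sum>j<n. x ^ Suc j)"
        using sum_power_Suc[of x n] by (simp add: x_def norm_power norm_mult)
      also have "\<dots> \<le> (\<Sum>j. x ^ Suc j)"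
        using geometric_sums_Suc[of x] x by (intro sum_le_suminf) (auto dest: sums_summable)
      also have "\<dots> = x / (1 - x)" using sums_unique[OF geometric_sums_Suc[of x]] x by simp
      also have "\<dots> \<le> x / (1 - norm q)" using x q by (intro divide_left_mono mult_pos_pos) auto
      finally show "norm (?a k n) \<le> norm q ^ Suc k / (1 - norm q)" by (simp add: x_def)
    qed
    show "summable (\<lambda>k. norm q ^ Suc k / (1 - norm q))"
      using geometric_sums_Suc[of "norm q"] q by (intro summable_divide) (auto dest: sums_summable)
  qed simp
  then show "summable (\<lambda>k. norm (?b k))" by blast
  have "exp (\<Sum>k. ?a k m) = (\<Prod>j=1..m. 1 / (1 - q ^ j))" for m
  proof -
    have qj: "norm (q ^ j) < 1" if "j \<in> {1..m}" for j
    proof -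
      have "Suc (j - 1) = j" using that by auto
      then show ?thesis using qk[of "j - 1"] by metis
    qed
    have "(\<lambda>k. \<Sum>j=1..m. (q ^ j) ^ Suc k / of_nat (Suc k)) sums (\<Sum>j=1..m. - Ln (1 - q ^ j))"
      by (rule sums_sum) (use neg_Ln_sums qj in blast)
    moreover have "(\<Sum>j=1..m. (q ^ j) ^ Suc k / of_nat (Suc k)) = ?a k m" for k
      by (simp add: sum_divide_distrib power_mult[symmetric] mult.commute del: power_Suc of_nat_Suc)
    ultimately have "(\<lambda>k. ?a k m) sums (\<Sum>j=1..m. - Ln (1 - q ^ j))" by (simp only:)
    then have "(\<Sum>k. ?a k m) = (\<Sum>j=1..m. - Ln (1 - q ^ j))" by (rule sums_unique[symmetric])
    also have "exp \<dots> = (\<Prod>j=1..m. exp (- Ln (1 - q ^ j)))" by (rule exp_sum) simp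
    also have "\<dots> = (\<Prod>j=1..m. 1 / (1 - q ^ j))"
    proof (rule prod.cong[OF refl])
      fix j assume "j \<in> {1..m}"
      then have "1 - q ^ j \<noteq> 0" using qj by force
      then show "exp (- Ln (1 - q ^ j)) = 1 / (1 - q ^ j)" by (simp add: exp_minus field_simps)
    qed
    finally show ?thesis .
  qed
  then have "(\<lambda>m. exp (\<Sum>k. ?a k m)) \<longlonglongrightarrow> part_gf q" using euler_product[OF q] by simp
  moreover have "(\<lambda>m. exp (\<Sum>k. ?a k m)) \<longlonglongrightarrow> exp (suminf ?b)" using T by (intro tendsto_exp) blast
  ultimately show "exp (suminf ?b) = part_gf q" using LIMSEQ_unique by blast
qed

text \<open>The logarithm of the generating function at \<open>q = exp (- s)\<close>.\<close>

definition log_gf :: "'a :: {real_normed_field, banach} \<Rightarrow> 'a" where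
  "log_gf s = (\<Sum>k. 1 / (of_nat (Suc k) * (exp (of_nat (Suc k) * s) - 1)))"

lemma exp_log_gf:
  fixes s :: complex
  assumes "Re s > 0"
  shows "summable (\<lambda>k. norm (1 / (of_nat (Suc k) * (exp (of_nat (Suc k) * s) - 1))))"
    and "exp (log_gf s) = part_gf (exp (- s))"
proof -
  have q: "norm (exp (- s)) < 1" using assms by simp
  have *: "exp (- s) ^ Suc k / (1 - exp (- s) ^ Suc k) / of_nat (Suc k) = 1 / (of_nat (Suc k) * (exp (of_nat (Suc k) * s) - 1))" for k
  proof -
    have e: "exp (- s) ^ Suc k = 1 / exp (of_nat (Suc k) * s)"
    proof -
      have "exp (- s) ^ Suc k = exp (of_nat (Suc k) * (- s))" by (rule exp_of_nat_mult[symmetric])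
      then show ?thesis by (simp only: mult_minus_right exp_minus inverse_eq_divide)
    qed
    show ?thesis unfolding e by (simp add: divide_simps del: of_nat_Suc)
  qed
  show "summable (\<lambda>k. norm (1 / (of_nat (Suc k) * (exp (of_nat (Suc k) * s) - 1))))"
    using exp_euler_series(1)[OF q] unfolding * .
  show "exp (log_gf s) = part_gf (exp (- s))"
    using exp_euler_series(2)[OF q] unfolding * log_gf_def .
qed

lemma log_gf_of_real: "s > 0 \<Longrightarrow> (of_real (log_gf s) :: complex) = log_gf (of_real s)"
proof -
  assume s: "s > 0"
  have *: "(1 / (of_nat (Suc k) * (exp (of_nat (Suc k) * of_real s) - 1)) :: complex) =
     of_real (1 / (of_nat (Suc k) * (exp (of_nat (Suc k) * s) - 1)))" for k
    by (simp add: exp_of_real[symmetric])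
  have "summable (\<lambda>k. norm (of_real (1 / (of_nat (Suc k) * (exp (of_nat (Suc k) * s) - 1))) :: complex))"
    using exp_log_gf(1)[of "of_real s"] s unfolding * by simp
  then have "summable (\<lambda>k. (of_real (1 / (of_nat (Suc k) * (exp (of_nat (Suc k) * s) - 1))) :: complex))"
    by (rule summable_norm_cancel)
  then have "summable (\<lambda>k. 1 / (of_nat (Suc k) * (exp (of_nat (Suc k) * s) - 1)) :: real)"
    by (simp only: summable_complex_of_real)
  then show ?thesis unfolding log_gf_def * by (rule suminf_of_real)
qed

lemma part_gf_of_real: "norm q < 1 \<Longrightarrow> (of_real (part_gf q) :: complex) = part_gf (of_real q)"
  unfolding part_gf_def
  using summable_norm_cancel[OF norm_summable_npart[of q]] by (subst suminf_of_real) simp_all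

lemma exp_log_gf_real:
  fixes s :: real
  assumes "s > 0"
  shows "exp (log_gf s) = part_gf (exp (- s))"
proof -
  have "complex_of_real (exp (log_gf s)) = complex_of_real (part_gf (exp (- s)))"
    using exp_log_gf(2)[of "of_real s"] assms
    by (simp add: log_gf_of_real exp_of_real[symmetric] part_gf_of_real)
  then show ?thesis by (simp only: of_real_eq_iff)
qed

section \<open>Tuples of partitions and their generating function\<close>

definition tuple_count :: "nat \<Rightarrow> nat \<Rightarrow> nat" where
  "tuple_count t w = card (partition_tuples t w)"

lemma partition_tuples_0: "partition_tuples 0 w = (if w = 0 then {\<lambda>_. undefined} else {})"
  by (auto simp: partition_tuples_def)

lemma bij_betw_partition_tuples_Suc:
  "bij_betw (\<lambda>(v, xs, X). X(t := xs))
     (SIGMA v:{..w}. {xs. partition_of v xs} \<times> partition_tuples t (w - v)) (partition_tuples (Suc t) w)"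
proof (rule bij_betw_byWitness[of _ "\<lambda>Y. (sum_list (Y t), Y t, restrict Y {..<t})"])
  show "\<forall>p\<in>SIGMA v:{..w}. {xs. partition_of v xs} \<times> partition_tuples t (w - v).
    (\<lambda>Y. (sum_list (Y t), Y t, restrict Y {..<t})) (case p of (v, xs, X) \<Rightarrow> X(t := xs)) = p"
    by (auto simp: partition_tuples_def partition_of_iff fun_eq_iff PiE_def extensional_def)
  show "\<forall>Y\<in>partition_tuples (Suc t) w.
    (case (sum_list (Y t), Y t, restrict Y {..<t}) of (v, xs, X) \<Rightarrow> X(t := xs)) = Y"
    by (auto simp: partition_tuples_def fun_eq_iff PiE_def extensional_def)
  show "(\<lambda>(v, xs, X). X(t := xs)) ` (SIGMA v:{..w}. {xs. partition_of v xs} \<times> partition_tuples t (w - v))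
      \<subseteq> partition_tuples (Suc t) w"
    by (auto simp: partition_tuples_def partition_of_iff lessThan_Suc PiE_def Pi_def extensional_def cong: sum.cong_simp)
  show "(\<lambda>Y. (sum_list (Y t), Y t, restrict Y {..<t})) ` partition_tuples (Suc t) w
    \<subseteq> (SIGMA v:{..w}. {xs. partition_of v xs} \<times> partition_tuples t (w - v))"
    by (auto simp: partition_tuples_def partition_of_iff lessThan_Suc PiE_def Pi_def extensional_def)
qed

lemma finite_partition_tuples: "finite (partition_tuples t w)"
proof (induction t arbitrary: w)
  case (Suc t)
  show ?case
    using bij_betw_finite[OF bij_betw_partition_tuples_Suc[of t w]] Suc finite_partitions by auto
qed (simp add: partition_tuples_0)

lemma tuple_count_0: "tuple_count 0 w = (if w = 0 then 1 else 0)"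
  by (simp add: tuple_count_def partition_tuples_0)

lemma tuple_count_Suc: "tuple_count (Suc t) w = (\<Sum>v\<le>w. npart v * tuple_count t (w - v))"
  unfolding tuple_count_def bij_betw_same_card[OF bij_betw_partition_tuples_Suc[of t w], symmetric]
  by (simp add: card_cartesian_product npart_def finite_partition_tuples finite_partitions)

lemma tuple_count_1: "tuple_count 1 w = npart w"
proof -
  have "tuple_count 1 w = (\<Sum>v\<le>w. if v = w then npart v else 0)"
    unfolding One_nat_def tuple_count_Suc by (rule sum.cong) (auto simp: tuple_count_0)
  then show ?thesis by simp
qed

lemma tuple_count_sums_aux:
  fixes q :: "'a :: {real_normed_field, banach}"
  assumes "norm q < 1" "summable (\<lambda>n. norm (of_nat (tuple_count t n) * q ^ n))"
    "(\<lambda>n. of_nat (tuple_count t n) * q ^ n) sums (part_gf q ^ t)"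
  shows "(\<lambda>n. of_nat (tuple_count (Suc t) n) * q ^ n) sums (part_gf q ^ Suc t)"
proof -
  have "(\<lambda>k. \<Sum>i\<le>k. (of_nat (npart i) * q ^ i) * (of_nat (tuple_count t (k - i)) * q ^ (k - i)))
     sums (part_gf q * part_gf q ^ t)"
    using Cauchy_product_sums[OF norm_summable_npart[OF assms(1)] assms(2)] sums_unique[OF assms(3)]
    by (simp add: part_gf_def)
  moreover have *: "(of_nat (npart i) * q ^ i) * (of_nat (tuple_count t (k - i)) * q ^ (k - i)) =
    of_nat (npart i * tuple_count t (k - i)) * q ^ k" if "i \<le> k" for i k
  proof -
    have "q ^ k = q ^ i * q ^ (k - i)" using that by (simp flip: power_add)
    then show ?thesis by simp
  qed
  have "(\<Sum>i\<le>k. (of_nat (npart i) * q ^ i) * (of_nat (tuple_count t (k - i)) * q ^ (k - i))) =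
    (\<Sum>i\<le>k. of_nat (npart i * tuple_count t (k - i)) * q ^ k)" for k
    by (intro sum.cong[OF refl]) (use * in blast)
  then have "(\<Sum>i\<le>k. (of_nat (npart i) * q ^ i) * (of_nat (tuple_count t (k - i)) * q ^ (k - i))) =
    of_nat (tuple_count (Suc t) k) * q ^ k" for k
    by (simp only: tuple_count_Suc of_nat_sum sum_distrib_right)
  ultimately show ?thesis by simp
qed

lemma tuple_count_sums_0:
  fixes q :: "'a :: {real_normed_field, banach}"
  shows "(\<lambda>n. of_nat (tuple_count 0 n) * q ^ n) sums (part_gf q ^ 0)"
    using sums_finite[of "{0}" "\<lambda>n. of_nat (tuple_count 0 n) * q ^ n"] by (simp add: tuple_count_0)

text \<open>For nonnegative q convergence is absolute convergence, so the induction through Cauchy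
  products closes by itself. Applied to \<open>norm q\<close>, it provides the absolute convergence
  for all q in the unit disc.\<close>

lemma tuple_count_sums_real:
  fixes q :: real
  assumes "0 \<le> q" "q < 1"
  shows "(\<lambda>n. real (tuple_count t n) * q ^ n) sums (part_gf q ^ t)"
proof (induction t)
  case 0
  then show ?case using tuple_count_sums_0[of q] by simp
next
  case (Suc t)
  have "summable (\<lambda>n. norm (of_nat (tuple_count t n) * q ^ n))"
    using Suc assms by (simp add: sums_iff)
  then show ?case using tuple_count_sums_aux[of q t] Suc assms by simp
qed

lemma tuple_count_sums:
  fixes q :: "'a :: {real_normed_field, banach}"
  assumes "norm q < 1"
  shows norm_summable_tuple_count: "summable (\<lambda>n. norm (of_nat (tuple_count t n) * q ^ n))"
    and tuple_count_gf: "(\<lambda>n. of_nat (tuple_count t n) * q ^ n) sums (part_gf q ^ t)"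
proof -
  show *: "summable (\<lambda>n. norm (of_nat (tuple_count t n) * q ^ n))" for t
    using tuple_count_sums_real[of "norm q" t] assms by (simp add: norm_mult norm_power sums_iff)
  show "(\<lambda>n. of_nat (tuple_count t n) * q ^ n) sums (part_gf q ^ t)"
    by (induction t) (use tuple_count_sums_0 tuple_count_sums_aux[OF assms *] in blast)+
qed

section \<open>Coefficients as integrals over a circle\<close>

lemma integral_cis:
  fixes m :: int
  shows "has_bochner_integral lborel (\<lambda>x. indicator {- pi..pi} x *\<^sub>R exp (\<i> * of_int m * of_real x))
     (if m = 0 then 2 * of_real pi else 0)"
proof (cases "m = 0")
  case True
  have "has_bochner_integral lborel (\<lambda>x. indicator {- pi..pi} x *\<^sub>R (1 :: complex)) (of_real pi - of_real (- pi))"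
    by (rule has_bochner_integral_FTC_Icc) (auto intro!: derivative_eq_intros)
  then show ?thesis using True by simp
next
  case False
  define F where "F = (\<lambda>x. exp (\<i> * of_int m * of_real x) / (\<i> * of_int m))"
  have "has_bochner_integral lborel (\<lambda>x. indicator {- pi..pi} x *\<^sub>R exp (\<i> * of_int m * of_real x)) (F pi - F (- pi))"
  proof (rule has_bochner_integral_FTC_Icc)
    fix x
    have "((\<lambda>z. exp (\<i> * of_int m * z) / (\<i> * of_int m)) has_field_derivative exp (\<i> * of_int m * of_real x)) (at (of_real x))"
      using False by (auto intro!: derivative_eq_intros)
    then show "(F has_vector_derivative exp (\<i> * of_int m * of_real x)) (at x within {- pi..pi})"
      unfolding F_def by (rule has_vector_derivative_real_field)
  qed (auto intro!: continuous_intros)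
  moreover have "F pi - F (- pi) = 0"
  proof -
    have "exp (\<i> * of_int m * of_real pi) = exp (\<i> * of_int m * of_real (- pi)) * exp (of_int m * (2 * of_real pi * \<i>))"
      by (simp flip: exp_add) (simp add: algebra_simps)
    also have "exp (of_int m * (2 * of_real pi * \<i>)) = 1"
      using exp_integer_2pi[of "of_int m"] by (simp add: algebra_simps)
    finally show ?thesis by (simp add: F_def)
  qed
  ultimately show ?thesis using False by simp
qed

text \<open>The arc is encoded by an indicator on the whole line, so that the later substitution x =
  h u and dominated convergence need no moving limits of integration.\<close>

lemma coefficient_integral:
  fixes a :: "nat \<Rightarrow> real" and \<rho> :: real
  assumes "summable (\<lambda>k. \<bar>a k * \<rho> ^ k\<bar>)"
  shows "(LINT x|lborel. indicator {- pi..pi} x *\<^sub>R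
            ((\<Sum>k. of_real (a k) * (of_real \<rho> * exp (\<i> * of_real x)) ^ k) * exp (- (\<i> * of_nat n * of_real x))))
         = of_real (2 * pi * a n * \<rho> ^ n)"
proof -
  define f where "f = (\<lambda>k x. of_real (a k * \<rho> ^ k) * (indicator {- pi..pi} x *\<^sub>R exp (\<i> * of_int (int k - int n) * of_real x)))"
  have hb: "has_bochner_integral lborel (f k) (of_real (a k * \<rho> ^ k) * (if int k - int n = 0 then 2 * of_real pi else 0))" for k
    unfolding f_def by (intro has_bochner_integral_mult_right integral_cis)
  have norm_f: "norm (f k x) = indicator {- pi..pi} x * \<bar>a k * \<rho> ^ k\<bar>" for k x
    by (simp add: f_def norm_mult indicator_def norm_power abs_mult power_abs)
  have int_norm: "(LINT x|lborel. norm (f k x)) = 2 * pi * \<bar>a k * \<rho> ^ k\<bar>" for k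
    by (simp add: norm_f)
  have "(\<lambda>k. integral\<^sup>L lborel (f k)) sums (LINT x|lborel. (\<Sum>k. f k x))"
  proof (rule sums_integral)
    show "integrable lborel (f k)" for k using hb by (auto simp: has_bochner_integral_iff)
    show "AE x in lborel. summable (\<lambda>k. norm (f k x))"
      unfolding norm_f by (intro AE_I2 summable_mult assms)
    show "summable (\<lambda>k. LINT x|lborel. norm (f k x))"
      unfolding int_norm by (intro summable_mult assms)
  qed
  moreover have "(\<lambda>k. integral\<^sup>L lborel (f k)) sums (\<Sum>k\<in>{n}. integral\<^sup>L lborel (f k))"
    by (rule sums_finite) (use hb in \<open>auto simp: has_bochner_integral_iff\<close>)
  ultimately have "(LINT x|lborel. (\<Sum>k. f k x)) = integral\<^sup>L lborel (f n)"
    using sums_unique2 by fastforce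
  also have "\<dots> = of_real (2 * pi * a n * \<rho> ^ n)"
    using hb[of n] by (simp add: has_bochner_integral_iff)
  also have "(\<lambda>x. \<Sum>k. f k x) = (\<lambda>x. indicator {- pi..pi} x *\<^sub>R
            ((\<Sum>k. of_real (a k) * (of_real \<rho> * exp (\<i> * of_real x)) ^ k) * exp (- (\<i> * of_nat n * of_real x))))"
  proof
    fix x
    have s: "summable (\<lambda>k. of_real (a k) * (of_real \<rho> * exp (\<i> * of_real x)) ^ k)"
      by (rule summable_norm_cancel) (use assms in \<open>simp add: norm_mult norm_power abs_mult power_abs\<close>)
    have e: "f k x = indicator {- pi..pi} x *\<^sub>R (of_real (a k) * (of_real \<rho> * exp (\<i> * of_real x)) ^ k * exp (- (\<i> * of_nat n * of_real x)))" for k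
    proof -
      have "exp (\<i> * of_int (int k - int n) * of_real x) = exp (\<i> * of_real x) ^ k * exp (- (\<i> * of_nat n * of_real x))"
        unfolding exp_of_nat_mult[symmetric] exp_add[symmetric] by (simp add: algebra_simps)
      then show ?thesis by (simp add: f_def power_mult_distrib)
    qed
    show "(\<Sum>k. f k x) = indicator {- pi..pi} x *\<^sub>R
            ((\<Sum>k. of_real (a k) * (of_real \<rho> * exp (\<i> * of_real x)) ^ k) * exp (- (\<i> * of_nat n * of_real x)))"
      unfolding e by (subst suminf_scaleR_right[symmetric]; (subst suminf_mult2[symmetric])?) (use s in \<open>auto intro: summable_mult2\<close>)
  qed
  finally show ?thesis .
qed

lemma tuple_count_integral:
  assumes "\<sigma> > 0"
  shows "(LINT x|lborel. indicator {- pi..pi} x *\<^sub>R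
            exp (of_nat t * log_gf (of_real \<sigma> - \<i> * of_real x) - \<i> * of_nat n * of_real x))
         = of_real (2 * pi * real (tuple_count t n) * exp (- (real n * \<sigma>)))"
proof -
  have "(\<Sum>k. of_real (real (tuple_count t k)) * (of_real (exp (- \<sigma>)) * exp (\<i> * of_real x)) ^ k) =
     exp (of_nat t * log_gf (of_real \<sigma> - \<i> * of_real x))" for x
  proof -
    have q: "of_real (exp (- \<sigma>)) * exp (\<i> * of_real x) = exp (- (of_real \<sigma> - \<i> * of_real x))"
    proof -
      have "- (of_real \<sigma> - \<i> * of_real x) = of_real (- \<sigma>) + \<i> * of_real x" by simp
      then show ?thesis by (simp only: exp_add exp_of_real)
    qed
    have "norm (exp (- (of_real \<sigma> - \<i> * of_real x))) < 1" using assms by simp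
    from tuple_count_gf[OF this, of t]
    show ?thesis unfolding q exp_of_nat_mult using exp_log_gf(2)[of "of_real \<sigma> - \<i> * of_real x"] assms
      by (simp add: sums_iff)
  qed
  note e = this
  have "summable (\<lambda>k. \<bar>real (tuple_count t k) * exp (- \<sigma>) ^ k\<bar>)"
    using norm_summable_tuple_count[of "exp (- \<sigma>)" t] assms by simp
  then show ?thesis
  proof -
    have "exp (- \<sigma>) ^ n = exp (- (real n * \<sigma>))" by (simp flip: exp_of_nat_mult)
    moreover have "exp (of_nat t * log_gf (of_real \<sigma> - \<i> * of_real x) - \<i> * of_nat n * of_real x) =
       exp (of_nat t * log_gf (of_real \<sigma> - \<i> * of_real x)) * exp (- (\<i> * of_nat n * of_real x))" for x
      unfolding exp_add[symmetric] by simp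
    ultimately show ?thesis
      using coefficient_integral[OF \<open>summable _\<close>, of n] unfolding e by simp
  qed
qed

subsection \<open>Estimates near the positive real axis\<close>

text \<open>The function 1/(exp x - 1) without its pole at 0. At x = k s with weight 1/k the poles
  add up to exactly pi^2/(6 s), and the rest of \<open>log_gf s\<close> is the corresponding sum of
  \<open>kern\<close>.\<close>

definition kern :: "complex \<Rightarrow> complex" where
  "kern x = 1 / (exp x - 1) - 1 / x"

lemma norm_exp_minus_1_ge:
  fixes x :: complex
  assumes "Re x > 0"
  shows "Re x / 2 * exp (Re x / 2) \<le> norm (exp x - 1)"
proof -
  define r where "r = Re x"
  have "exp r = exp (r / 2) * exp (r / 2)" unfolding exp_add[symmetric] by simp
  then have "exp r - 1 = (exp (r / 2) - 1) * (exp (r / 2) + 1)" by (simp add: algebra_simps)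
  moreover have "r / 2 * exp (r / 2) \<le> (exp (r / 2) - 1) * (exp (r / 2) + 1)"
  proof (rule mult_mono)
    show "r / 2 \<le> exp (r / 2) - 1" using exp_ge_add_one_self[of "r / 2"] by linarith
  qed (use assms in \<open>auto simp: r_def\<close>)
  moreover have "exp r - 1 \<le> norm (exp x - 1)"
    using norm_triangle_ineq2[of "exp x" 1] by (simp add: r_def)
  ultimately show ?thesis by (simp add: r_def)
qed

lemma exp_minus_1_nonzero: "Re x > 0 \<Longrightarrow> exp x - 1 \<noteq> 0"
  using norm_exp_minus_1_ge[of x] by (auto simp: mult_le_0_iff)

text \<open>The bound keeps both features of the denominator: the double zero at 0 and the
  exponential growth, which later cancels the numerator \<open>exp x\<close>.\<close>

lemma norm_exp_minus_1_sq_ge: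
  fixes x :: complex
  assumes "Re x > 0"
  shows "(Re x)\<^sup>2 / 4 * exp (Re x) \<le> norm ((exp x - 1)\<^sup>2)"
proof -
  have "(Re x / 2 * exp (Re x / 2))\<^sup>2 \<le> (norm (exp x - 1))\<^sup>2"
    using norm_exp_minus_1_ge[OF assms] assms by (intro power_mono) auto
  moreover have "(exp (Re x / 2))\<^sup>2 = exp (Re x)" by (simp add: power2_eq_square flip: exp_add)
  ultimately show ?thesis by (simp add: power_mult_distrib power_divide norm_power)
qed

lemma kern_deriv:
  assumes "Re x > 0"
  shows "(kern has_field_derivative (1 / x\<^sup>2 - exp x / (exp x - 1)\<^sup>2)) (at x within S)"
proof -
  have "x \<noteq> 0" "exp x - 1 \<noteq> 0" using assms exp_minus_1_nonzero by auto
  then show ?thesis unfolding kern_def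
    by (auto intro!: derivative_eq_intros simp: power2_eq_square)
qed

lemma kern_deriv_bound_large:
  assumes "Re x > 0"
  shows "norm (1 / x\<^sup>2 - exp x / (exp x - 1)\<^sup>2) \<le> 5 / (Re x)\<^sup>2"
proof -
  define r where "r = Re x"
  have r: "r > 0" using assms by (simp add: r_def)
  have "r\<^sup>2 \<le> (norm x)\<^sup>2" using r complex_Re_le_cmod[of x] by (intro power_mono) (auto simp: r_def)
  then have "norm (1 / x\<^sup>2) \<le> 1 / r\<^sup>2"
    using r by (simp add: norm_divide norm_power frac_le)
  moreover have "norm (exp x / (exp x - 1)\<^sup>2) \<le> exp r / (r\<^sup>2 / 4 * exp r)"
    unfolding norm_divide using norm_exp_minus_1_sq_ge[OF assms] r
    by (intro frac_le) (auto simp: r_def)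
  moreover have "exp r / (r\<^sup>2 / 4 * exp r) = 4 / r\<^sup>2" using r by (simp add: field_simps)
  moreover have "norm (1 / x\<^sup>2 - exp x / (exp x - 1)\<^sup>2) \<le> norm (1 / x\<^sup>2) + norm (exp x / (exp x - 1)\<^sup>2)"
    by (rule norm_triangle_ineq4)
  ultimately show ?thesis by (simp add: r_def)
qed

text \<open>Over the common denominator the numerator is (exp x - 1)^2 - x^2 exp x = exp x (exp x +
  exp(-x) - 2 - x^2). It vanishes to fourth order at 0 because the odd Taylor terms cancel, and so
  does the denominator. In the sector |Im x| <= Re x the modulus of x is comparable with Re
  x.\<close>

lemma kern_deriv_bound_small:
  assumes "Re x > 0" "\<bar>Im x\<bar> \<le> Re x" "Re x \<le> 1"
  shows "norm (1 / x\<^sup>2 - exp x / (exp x - 1)\<^sup>2) \<le> 64 * exp 1"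
proof -
  define r where "r = Re x"
  have r: "r > 0" "r \<le> 1" using assms by (auto simp: r_def)
  have nx: "r \<le> norm x" "norm x \<le> 2 * r"
    using complex_Re_le_cmod[of x] cmod_le[of x] assms by (auto simp: r_def)
  have nz: "x \<noteq> 0" "exp x - 1 \<noteq> 0" using assms exp_minus_1_nonzero by auto
  define P where "P = (\<lambda>z :: complex. \<Sum>k\<le>3. z ^ k / fact k)"
  have P: "P x + P (- x) = 2 + x\<^sup>2"
    by (simp add: P_def eval_nat_numeral fact_reduce)
  have T: "norm (exp z - P z) \<le> exp 1 * (2 * r) ^ 4 / 6" if "z = x \<or> z = - x" for z
  proof -
    have "norm (exp z - P z) \<le> exp \<bar>Re z\<bar> * norm z ^ Suc 3 / fact 3"
      unfolding P_def by (rule Taylor_exp)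
    also have "\<dots> \<le> exp 1 * (2 * r) ^ 4 / 6"
    proof -
      have "exp \<bar>Re z\<bar> \<le> exp 1" using that r by (auto simp: r_def)
      moreover have "norm z ^ Suc 3 \<le> (2 * r) ^ 4"
        using that nx power_mono[of "norm x" "2 * r" 4] by auto
      ultimately have "exp \<bar>Re z\<bar> * norm z ^ Suc 3 \<le> exp 1 * (2 * r) ^ 4" by (intro mult_mono) auto
      then show ?thesis by (simp add: fact_numeral)
    qed
    finally show ?thesis .
  qed
  have "exp x + exp (- x) - 2 - x\<^sup>2 = (exp x - P x) + (exp (- x) - P (- x))"
    using P by (simp add: algebra_simps)
  then have "norm (exp x + exp (- x) - 2 - x\<^sup>2) \<le> norm (exp x - P x) + norm (exp (- x) - P (- x))"
    by (metis norm_triangle_ineq)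
  also have "\<dots> \<le> exp 1 * (2 * r) ^ 4 / 6 + exp 1 * (2 * r) ^ 4 / 6"
    using T by (intro add_mono) auto
  also have "\<dots> \<le> 16 * exp 1 * r ^ 4" by (simp add: power_mult_distrib)
  finally have N: "norm (exp x + exp (- x) - 2 - x\<^sup>2) \<le> 16 * exp 1 * r ^ 4" .
  have "(exp x - 1)\<^sup>2 - x\<^sup>2 * exp x = exp x * (exp x + exp (- x) - 2 - x\<^sup>2)"
    by (simp add: power2_eq_square algebra_simps exp_minus)
  then have e: "1 / x\<^sup>2 - exp x / (exp x - 1)\<^sup>2 = exp x * (exp x + exp (- x) - 2 - x\<^sup>2) / (x\<^sup>2 * (exp x - 1)\<^sup>2)"
  proof -
    have "1 / x\<^sup>2 - exp x / (exp x - 1)\<^sup>2 = ((exp x - 1)\<^sup>2 - x\<^sup>2 * exp x) / (x\<^sup>2 * (exp x - 1)\<^sup>2)"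
      using nz by (simp add: divide_simps mult.commute)
    then show ?thesis using \<open>(exp x - 1)\<^sup>2 - x\<^sup>2 * exp x = _\<close> by (simp only:)
  qed
  have "norm (1 / x\<^sup>2 - exp x / (exp x - 1)\<^sup>2) =
    exp r * norm (exp x + exp (- x) - 2 - x\<^sup>2) / (norm (x\<^sup>2) * norm ((exp x - 1)\<^sup>2))"
    unfolding e by (simp add: norm_mult norm_divide r_def)
  also have "\<dots> \<le> exp r * (16 * exp 1 * r ^ 4) / (r\<^sup>2 * (r\<^sup>2 / 4 * exp r))"
    using N nx r norm_exp_minus_1_sq_ge[OF assms(1)]
    by (intro frac_le mult_mono mult_pos_pos) (auto simp: r_def norm_power intro!: power_mono)
  also have "\<dots> = 64 * exp 1"
  proof -
    have "r ^ 4 = r\<^sup>2 * r\<^sup>2" by (simp flip: power_add)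
    then show ?thesis using r by (simp add: field_simps)
  qed
  finally show ?thesis .
qed

text \<open>The exponent 5/4 lies strictly between 1 and 3/2: above 1 the sum over k in
  \<open>log_gf_diff\<close> converges, below 3/2 the resulting error vanishes at the scale |x| ~
  sigma^(3/2) of the saddle point.\<close>

lemma kern_deriv_bound:
  assumes "Re x > 0" "\<bar>Im x\<bar> \<le> Re x"
  shows "norm (1 / x\<^sup>2 - exp x / (exp x - 1)\<^sup>2) \<le> 64 * exp 1 * Re x powr (- 5 / 4)"
proof (cases "Re x \<le> 1")
  case True
  have "1 \<le> Re x powr (- 5 / 4)" using powr_mono2'[of "- 5 / 4" "Re x" 1] True assms by simp
  then have "64 * exp 1 * 1 \<le> 64 * exp 1 * Re x powr (- 5 / 4)" by (intro mult_left_mono) auto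
  then show ?thesis using kern_deriv_bound_small[OF assms True] by linarith
next
  case False
  have "5 / (Re x)\<^sup>2 = 5 * Re x powr (- 2)" using assms by (simp add: powr_minus powr_numeral divide_simps)
  also have "\<dots> \<le> 5 * Re x powr (- 5 / 4)" using False by (intro mult_left_mono powr_mono) auto
  also have "\<dots> \<le> 64 * exp 1 * Re x powr (- 5 / 4)"
    using exp_ge_add_one_self[of 1] by (intro mult_right_mono) auto
  finally show ?thesis using kern_deriv_bound_large[OF assms(1)] by linarith
qed

lemma kern_diff:
  assumes "\<sigma> > 0" "\<bar>x\<bar> \<le> \<sigma>"
  shows "norm (kern (of_real \<sigma> - \<i> * of_real x) - kern (of_real \<sigma>)) \<le> 64 * exp 1 * \<sigma> powr (- 5 / 4) * \<bar>x\<bar>"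
proof -
  let ?s = "of_real \<sigma> - \<i> * of_real x"
  let ?S = "closed_segment (of_real \<sigma>) ?s"
  have S: "Re z = \<sigma> \<and> \<bar>Im z\<bar> \<le> \<sigma>" if "z \<in> ?S" for z
  proof -
    have "\<exists>u. 0 \<le> u \<and> u \<le> 1 \<and> z = (1 - u) *\<^sub>R of_real \<sigma> + u *\<^sub>R ?s"
      using that by (simp only: in_segment)
    then obtain u where u: "0 \<le> u" "u \<le> 1" "z = (1 - u) *\<^sub>R of_real \<sigma> + u *\<^sub>R ?s"
      by blast
    have "\<bar>u * x\<bar> \<le> 1 * \<sigma>" unfolding abs_mult using u assms by (intro mult_mono) auto
    moreover have "Re z = (1 - u) * \<sigma> + u * \<sigma>" "Im z = - (u * x)"
      unfolding u(3) by simp_all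
    ultimately show ?thesis by (simp add: algebra_simps)
  qed
  have "norm (kern ?s - kern (of_real \<sigma>)) \<le> 64 * exp 1 * \<sigma> powr (- 5 / 4) * norm (?s - of_real \<sigma>)"
  proof (rule field_differentiable_bound[where S = ?S])
    fix z assume z: "z \<in> ?S"
    show "(kern has_field_derivative (1 / z\<^sup>2 - exp z / (exp z - 1)\<^sup>2)) (at z within ?S)"
      by (rule kern_deriv) (use S[OF z] assms in auto)
    show "norm (1 / z\<^sup>2 - exp z / (exp z - 1)\<^sup>2) \<le> 64 * exp 1 * \<sigma> powr (- 5 / 4)"
      using kern_deriv_bound[of z] S[OF z] assms by auto
  qed auto
  then show ?thesis by (simp add: norm_mult)
qed

lemma log_gf_kern_sums:
  assumes "Re s > 0"
  shows "(\<lambda>k. kern (of_nat (Suc k) * s) / of_nat (Suc k)) sums (log_gf s - of_real (pi\<^sup>2 / 6) / s)"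
proof -
  have "(\<lambda>k. 1 / (of_nat (Suc k) * (exp (of_nat (Suc k) * s) - 1))) sums log_gf s"
    unfolding log_gf_def using summable_norm_cancel[OF exp_log_gf(1)[OF assms]] by (rule summable_sums)
  moreover have "(\<lambda>k. of_real (1 / (real k + 1)\<^sup>2) / s) sums (of_real (pi\<^sup>2 / 6) / s)"
    by (intro sums_divide sums_of_real) (use inverse_squares_sums in \<open>simp add: add.commute\<close>)
  ultimately have "(\<lambda>k. 1 / (of_nat (Suc k) * (exp (of_nat (Suc k) * s) - 1)) - of_real (1 / (real k + 1)\<^sup>2) / s)
     sums (log_gf s - of_real (pi\<^sup>2 / 6) / s)" by (rule sums_diff)
  moreover have "1 / (of_nat (Suc k) * (exp (of_nat (Suc k) * s) - 1)) - of_real (1 / (real k + 1)\<^sup>2) / s =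
     kern (of_nat (Suc k) * s) / of_nat (Suc k)" for k
  proof -
    have "of_real (1 / (real k + 1)\<^sup>2) = (1 / (of_nat (Suc k))\<^sup>2 :: complex)" by (simp add: add.commute)
    then show ?thesis by (simp add: kern_def diff_divide_distrib power2_eq_square mult_ac del: of_nat_Suc)
  qed
  ultimately show ?thesis by simp
qed

text \<open>Termwise \<open>kern_diff\<close> at m sigma and m x: the factor m of |m x| cancels
  against the weight 1/m of the series, so m^(-5/4) remains and is summable.\<close>

lemma log_gf_diff:
  obtains K where "K > 0" and "\<And>\<sigma> x. \<sigma> > 0 \<Longrightarrow> \<bar>x\<bar> \<le> \<sigma> \<Longrightarrow>
    norm (log_gf (of_real \<sigma> - \<i> * of_real x) - log_gf (of_real \<sigma>)
      - of_real (pi\<^sup>2 / 6) * (1 / (of_real \<sigma> - \<i> * of_real x) - 1 / of_real \<sigma>)) \<le> K * \<bar>x\<bar> * \<sigma> powr (- 5 / 4)"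
proof -
  define Z where "Z = (\<Sum>k. real (Suc k) powr (- 5 / 4))"
  have sZ: "summable (\<lambda>k. real (Suc k) powr (- 5 / 4))"
    by (subst summable_Suc_iff) (simp add: summable_real_powr_iff)
  have "Z \<ge> 0" unfolding Z_def by (intro suminf_nonneg sZ) auto
  show thesis
  proof (rule that[of "64 * exp 1 * Z + 1"])
    show "64 * exp 1 * Z + 1 > 0" using \<open>Z \<ge> 0\<close> by (simp add: add_nonneg_pos)
    fix \<sigma> x :: real assume s: "\<sigma> > 0" "\<bar>x\<bar> \<le> \<sigma>"
    let ?s = "of_real \<sigma> - \<i> * of_real x"
    let ?d = "\<lambda>k. kern (of_nat (Suc k) * ?s) / of_nat (Suc k) - kern (of_nat (Suc k) * of_real \<sigma>) / of_nat (Suc k)"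
    have d: "?d sums ((log_gf ?s - of_real (pi\<^sup>2 / 6) / ?s) - (log_gf (of_real \<sigma>) - of_real (pi\<^sup>2 / 6) / of_real \<sigma>))"
      by (intro sums_diff log_gf_kern_sums) (use s in auto)
    have b: "norm (?d k) \<le> 64 * exp 1 * \<bar>x\<bar> * \<sigma> powr (- 5 / 4) * real (Suc k) powr (- 5 / 4)" for k
    proof -
      define m where "m = real (Suc k)"
      have m: "m > 0" "(of_nat (Suc k) :: complex) = of_real m" by (simp_all add: m_def)
      have "norm (?d k) = norm (kern (of_real (m * \<sigma>) - \<i> * of_real (m * x)) - kern (of_real (m * \<sigma>))) / m"
        unfolding m(2) diff_divide_distrib[symmetric] norm_divide using m(1) by (simp add: algebra_simps)
      also have "\<dots> \<le> (64 * exp 1 * (m * \<sigma>) powr (- 5 / 4) * \<bar>m * x\<bar>) / m"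
        using s m(1) by (intro divide_right_mono kern_diff) (auto simp: abs_mult)
      also have "\<dots> = 64 * exp 1 * \<bar>x\<bar> * \<sigma> powr (- 5 / 4) * m powr (- 5 / 4)"
        using s m(1) by (simp add: powr_mult abs_mult)
      finally show ?thesis by (simp add: m_def)
    qed
    have "norm (suminf ?d) \<le> (\<Sum>k. 64 * exp 1 * \<bar>x\<bar> * \<sigma> powr (- 5 / 4) * real (Suc k) powr (- 5 / 4))"
      by (rule norm_suminf_le[OF b]) (intro summable_mult sZ)
    also have "\<dots> = 64 * exp 1 * \<bar>x\<bar> * \<sigma> powr (- 5 / 4) * Z"
      unfolding Z_def by (rule suminf_mult[OF sZ])
    also have "\<dots> \<le> (64 * exp 1 * Z + 1) * \<bar>x\<bar> * \<sigma> powr (- 5 / 4)"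
      by (simp add: algebra_simps)
    finally show "norm (log_gf ?s - log_gf (of_real \<sigma>) - of_real (pi\<^sup>2 / 6) * (1 / ?s - 1 / of_real \<sigma>))
       \<le> (64 * exp 1 * Z + 1) * \<bar>x\<bar> * \<sigma> powr (- 5 / 4)"
      unfolding sums_unique[OF d, symmetric] by (simp add: algebra_simps)
  qed
qed

text \<open>Half the angle, y = x/2, satisfies |y| <= 2 and cos y >= 0. There the fourth-order
  expansion of the cosine gives 1 - cos y >= y^2/3, and 1 - cos x = 2 (1 - cos y) (1 + cos
  y).\<close>

lemma one_minus_cos_ge:
  fixes x :: real
  assumes "\<bar>x\<bar> \<le> pi"
  shows "x\<^sup>2 / 6 \<le> 1 - cos x"
proof -
  define y where "y = x / 2"
  have y: "\<bar>y\<bar> \<le> pi / 2" using assms by (simp add: y_def)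
  have c: "cos y \<ge> 0" using y by (intro cos_ge_zero) auto
  obtain t where "cos y = (\<Sum>m<4. cos_coeff m * y ^ m) + (cos (t + 1 / 2 * real 4 * pi) / fact 4) * y ^ 4"
    using Maclaurin_cos_expansion[of y 4] by blast
  then have "cos y = 1 - y\<^sup>2 / 2 + cos (t + 1 / 2 * real 4 * pi) * (y ^ 4 / 24)"
  proof -
    have "{..<4 :: nat} = {0, 1, 2, 3}" by auto
    then show ?thesis using \<open>cos y = _\<close> by (simp add: cos_coeff_def fact_numeral)
  qed
  also have "\<dots> \<le> 1 - y\<^sup>2 / 2 + 1 * (y ^ 4 / 24)" by (intro add_left_mono mult_right_mono) auto
  finally have "1 - cos y \<ge> y\<^sup>2 / 2 - y ^ 4 / 24" by simp
  moreover have "y ^ 4 \<le> 4 * y\<^sup>2"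
  proof -
    have "\<bar>y\<bar> \<le> 2" using y pi_less_4 by linarith
    then have "y\<^sup>2 \<le> 4" using abs_le_square_iff[of y 2] by simp
    then have "y\<^sup>2 * y\<^sup>2 \<le> 4 * y\<^sup>2" by (intro mult_right_mono) auto
    then show ?thesis by (simp add: eval_nat_numeral)
  qed
  ultimately have *: "1 - cos y \<ge> y\<^sup>2 / 3" by simp
  have "1 - cos x = 2 - 2 * (cos y)\<^sup>2" using cos_double_cos[of y] by (simp add: y_def)
  also have "\<dots> = 2 * (1 - cos y) * (1 + cos y)" by (simp add: power2_eq_square algebra_simps)
  also have "\<dots> \<ge> 2 * (y\<^sup>2 / 3) * 1" using * c by (intro mult_mono) auto
  finally show ?thesis by (simp add: y_def power_divide)
qed

lemma norm_exp_minus_1_sq: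
  "(norm (exp (of_real \<sigma> - \<i> * of_real x) - 1))\<^sup>2 = (exp \<sigma> - 1)\<^sup>2 + 2 * exp \<sigma> * (1 - cos x)"
proof -
  have "exp (of_real \<sigma> - \<i> * of_real x) = Complex (exp \<sigma> * cos x) (- exp \<sigma> * sin x)"
    by (simp add: complex_eq_iff Re_exp Im_exp)
  then have "(norm (exp (of_real \<sigma> - \<i> * of_real x) - 1))\<^sup>2 = (exp \<sigma> * cos x - 1)\<^sup>2 + (exp \<sigma> * sin x)\<^sup>2"
    by (simp add: cmod_power2)
  also have "\<dots> = (exp \<sigma>)\<^sup>2 * ((cos x)\<^sup>2 + (sin x)\<^sup>2) - 2 * exp \<sigma> * cos x + 1"
  proof -
    have "(a * c - 1)\<^sup>2 + (a * d)\<^sup>2 = a\<^sup>2 * (c\<^sup>2 + d\<^sup>2) - 2 * a * c + 1" for a c d :: real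
      by (simp add: power2_eq_square algebra_simps)
    then show ?thesis .
  qed
  also have "\<dots> = (exp \<sigma>)\<^sup>2 - 2 * exp \<sigma> * cos x + 1" by simp
  finally show ?thesis by (simp add: power2_eq_square algebra_simps)
qed

lemma minor_arc_term:
  assumes "0 < \<sigma>" "\<sigma> \<le> 1" "\<bar>x\<bar> \<le> pi"
  shows "min 1 ((x / \<sigma>)\<^sup>2) / (170 * \<sigma>) \<le> 1 / (exp \<sigma> - 1) - 1 / norm (exp (of_real \<sigma> - \<i> * of_real x) - 1)"
proof -
  define w where "w = min 1 ((x / \<sigma>)\<^sup>2)"
  define E where "E = exp \<sigma> - 1"
  define N where "N = norm (exp (of_real \<sigma> - \<i> * of_real x) - 1)"
  have w: "0 \<le> w" "w \<le> 1" by (auto simp: w_def)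
  have E: "0 < E" "E \<le> 2 * \<sigma>"
  proof -
    have "exp \<sigma> \<le> 1 + \<sigma> + \<sigma>\<^sup>2" using assms by (intro exp_bound) auto
    moreover have "\<sigma>\<^sup>2 \<le> \<sigma>" using assms by (simp add: power2_eq_square mult_left_le)
    ultimately show "E \<le> 2 * \<sigma>" by (simp add: E_def)
  qed (use assms in \<open>simp add: E_def\<close>)
  \<comment> \<open>Since E <= 2 sigma and 1 - cos x >= x^2/6, N^2 exceeds E^2 by at least x^2/3 >=
    E^2 w/12. The constant 84 leaves room for the square root, and 170 = 2 * 85 with 1 - 1/(1 +
    w/84) >= w/85.\<close>
  have "(E * (1 + w / 84))\<^sup>2 = E\<^sup>2 * (1 + w / 42 + w * w / 7056)" by (simp add: power2_eq_square algebra_simps)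
  also have "\<dots> \<le> E\<^sup>2 * (1 + w / 12)"
    using w mult_left_le[of w w] by (intro mult_left_mono) auto
  also have "\<dots> = E\<^sup>2 + E\<^sup>2 * w / 12" by (simp add: algebra_simps)
  also have "\<dots> \<le> E\<^sup>2 + 2 * exp \<sigma> * (1 - cos x)"
  proof -
    have "E\<^sup>2 * w \<le> (2 * \<sigma>)\<^sup>2 * (x / \<sigma>)\<^sup>2"
      using E w by (intro mult_mono power_mono) (auto simp: w_def)
    also have "\<dots> = 4 * x\<^sup>2" using assms by (simp add: power_mult_distrib power_divide)
    finally have "E\<^sup>2 * w \<le> 4 * x\<^sup>2" .
    moreover
    have "2 * 1 * (x\<^sup>2 / 6) \<le> 2 * exp \<sigma> * (1 - cos x)"
      using one_minus_cos_ge[OF assms(3)] assms by (intro mult_mono) auto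
    ultimately show ?thesis by simp
  qed
  also have "\<dots> = N\<^sup>2" by (simp add: N_def E_def norm_exp_minus_1_sq)
  finally have "E * (1 + w / 84) \<le> N" by (rule power2_le_imp_le) (unfold N_def, rule norm_ge_zero)
  moreover have "0 < E * (1 + w / 84)" using E w by (intro mult_pos_pos) auto
  ultimately have "1 / N \<le> 1 / (E * (1 + w / 84))"
    using frac_le[of 1 1 "E * (1 + w / 84)" N] by simp
  moreover have "w / (170 * \<sigma>) \<le> 1 / E - 1 / (E * (1 + w / 84))"
  proof -
    have "w / (170 * \<sigma>) \<le> (w / 85) / E" using E w assms mult_right_mono[OF E(2) w(1)] by (simp add: field_simps)
    also have "w / 85 \<le> 1 - 1 / (1 + w / 84)" using w mult_left_le[of w w] by (simp add: field_simps)
    then have "(w / 85) / E \<le> (1 - 1 / (1 + w / 84)) / E" using E by (intro divide_right_mono) auto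
    also have "\<dots> = 1 / E - 1 / (E * (1 + w / 84))" using E by (simp add: diff_divide_distrib)
    finally show ?thesis .
  qed
  ultimately show ?thesis unfolding w_def E_def N_def by linarith
qed

text \<open>No term of the series has a larger real part off the axis than on it, so keeping the
  loss of the first term only still gives an upper bound.\<close>

lemma minor_arc:
  assumes "0 < \<sigma>" "\<sigma> \<le> 1" "\<bar>x\<bar> \<le> pi"
  shows "Re (log_gf (of_real \<sigma> - \<i> * of_real x)) \<le> log_gf \<sigma> - min 1 ((x / \<sigma>)\<^sup>2) / (170 * \<sigma>)"
proof -
  let ?s = "of_real \<sigma> - \<i> * of_real x :: complex"
  let ?f = "\<lambda>k. 1 / (of_nat (Suc k) * (exp (of_nat (Suc k) * ?s) - 1))"
  let ?g = "\<lambda>k. 1 / (real (Suc k) * (exp (real (Suc k) * \<sigma>) - 1))"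
  have f: "summable ?f" using summable_norm_cancel[OF exp_log_gf(1)[of ?s]] assms by simp
  have "complex_of_real (?g k) = 1 / (of_nat (Suc k) * (exp (of_nat (Suc k) * of_real \<sigma>) - 1))" for k
    by (simp add: exp_of_real[symmetric])
  then have "(\<lambda>k. complex_of_real (?g k)) = (\<lambda>k. 1 / (of_nat (Suc k) * (exp (of_nat (Suc k) * of_real \<sigma>) - 1)))"
    by (rule ext)
  then have "summable (\<lambda>k. complex_of_real (?g k))"
    using summable_norm_cancel[OF exp_log_gf(1)[of "of_real \<sigma>"]] assms by (simp only: Re_complex_of_real)
  then have g: "summable ?g" by (simp only: summable_complex_of_real)
  have le: "Re (?f k) \<le> 1 / (real (Suc k) * norm (exp (of_nat (Suc k) * ?s) - 1))" for k
    using complex_Re_le_cmod[of "?f k"] by (simp add: norm_divide norm_mult del: of_nat_Suc)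
  have gf: "Re (?f k) \<le> ?g k" for k
  proof -
    have "exp (real (Suc k) * \<sigma>) - 1 \<le> norm (exp (of_nat (Suc k) * ?s) - 1)"
      using norm_triangle_ineq2[of "exp (of_nat (Suc k) * ?s)" 1] by simp
    then have "1 / (real (Suc k) * norm (exp (of_nat (Suc k) * ?s) - 1)) \<le> ?g k"
    proof (intro divide_left_mono mult_left_mono mult_pos_pos)
      have "0 < real (Suc k) * \<sigma>" using assms by simp
      then show "0 < exp (real (Suc k) * \<sigma>) - 1" by (simp del: of_nat_Suc)
      then show "0 < norm (exp (of_nat (Suc k) * ?s) - 1)"
        using \<open>exp (real (Suc k) * \<sigma>) - 1 \<le> _\<close> by linarith
    qed (simp_all del: of_nat_Suc)
    then show ?thesis using le[of k] by linarith
  qed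
  have first_le: "h 0 \<le> suminf h" if "summable h" "\<And>k. 0 \<le> h k" for h :: "nat \<Rightarrow> real"
    using sum_le_suminf[of h "{0}"] that by simp
  have "?g 0 - Re (?f 0) \<le> (\<Sum>k. ?g k - Re (?f k))"
    by (rule first_le) (intro summable_diff g summable_Re f, rule diff_ge_0_iff_ge[THEN iffD2], rule gf)
  also have "\<dots> = log_gf \<sigma> - Re (log_gf ?s)"
    unfolding log_gf_def Re_suminf[OF f] by (intro suminf_diff[symmetric] g summable_Re f)
  finally have "?g 0 - Re (?f 0) \<le> log_gf \<sigma> - Re (log_gf ?s)" .
  moreover have "?g 0 - Re (?f 0) \<ge> 1 / (exp \<sigma> - 1) - 1 / norm (exp ?s - 1)" using le[of 0] by simp
  ultimately show ?thesis using minor_arc_term[OF assms] by linarith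
qed

subsection \<open>The constant in the asymptotics\<close>

lemma size_t_hooks_le:
  assumes "partition_of n xs" shows "size (t_hooks t xs) \<le> n"
proof -
  have "size (t_hooks t xs) \<le> size (image_mset (\<lambda>(k, j). hook_length xs k j) (mset_set (diagram xs)))"
    unfolding t_hooks_def by (rule size_filter_mset_lesseq)
  also have "\<dots> = n" using assms card_diagram[of xs] by (simp add: partition_of_def)
  finally show ?thesis .
qed

definition core_count :: "nat \<Rightarrow> int \<Rightarrow> nat" where
  "core_count t m = card {c \<in> charge_vectors t. core_size t c = m}"

lemma card_partitions_hook_pred:
  assumes "t > 0"
  shows "card {xs. partition_of n xs \<and> P (size (t_hooks (int t) xs))} =
     (\<Sum>w | w \<le> n \<and> P w. core_count t (int n - int (t * w)) * tuple_count t w)"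
proof -
  have "{xs. partition_of n xs \<and> P (size (t_hooks (int t) xs))} =
     (\<Union>w\<in>{w. w \<le> n \<and> P w}. {xs. partition_of n xs \<and> size (t_hooks (int t) xs) = w})"
    using size_t_hooks_le by auto
  also have "card \<dots> = (\<Sum>w | w \<le> n \<and> P w. card {xs. partition_of n xs \<and> size (t_hooks (int t) xs) = w})"
    by (rule card_UN_disjoint) (auto intro: finite_subset[OF _ finite_partitions[of n]])
  also have "\<dots> = (\<Sum>w | w \<le> n \<and> P w. core_count t (int n - int (t * w)) * tuple_count t w)"
    unfolding card_partitions_t_hooks[OF assms] core_count_def tuple_count_def
    by (simp add: eq_diff_eq)
  finally show ?thesis .
qed

section \<open>Triangular numbers as the sizes of the 2-cores\<close>

definition tri :: "nat \<Rightarrow> nat" where "tri j = j * (j + 1) div 2"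

lemma two_tri: "2 * tri j = j * (j + 1)"
  by (simp add: tri_def)

lemma int_two_tri: "2 * int (tri j) = int j * (int j + 1)"
proof -
  have "int (2 * tri j) = int (j * (j + 1))" by (simp only: two_tri)
  then show ?thesis by (simp add: algebra_simps)
qed

lemma real_tri: "real (tri j) = real j * (real j + 1) / 2"
  using two_tri[of j] by (simp add: field_simps flip: of_nat_mult of_nat_add)

lemma strict_mono_tri: "strict_mono tri"
proof (rule strict_monoI_Suc)
  show "tri j < tri (Suc j)" for j using two_tri[of j] two_tri[of "Suc j"] by simp
qed

text \<open>A charge vector of length 2 is (-k, k) and has core size 2 k^2 + k. This is the
  triangular number of j = 2 k if k >= 0 and of j = -2 k - 1 if k < 0, and every j arises once. The
  2-cores are the staircase partitions.\<close>

lemma core_count_2: "core_count 2 (int m) = (if m \<in> range tri then 1 else 0)"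
proof -
  have two: "{..<2 :: nat} = {0, 1}" by auto
  have size: "core_size 2 c = 2 * (c 1)\<^sup>2 + c 1" if "c \<in> charge_vectors 2" for c
  proof -
    have c0: "c 0 = - c 1" using that by (simp add: charge_vectors_def two)
    have "2 * core_size 2 c = 2 * (2 * (c 1)\<^sup>2 + c 1)"
      unfolding two_core_size two using c0 by (simp add: power2_eq_square algebra_simps)
    then show ?thesis by simp
  qed
  have "bij_betw (\<lambda>c. if c 1 \<ge> 0 then nat (2 * c 1) else nat (- 2 * c 1 - 1))
    {c \<in> charge_vectors 2. core_size 2 c = int m} {j. tri j = m}"
  proof (rule bij_betw_byWitness[of _ "\<lambda>j. let k = (if even j then int (j div 2) else - int (j div 2) - 1) in
       (\<lambda>r\<in>{..<2}. if r = (0::nat) then - k else k)"])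
    show "\<forall>c\<in>{c \<in> charge_vectors 2. core_size 2 c = int m}.
     (let k = (if even (if c 1 \<ge> 0 then nat (2 * c 1) else nat (- 2 * c 1 - 1)) then int ((if c 1 \<ge> 0 then nat (2 * c 1) else nat (- 2 * c 1 - 1)) div 2) else - int ((if c 1 \<ge> 0 then nat (2 * c 1) else nat (- 2 * c 1 - 1)) div 2) - 1) in
       (\<lambda>r\<in>{..<2}. if r = (0::nat) then - k else k)) = c"
    proof
      fix c assume "c \<in> {c \<in> charge_vectors 2. core_size 2 c = int m}"
      then have c: "c \<in> {..<2} \<rightarrow>\<^sub>E UNIV" "c 0 = - c 1" by (auto simp: charge_vectors_def two)
      define j where "j = (if c 1 \<ge> 0 then nat (2 * c 1) else nat (- 2 * c 1 - 1))"
      define k where "k = (if even j then int (j div 2) else - int (j div 2) - 1)"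
      have "k = c 1"
      proof (cases "c 1 \<ge> 0")
        case True
        then have "j = 2 * nat (c 1)" by (simp add: j_def nat_mult_distrib)
        then show ?thesis using True by (simp add: k_def)
      next
        case False
        then have "j = 2 * nat (- c 1 - 1) + 1" by (simp add: j_def)
        then show ?thesis using False by (simp add: k_def)
      qed
      then have "(\<lambda>r\<in>{..<2}. if r = (0::nat) then - k else k) = c"
        using c by (auto simp: fun_eq_iff PiE_def extensional_def less_2_cases_iff)
      then show "(let k = (if even (if c 1 \<ge> 0 then nat (2 * c 1) else nat (- 2 * c 1 - 1)) then int ((if c 1 \<ge> 0 then nat (2 * c 1) else nat (- 2 * c 1 - 1)) div 2) else - int ((if c 1 \<ge> 0 then nat (2 * c 1) else nat (- 2 * c 1 - 1)) div 2) - 1) in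
       (\<lambda>r\<in>{..<2}. if r = (0::nat) then - k else k)) = c"
        unfolding Let_def k_def j_def .
    qed
    show "\<forall>j\<in>{j. tri j = m}. (\<lambda>c. if c 1 \<ge> 0 then nat (2 * c 1) else nat (- 2 * c 1 - 1))
      (let k = (if even j then int (j div 2) else - int (j div 2) - 1) in (\<lambda>r\<in>{..<2}. if r = (0::nat) then - k else k)) = j"
      by (auto simp: Let_def elim!: evenE oddE)
    show "(\<lambda>c. if c 1 \<ge> 0 then nat (2 * c 1) else nat (- 2 * c 1 - 1)) ` {c \<in> charge_vectors 2. core_size 2 c = int m} \<subseteq> {j. tri j = m}"
    proof (rule image_subsetI)
      fix c :: "nat \<Rightarrow> int" assume "c \<in> {c \<in> charge_vectors 2. core_size 2 c = int m}"
      then have m: "2 * (c 1)\<^sup>2 + c 1 = int m" using size by auto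
      define j where "j = (if c 1 \<ge> 0 then nat (2 * c 1) else nat (- 2 * c 1 - 1))"
      have "int j * (int j + 1) = 2 * int m"
        unfolding m[symmetric] by (auto simp: j_def power2_eq_square algebra_simps)
      then have "2 * int (tri j) = 2 * int m" using int_two_tri[of j] by simp
      then have "j \<in> {j. tri j = m}" by simp
      then show "(if c 1 \<ge> 0 then nat (2 * c 1) else nat (- 2 * c 1 - 1)) \<in> {j. tri j = m}" unfolding j_def .
    qed
    show "(\<lambda>j. let k = (if even j then int (j div 2) else - int (j div 2) - 1) in
       (\<lambda>r\<in>{..<2}. if r = (0::nat) then - k else k)) ` {j. tri j = m} \<subseteq> {c \<in> charge_vectors 2. core_size 2 c = int m}"
    proof (rule image_subsetI)
      fix j assume j: "j \<in> {j. tri j = m}"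
      define k where "k = (if even j then int (j div 2) else - int (j div 2) - 1)"
      define c where "c = (\<lambda>r\<in>{..<2}. if r = (0::nat) then - k else k)"
      have c: "c \<in> charge_vectors 2" by (auto simp: c_def charge_vectors_def two)
      have "2 * (2 * k\<^sup>2 + k) = int j * (int j + 1)"
        by (cases "even j") (auto simp: k_def power2_eq_square algebra_simps elim!: evenE oddE)
      also have "\<dots> = 2 * int m" using int_two_tri[of j] j by simp
      finally have "core_size 2 c = int m" using size[OF c] by (simp add: c_def)
      then show "(let k = (if even j then int (j div 2) else - int (j div 2) - 1) in
       (\<lambda>r\<in>{..<2}. if r = (0::nat) then - k else k)) \<in> {c \<in> charge_vectors 2. core_size 2 c = int m}"
        using c unfolding Let_def c_def k_def by simp
    qed
  qed
  then have "core_count 2 (int m) = card {j. tri j = m}"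
    unfolding core_count_def by (rule bij_betw_same_card)
  also have "\<dots> = (if m \<in> range tri then 1 else 0)"
  proof (cases "m \<in> range tri")
    case True
    then obtain i where "m = tri i" by blast
    then have "{j. tri j = m} = {i}" using strict_mono_eq[OF strict_mono_tri] by auto
    then show ?thesis using True by simp
  next
    case False
    then have "{j. tri j = m} = {}" by auto
    then show ?thesis using False by simp
  qed
  finally show ?thesis .
qed

lemma core_count_2_neg: "m < 0 \<Longrightarrow> core_count 2 m = 0"
proof -
  assume m: "m < 0"
  have two: "{..<2 :: nat} = {0, 1}" by auto
  have "core_size 2 c \<ge> 0" if "c \<in> charge_vectors 2" for c
  proof -
    have c0: "c 0 = - c 1" using that by (simp add: charge_vectors_def two)
    have "2 * core_size 2 c = 2 * (c 1 * (2 * c 1 + 1))"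
      unfolding two_core_size two using c0 by (simp add: algebra_simps)
    moreover have "c 1 * (2 * c 1 + 1) \<ge> 0" by (cases "c 1 \<ge> 0") (auto simp: mult_nonpos_nonpos)
    ultimately show ?thesis by simp
  qed
  then have "{c \<in> charge_vectors 2. core_size 2 c = m} = {}" using m by force
  then show ?thesis by (simp only: core_count_def card.empty)
qed

text \<open>All partitions of n are sorted by their number w of 2-hooks. The index i = 2 w brings
  the sum into the shape of a Cauchy product coefficient.\<close>

lemma npart_two_cores:
  "npart n = (\<Sum>i\<le>n. (if even i then tuple_count 2 (i div 2) else 0) * core_count 2 (int (n - i)))"
proof -
  have "npart n = (\<Sum>w\<le>n. core_count 2 (int n - int (2 * w)) * tuple_count 2 w)"
    using card_partitions_hook_pred[of 2 n "\<lambda>_. True"] by (simp add: npart_def atMost_def)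
  also have "\<dots> = (\<Sum>w | 2 * w \<le> n. core_count 2 (int n - int (2 * w)) * tuple_count 2 w)"
    by (rule sum.mono_neutral_right) (auto intro: core_count_2_neg)
  also have "\<dots> = (\<Sum>i | i \<le> n \<and> even i. tuple_count 2 (i div 2) * core_count 2 (int (n - i)))"
    by (rule sum.reindex_bij_witness[of _ "\<lambda>i. i div 2" "\<lambda>w. 2 * w"]) (auto simp: of_nat_diff)
  also have "\<dots> = (\<Sum>i\<le>n. (if even i then tuple_count 2 (i div 2) else 0) * core_count 2 (int (n - i)))"
    by (rule sum.mono_neutral_cong_left) auto
  finally show ?thesis .
qed

lemma summable_core_count_2:
  fixes q :: real
  assumes "0 \<le> q" "q < 1"
  shows "summable (\<lambda>m. real (core_count 2 (int m)) * q ^ m)"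
  by (rule summable_comparison_test'[OF summable_geometric[of q], of 0])
     (use assms in \<open>auto simp: core_count_2\<close>)

lemma gauss_triangular:
  fixes q :: real
  assumes "0 \<le> q" "q < 1"
  shows "part_gf q = (\<Sum>j. q ^ tri j) * part_gf (q\<^sup>2) ^ 2"
proof -
  define b where "b = (\<lambda>i. real (if even i then tuple_count 2 (i div 2) else 0) * q ^ i)"
  define r where "r = (\<lambda>m. real (core_count 2 (int m)) * q ^ m)"
  have q2: "norm (q\<^sup>2) < 1" using assms power_Suc_lt_one[of q 1] by (simp add: power2_eq_square)
  have "(\<lambda>w. b (2 * w)) sums (part_gf (q\<^sup>2) ^ 2)"
    using tuple_count_gf[OF q2, of 2] by (simp add: b_def power_mult)
  then have bs: "b sums (part_gf (q\<^sup>2) ^ 2)"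
    by (subst (asm) sums_mono_reindex) (auto simp: strict_mono_def b_def elim!: evenE)
  have b0: "b i \<ge> 0" for i using assms by (simp add: b_def)
  have rs: "summable r" unfolding r_def using summable_core_count_2[OF assms] .
  have r0: "r i \<ge> 0" for i using assms by (simp add: r_def)
  have "suminf r = (\<Sum>j. r (tri j))"
    by (rule suminf_mono_reindex[OF strict_mono_tri, symmetric]) (simp add: r_def core_count_2)
  also have "\<dots> = (\<Sum>j. q ^ tri j)" by (simp add: r_def core_count_2)
  finally have r: "suminf r = (\<Sum>j. q ^ tri j)" .
  have "(\<lambda>n. \<Sum>i\<le>n. b i * r (n - i)) sums (suminf b * suminf r)"
    by (rule Cauchy_product_sums) (use b0 r0 rs bs in \<open>auto dest: sums_summable\<close>)
  moreover have "(\<Sum>i\<le>n. b i * r (n - i)) = of_nat (npart n) * q ^ n" for n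
  proof -
    have "b i * r (n - i) = real ((if even i then tuple_count 2 (i div 2) else 0) * core_count 2 (int (n - i))) * q ^ n" if "i \<le> n" for i
    proof -
      have "q ^ n = q ^ i * q ^ (n - i)" using that by (simp flip: power_add)
      then show ?thesis by (simp add: b_def r_def)
    qed
    then have "(\<Sum>i\<le>n. b i * r (n - i)) = (\<Sum>i\<le>n. real ((if even i then tuple_count 2 (i div 2) else 0) * core_count 2 (int (n - i))) * q ^ n)"
      by (intro sum.cong[OF refl]) simp
    also have "\<dots> = of_nat (npart n) * q ^ n"
      by (simp only: npart_two_cores[of n] of_nat_sum sum_distrib_right)
    finally show ?thesis .
  qed
  ultimately have "(\<lambda>n. of_nat (npart n) * q ^ n) sums (suminf b * suminf r)" by simp
  then show ?thesis using r sums_unique[OF bs] unfolding part_gf_def by (simp add: sums_iff mult.commute)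
qed



section \<open>The series over triangular numbers near s = 0\<close>

definition theta :: "real \<Rightarrow> real" where
  "theta s = (\<Sum>j. exp (- s) ^ tri j)"

lemma log_gf_theta:
  assumes "s > 0"
  shows "exp (log_gf s) = theta s * exp (2 * log_gf (2 * s))"
proof -
  have "exp (- s) ^ 2 = exp (- (2 * s))" by (simp flip: exp_of_nat_mult)
  moreover have "part_gf (exp (- (2 * s))) ^ 2 = exp (2 * log_gf (2 * s))"
    using exp_log_gf_real[of "2 * s"] assms exp_of_nat_mult[of 2 "log_gf (2 * s)"] by simp
  ultimately show ?thesis
    using gauss_triangular[of "exp (- s)"] exp_log_gf_real[OF assms] assms by (simp add: theta_def)
qed

lemma half_gaussian_integral:
  fixes s :: real
  assumes "s > 0"
  shows "has_bochner_integral lborel (\<lambda>x. indicator {0..} x *\<^sub>R exp (- (s * x\<^sup>2 / 2))) (sqrt (pi / (2 * s)))"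
proof -
  define c where "c = sqrt (s / 2)"
  have c: "c > 0" "c\<^sup>2 = s / 2" using assms by (auto simp: c_def)
  have "has_bochner_integral lborel (\<lambda>x. indicator {0..} (0 + c * x) *\<^sub>R exp (- (0 + c * x)\<^sup>2)) ((sqrt pi / 2) /\<^sub>R \<bar>c\<bar>)"
    using lborel_has_bochner_integral_real_affine_iff[of c "\<lambda>x. indicator {0..} x *\<^sub>R exp (- x\<^sup>2)" "sqrt pi / 2" 0]
      gaussian_moment_0 c by simp
  moreover have "(sqrt pi / 2) /\<^sub>R \<bar>c\<bar> = sqrt (pi / (2 * s))"
  proof -
    have "((sqrt pi / 2) / c)\<^sup>2 = pi / (2 * s)" using c assms by (simp add: power_divide field_simps)
    then have "sqrt (pi / (2 * s)) = (sqrt pi / 2) / c"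
      by (metis abs_of_nonneg c(1) divide_nonneg_pos less_eq_real_def pi_ge_zero real_sqrt_abs real_sqrt_ge_zero zero_le_divide_iff zero_le_numeral)
    then show ?thesis using c by (simp add: field_simps)
  qed
  moreover have "(\<lambda>x. indicator {0..} (0 + c * x) *\<^sub>R exp (- (0 + c * x)\<^sup>2)) =
    (\<lambda>x :: real. indicator {0..} x *\<^sub>R exp (- (s * x\<^sup>2 / 2)))"
    using c by (auto simp: fun_eq_iff indicator_def zero_le_mult_iff power_mult_distrib)
  ultimately show ?thesis by simp
qed

text \<open>Comparison of sum and integral for a decreasing function: they differ by at most f 0 =
  1, while the integral grows like s^(-1/2).\<close>

lemma gaussian_sum_bounds:
  fixes s :: real
  assumes "s > 0"
  defines "f \<equiv> \<lambda>x::real. exp (- (s * x\<^sup>2 / 2))"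
  shows "summable (\<lambda>k. f (real k))" "sqrt (pi / (2 * s)) \<le> (\<Sum>k. f (real k))"
    "(\<Sum>k. f (real k)) \<le> sqrt (pi / (2 * s)) + 1"
proof -
  define I where "I = sqrt (pi / (2 * s))"
  have anti: "f y \<le> f x" if "0 \<le> x" "x \<le> y" for x y
    unfolding f_def using assms(1) that by (auto intro!: divide_right_mono mult_left_mono power_mono)
  interpret antimono_fun_sum_integral_diff f
    by standard (use anti in \<open>auto simp: f_def intro!: continuous_intros\<close>)
  have hb: "has_bochner_integral lborel (\<lambda>x. indicator {0..} x *\<^sub>R f x) I"
    using half_gaussian_integral[OF assms(1)] by (simp add: f_def I_def)
  have set_int: "set_integrable lborel {0..real n} f" for n
    unfolding f_def by (intro borel_integrable_atLeastAtMost' continuous_intros) auto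
  have int_eq: "integral {0..real n} f = (LINT x|lborel. indicator {..real n} x *\<^sub>R (indicator {0..} x *\<^sub>R f x))" for n
  proof -
    have "integral {0..real n} f = (LINT x:{0..real n}|lborel. f x)"
      using set_borel_integral_eq_integral(2)[OF set_int[of n]] by simp
    also have "\<dots> = (LINT x|lborel. indicator {..real n} x *\<^sub>R (indicator {0..} x *\<^sub>R f x))"
      unfolding set_lebesgue_integral_def by (intro Bochner_Integration.integral_cong) (auto simp: indicator_def)
    finally show ?thesis .
  qed
  have "((\<lambda>y. LINT x|lborel. indicator {..y} x *\<^sub>R (indicator {0..} x *\<^sub>R f x)) \<longlongrightarrow> (LINT x|lborel. indicator {0..} x *\<^sub>R f x)) at_top"
    by (rule tendsto_integral_at_top) (use hb in \<open>auto simp: has_bochner_integral_iff\<close>)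
  then have "((\<lambda>n. LINT x|lborel. indicator {..real n} x *\<^sub>R (indicator {0..} x *\<^sub>R f x)) \<longlonglongrightarrow> I)"
    using hb by (auto simp: has_bochner_integral_iff intro: filterlim_compose[OF _ filterlim_real_sequentially])
  then have lim: "(\<lambda>n. integral {0..real n} f) \<longlonglongrightarrow> I" unfolding int_eq .
  have bnd: "integral {0..real n} f \<le> (\<Sum>k\<le>n. f (real k))" "(\<Sum>k\<le>n. f (real k)) \<le> integral {0..real n} f + 1" for n
  proof -
    show "integral {0..real n} f \<le> (\<Sum>k\<le>n. f (real k))"
      using sum_integral_diff_series_nonneg[of n] by (simp add: sum_integral_diff_series_def)
    have "sum_integral_diff_series n \<le> sum_integral_diff_series 0"
      by (rule sum_integral_diff_series_antimono) simp
    moreover have "f 0 = 1" by (simp add: f_def)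
    ultimately show "(\<Sum>k\<le>n. f (real k)) \<le> integral {0..real n} f + 1"
      unfolding sum_integral_diff_series_def by simp
  qed
  have mono: "integral {0..real n} f \<le> I" for n
  proof -
    have "(LINT x|lborel. indicator {..real n} x *\<^sub>R (indicator {0..} x *\<^sub>R f x)) \<le> (LINT x|lborel. indicator {0..} x *\<^sub>R f x)"
    proof (rule integral_mono)
      have g: "integrable lborel (\<lambda>x. indicator {0..} x *\<^sub>R f x)" using hb by (simp only: has_bochner_integral_iff)
      show "integrable lborel (\<lambda>x. indicator {0..} x *\<^sub>R f x)" by (rule g)
      show "integrable lborel (\<lambda>x. indicator {..real n} x *\<^sub>R (indicator {0..} x *\<^sub>R f x))"
        by (rule integrable_mult_indicator[OF _ g]) simp
    qed (auto simp: indicator_def f_def)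
    then show ?thesis unfolding int_eq using hb by (simp add: has_bochner_integral_iff)
  qed
  have f0: "f x \<ge> 0" for x by (simp add: f_def)
  show s: "summable (\<lambda>k. f (real k))"
  proof (rule bounded_imp_summable)
    show "(\<Sum>k\<le>n. f (real k)) \<le> I + 1" for n using bnd(2)[of n] mono[of n] by linarith
  qed (rule f0)
  have sl: "(\<lambda>n. \<Sum>k\<le>n. f (real k)) \<longlonglongrightarrow> (\<Sum>k. f (real k))"
    using s by (simp add: summable_LIMSEQ')
  show "I \<le> (\<Sum>k. f (real k))" by (rule LIMSEQ_le[OF lim sl]) (use bnd in auto)
  show "(\<Sum>k. f (real k)) \<le> I + 1"
    by (rule LIMSEQ_le_const2[OF sl]) (use bnd(2) mono in \<open>auto intro!: exI[of _ 0] order_trans[OF bnd(2)]\<close>)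
qed

text \<open>From j^2 <= j (j + 1) <= (j + 1)^2 the series lies between the Gaussian sum and the same
  sum without its first term.\<close>

lemma theta_bounds:
  assumes "s > 0"
  shows "sqrt (pi / (2 * s)) - 1 \<le> theta s" "theta s \<le> sqrt (pi / (2 * s)) + 1"
proof -
  define f where "f = (\<lambda>x::real. exp (- (s * x\<^sup>2 / 2)))"
  have g: "summable (\<lambda>k. f (real k))" "sqrt (pi / (2 * s)) \<le> (\<Sum>k. f (real k))"
    "(\<Sum>k. f (real k)) \<le> sqrt (pi / (2 * s)) + 1"
    using gaussian_sum_bounds[OF assms] by (simp_all only: f_def)
  have e: "exp (- s) ^ tri j = exp (- (s * (real j * (real j + 1)) / 2))" for j
    unfolding exp_of_nat_mult[symmetric] real_tri by (simp add: algebra_simps)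
  have up: "exp (- s) ^ tri j \<le> f (real j)" and lo: "f (real (Suc j)) \<le> exp (- s) ^ tri j" for j
    unfolding e f_def using assms
    by (auto intro!: divide_right_mono mult_left_mono mult_mono simp: power2_eq_square)
  have st: "summable (\<lambda>j. exp (- s) ^ tri j)"
    by (rule summable_comparison_test'[OF g(1), of 0]) (simp add: up del: exp_le_cancel_iff)
  have sf: "summable (\<lambda>k. f (real (Suc k)))" using g(1) by (subst summable_Suc_iff)
  have "(\<Sum>k. f (real (Suc k))) \<le> theta s" unfolding theta_def by (rule suminf_le[OF lo sf st])
  moreover have "(\<Sum>k. f (real (Suc k))) = (\<Sum>k. f (real k)) - 1"
    using suminf_split_head[OF g(1)] by (simp add: f_def)
  ultimately show "sqrt (pi / (2 * s)) - 1 \<le> theta s" using g(2) by linarith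
  have "theta s \<le> (\<Sum>k. f (real k))" unfolding theta_def by (rule suminf_le[OF up st g(1)])
  then show "theta s \<le> sqrt (pi / (2 * s)) + 1" using g(3) by linarith
qed

lemma theta_asymp: "((\<lambda>s. ln (theta s) - ln (pi / (2 * s)) / 2) \<longlongrightarrow> 0) (at_right 0)"
proof -
  have "((\<lambda>s. theta s / sqrt (pi / (2 * s))) \<longlongrightarrow> 1) (at_right 0)"
  proof (rule tendsto_sandwich)
    show "\<forall>\<^sub>F s in at_right 0. 1 - 1 / sqrt (pi / (2 * s)) \<le> theta s / sqrt (pi / (2 * s))"
      using eventually_at_right_less[of 0]
    proof eventually_elim
      case (elim s)
      have I: "sqrt (pi / (2 * s)) > 0" using elim by simp
      have "(sqrt (pi / (2 * s)) - 1) / sqrt (pi / (2 * s)) \<le> theta s / sqrt (pi / (2 * s))"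
        by (rule divide_right_mono[OF theta_bounds(1)[OF elim]]) (use I in linarith)
      then show ?case using I unfolding diff_divide_distrib by (simp only: divide_self less_irrefl)
    qed
    show "\<forall>\<^sub>F s in at_right 0. theta s / sqrt (pi / (2 * s)) \<le> 1 + 1 / sqrt (pi / (2 * s))"
      using eventually_at_right_less[of 0]
    proof eventually_elim
      case (elim s)
      have I: "sqrt (pi / (2 * s)) > 0" using elim by simp
      have "theta s / sqrt (pi / (2 * s)) \<le> (sqrt (pi / (2 * s)) + 1) / sqrt (pi / (2 * s))"
        by (rule divide_right_mono[OF theta_bounds(2)[OF elim]]) (use I in linarith)
      then show ?case using I unfolding add_divide_distrib by (simp only: divide_self less_irrefl)
    qed
    show "((\<lambda>s. 1 - 1 / sqrt (pi / (2 * s))) \<longlongrightarrow> 1) (at_right 0)" by real_asymp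
    show "((\<lambda>s. 1 + 1 / sqrt (pi / (2 * s))) \<longlongrightarrow> 1) (at_right 0)" by real_asymp
  qed
  then have "((\<lambda>s. ln (theta s / sqrt (pi / (2 * s)))) \<longlongrightarrow> ln 1) (at_right 0)"
    by (rule tendsto_ln) simp
  moreover have "\<forall>\<^sub>F s in at_right 0. ln (theta s / sqrt (pi / (2 * s))) = ln (theta s) - ln (pi / (2 * s)) / 2"
    using eventually_at_right_less[of 0]
  proof eventually_elim
    case (elim s)
    have "theta s > 0" using log_gf_theta[OF elim] by (metis exp_gt_zero zero_less_mult_pos2)
    then show ?case using elim by (simp add: ln_div ln_sqrt)
  qed
  ultimately show ?thesis by (simp add: filterlim_cong)
qed

lemma exp_diff_quotient: "k > 0 \<Longrightarrow> ((\<lambda>s. s / (exp (k * s) - 1)) \<longlongrightarrow> 1 / k) (at_right (0::real))"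
proof -
  assume "k > 0"
  then have "((\<lambda>s. s / (exp (k * s) - 1)) \<longlongrightarrow> inverse k) (at_right (0::real))" by real_asymp
  then show ?thesis by (simp only: inverse_eq_divide)
qed

text \<open>Only the leading order, obtained termwise with exp y - 1 >= y as domination. It excludes
  the multiples of 1/s, which solve the homogeneous doubling relation D(s) = 2 D(2 s).\<close>

lemma s_log_gf: "((\<lambda>s. s * log_gf s) \<longlongrightarrow> pi\<^sup>2 / 6) (at_right (0::real))"
proof -
  have T: "((\<lambda>s. \<Sum>k. s / (real (Suc k) * (exp (real (Suc k) * s) - 1))) \<longlongrightarrow> (\<Sum>k. 1 / (real (Suc k))\<^sup>2)) (at_right 0)"
  proof (rule tannerys_theorem[THEN conjunct2, THEN conjunct2])
    fix k
    have "((\<lambda>s. s / (exp (real (Suc k) * s) - 1) / real (Suc k)) \<longlongrightarrow> 1 / real (Suc k) / real (Suc k)) (at_right 0)"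
      by (intro tendsto_divide exp_diff_quotient) auto
    then show "((\<lambda>s. s / (real (Suc k) * (exp (real (Suc k) * s) - 1))) \<longlongrightarrow> 1 / (real (Suc k))\<^sup>2) (at_right 0)"
      by (simp add: power2_eq_square mult.commute del: of_nat_Suc)
    show "\<forall>\<^sub>F (k, s) in sequentially \<times>\<^sub>F at_right 0. norm (s / (real (Suc k) * (exp (real (Suc k) * s) - 1))) \<le> 1 / (real (Suc k))\<^sup>2"
    proof -
      have "\<forall>\<^sub>F p in sequentially \<times>\<^sub>F at_right (0::real). snd p > 0"
        by (rule filterlim_snd[unfolded filterlim_iff, rule_format], rule eventually_at_right_less)
      then show ?thesis
      proof eventually_elim
        case (elim p)
        obtain k s where p: "p = (k, s)" by (cases p)
        define m where "m = real (Suc k)"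
        have m: "m > 0" "s > 0" using elim by (auto simp: p m_def)
        have "m * s \<le> exp (m * s) - 1" using exp_ge_add_one_self[of "m * s"] by linarith
        then have "s / (m * (exp (m * s) - 1)) \<le> s / (m * (m * s))"
          using m by (intro divide_left_mono mult_left_mono mult_pos_pos) (auto intro: less_le_trans[of 0 "m * s"])
        also have "\<dots> = 1 / m\<^sup>2" using m by (simp add: power2_eq_square)
        finally have "s / (m * (exp (m * s) - 1)) \<le> 1 / m\<^sup>2" .
        moreover have "0 \<le> s / (m * (exp (m * s) - 1))" using m by simp
        ultimately show ?case unfolding p prod.case real_norm_def m_def[symmetric] by linarith
      qed
    qed
    show "summable (\<lambda>k. 1 / (real (Suc k))\<^sup>2)"
      using inverse_squares_sums by (simp add: sums_iff add.commute)
  qed simp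
  have val: "(\<Sum>k. 1 / (real (Suc k))\<^sup>2) = pi\<^sup>2 / 6"
    using inverse_squares_sums by (simp add: sums_iff add.commute)
  have "\<forall>\<^sub>F s in at_right 0. (\<Sum>k. s / (real (Suc k) * (exp (real (Suc k) * s) - 1))) = s * log_gf s"
    using eventually_at_right_less[of 0]
  proof eventually_elim
    case (elim s)
    have "(\<lambda>k. complex_of_real (1 / (real (Suc k) * (exp (real (Suc k) * s) - 1)))) =
      (\<lambda>k. 1 / (of_nat (Suc k) * (exp (of_nat (Suc k) * of_real s) - 1)))"
      by (rule ext) (simp add: exp_of_real[symmetric])
    then have "summable (\<lambda>k. complex_of_real (1 / (real (Suc k) * (exp (real (Suc k) * s) - 1))))"
      using summable_norm_cancel[OF exp_log_gf(1)[of "of_real s"]] elim by (simp only: Re_complex_of_real)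
    then have "summable (\<lambda>k. 1 / (real (Suc k) * (exp (real (Suc k) * s) - 1)))"
      by (simp only: summable_complex_of_real)
    from suminf_mult[OF this, of s] show ?case by (simp add: log_gf_def)
  qed
  with T[unfolded val] show ?thesis by (rule Lim_transform_eventually)
qed

text \<open>Gauss's identity in logarithmic form says that the error D satisfies D(s) = 2 D(2 s) +
  e(s), where e tends to 0 by \<open>theta_asymp\<close>. The terms ln s / 2 and ln(2 pi) / 2 are
  exactly those that this relation requires.\<close>

lemma log_gf_asymp:
  "((\<lambda>s. log_gf s - pi\<^sup>2 / (6 * s) - ln s / 2 + ln (2 * pi) / 2) \<longlongrightarrow> 0) (at_right (0::real))"
proof -
  define D where "D = (\<lambda>s. log_gf s - pi\<^sup>2 / (6 * s) - ln s / 2 + ln (2 * pi) / 2 :: real)"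
  define e where "e = (\<lambda>s. ln (theta s) - ln (pi / (2 * s)) / 2)"
  have De: "D s = 2 * D (2 * s) + e s" if s: "s > 0" for s
  proof -
    have th: "theta s > 0" using log_gf_theta[OF s] by (metis exp_gt_zero zero_less_mult_pos2)
    have "log_gf s = ln (theta s * exp (2 * log_gf (2 * s)))"
      using log_gf_theta[OF s] by (metis ln_exp)
    also have "\<dots> = ln (theta s) + 2 * log_gf (2 * s)" using th by (simp add: ln_mult)
    finally have "log_gf s = ln (theta s) + 2 * log_gf (2 * s)" .
    then show ?thesis using s unfolding D_def e_def by (simp add: ln_mult ln_div field_simps)
  qed
  have e0: "(e \<longlongrightarrow> 0) (at_right 0)" unfolding e_def by (rule theta_asymp)
  have sD: "((\<lambda>s. s * D s) \<longlongrightarrow> 0) (at_right 0)"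
  proof -
    have "((\<lambda>s. s * log_gf s - pi\<^sup>2 / 6 - s * ln s / 2 + s * ln (2 * pi) / 2) \<longlongrightarrow> pi\<^sup>2 / 6 - pi\<^sup>2 / 6 - 0 + 0) (at_right 0)"
    proof (intro tendsto_add tendsto_diff s_log_gf tendsto_const)
      show "((\<lambda>s::real. s * ln s / 2) \<longlongrightarrow> 0) (at_right 0)" by real_asymp
      show "((\<lambda>s::real. s * ln (2 * pi) / 2) \<longlongrightarrow> 0) (at_right 0)" by real_asymp
    qed
    moreover have "\<forall>\<^sub>F s in at_right 0. s * log_gf s - pi\<^sup>2 / 6 - s * ln s / 2 + s * ln (2 * pi) / 2 = s * D s"
      using eventually_at_right_less[of 0]
      by eventually_elim (simp add: D_def field_simps power2_eq_square)
    ultimately show ?thesis by (simp add: filterlim_cong)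
  qed
  have "(D \<longlongrightarrow> 0) (at_right 0)"
  proof (rule tendstoI)
    fix \<epsilon> :: real assume eps: "\<epsilon> > 0"
    obtain d where d: "d > 0" "\<And>s. 0 < s \<Longrightarrow> s < d \<Longrightarrow> \<bar>e s\<bar> < \<epsilon> / 2"
      using tendstoD[OF e0, of "\<epsilon> / 2"] eps by (auto simp: eventually_at_right_field)
    \<comment> \<open>Read backwards the relation is a contraction, D(2 r) = (D(r) - e(r)) / 2. The
      errors met on the way from s to s/2^m form a geometric series with total below
      epsilon/2.\<close>
    have it: "\<bar>D s\<bar> \<le> \<bar>D (s / 2 ^ m)\<bar> / 2 ^ m + \<epsilon> / 2" if s: "0 < s" "s < d" for s m
    proof -
      have "\<bar>D s\<bar> \<le> \<bar>D (s / 2 ^ m)\<bar> / 2 ^ m + (1 - 1 / 2 ^ m) * (\<epsilon> / 2)"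
      proof (induction m)
        case (Suc m)
        define r where "r = s / 2 ^ Suc m"
        have "s / 2 ^ Suc m < s * 1" unfolding divide_inverse using s by (intro mult_strict_left_mono) (auto simp: inverse_less_1_iff one_less_power simp del: power_Suc)
        then have r: "r > 0" "r < d" using s by (auto simp: r_def)
        have r2: "s / 2 ^ m = 2 * r" by (simp add: r_def)
        have "2 * D (2 * r) = D r - e r" using De[OF r(1)] by simp
        then have "\<bar>2 * D (2 * r)\<bar> \<le> \<bar>D r\<bar> + \<epsilon> / 2" using d(2)[OF r] by linarith
        then have "\<bar>D (2 * r)\<bar> \<le> (\<bar>D r\<bar> + \<epsilon> / 2) / 2" by (simp add: abs_mult)
        then have "\<bar>D (2 * r)\<bar> / 2 ^ m \<le> (\<bar>D r\<bar> + \<epsilon> / 2) / 2 / 2 ^ m" by (rule divide_right_mono) simp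
        then have "\<bar>D s\<bar> \<le> (\<bar>D r\<bar> + \<epsilon> / 2) / 2 / 2 ^ m + (1 - 1 / 2 ^ m) * (\<epsilon> / 2)"
          using Suc unfolding r2 by linarith
        also have "\<dots> = \<bar>D r\<bar> / 2 ^ Suc m + (1 - 1 / 2 ^ Suc m) * (\<epsilon> / 2)" by (simp add: field_simps)
        finally show ?case by (simp add: r_def)
      qed simp
      also have "(1 - 1 / 2 ^ m) * (\<epsilon> / 2) \<le> 1 * (\<epsilon> / 2)" using eps by (intro mult_right_mono) auto
      finally show ?thesis by simp
    qed
    have "\<bar>D s\<bar> \<le> \<epsilon> / 2" if s: "0 < s" "s < d" for s
    proof (rule LIMSEQ_le_const)
      \<comment> \<open>With r = s/2^m the leftover |D(r)|/2^m equals |r D(r)|/s, which vanishes in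
        the limit by \<open>sD\<close>.\<close>
      have "filterlim (\<lambda>m. s / 2 ^ m) (at_right 0) sequentially"
        using s by real_asymp
      from filterlim_compose[OF sD this] have "(\<lambda>m. s / 2 ^ m * D (s / 2 ^ m)) \<longlonglongrightarrow> 0" .
      then have "(\<lambda>m. \<bar>s / 2 ^ m * D (s / 2 ^ m)\<bar> / s) \<longlonglongrightarrow> \<bar>0\<bar> / s"
        using s by (intro tendsto_intros) auto
      then have "(\<lambda>m. \<bar>D (s / 2 ^ m)\<bar> / 2 ^ m) \<longlonglongrightarrow> 0"
        using s by (simp add: abs_mult)
      then have "(\<lambda>m. \<bar>D (s / 2 ^ m)\<bar> / 2 ^ m + \<epsilon> / 2) \<longlonglongrightarrow> 0 + \<epsilon> / 2" by (intro tendsto_add tendsto_const)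
      then show "(\<lambda>m. \<bar>D (s / 2 ^ m)\<bar> / 2 ^ m + \<epsilon> / 2) \<longlonglongrightarrow> \<epsilon> / 2" by simp
      show "\<exists>N. \<forall>m\<ge>N. \<bar>D s\<bar> \<le> \<bar>D (s / 2 ^ m)\<bar> / 2 ^ m + \<epsilon> / 2" using it[OF s] by blast
    qed
    then show "\<forall>\<^sub>F s in at_right 0. dist (D s) 0 < \<epsilon>"
    proof -
      have "\<forall>\<^sub>F s in at_right 0. 0 < s \<and> s < d"
        using d(1) by (auto simp: eventually_at_right_field)
      then show ?thesis
      proof eventually_elim
        case (elim s)
        then have "\<bar>D s\<bar> \<le> \<epsilon> / 2" using \<open>\<And>s. 0 < s \<Longrightarrow> s < d \<Longrightarrow> \<bar>D s\<bar> \<le> \<epsilon> / 2\<close> by blast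
        then show ?case using eps by (simp add: dist_real_def)
      qed
    qed
  qed
  then show ?thesis by (simp add: D_def)
qed

subsection \<open>The saddle point\<close>

text \<open>The scaling means A x^2 = sigma^3 u^2, and n = A/sigma^2 is the saddle condition. The
  linear terms in x cancel exactly, so no Taylor remainder appears and only the factor sigma/s,
  which tends to 1, is left.\<close>

lemma saddle_exponent:
  fixes \<sigma> x A u n :: real
  assumes "\<sigma> > 0" "A > 0" "n = A / \<sigma>\<^sup>2" "x = \<sigma> * sqrt (\<sigma> / A) * u"
  shows "of_real A * (1 / (of_real \<sigma> - \<i> * of_real x) - 1 / of_real \<sigma>) - \<i> * of_real n * of_real x =
     - of_real (u\<^sup>2) * (of_real \<sigma> / (of_real \<sigma> - \<i> * of_real x))"
proof -
  define s where "s = of_real \<sigma> - \<i> * of_real x"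
  have s: "s \<noteq> 0" using assms by (auto simp: s_def complex_eq_iff)
  have "x\<^sup>2 = \<sigma>\<^sup>2 * (\<sigma> / A) * u\<^sup>2" using assms by (simp add: power_mult_distrib)
  then have "A * x\<^sup>2 = \<sigma> ^ 3 * u\<^sup>2" using assms by (simp add: field_simps power2_eq_square power3_eq_cube)
  then have xx: "of_real A * (of_real x)\<^sup>2 = (of_real \<sigma> ^ 3 * of_real (u\<^sup>2) :: complex)"
    by (simp only: flip: of_real_power of_real_mult)
  have "of_real A * (1 / s - 1 / of_real \<sigma>) - \<i> * of_real n * of_real x =
     of_real A * (\<i> * of_real x) * (of_real \<sigma> - s) / (s * of_real \<sigma> ^ 2)"
  proof -
    have "1 / s - 1 / of_real \<sigma> = (of_real \<sigma> - s) / (s * of_real \<sigma>)" using s assms by (simp add: field_simps)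
    also have "of_real \<sigma> - s = \<i> * of_real x" by (simp add: s_def)
    finally have 1: "1 / s - 1 / of_real \<sigma> = \<i> * of_real x / (s * of_real \<sigma>)" .
    have 2: "(of_real n :: complex) = of_real A / of_real \<sigma> ^ 2" using assms by simp
    have gen: "a * (b / (s * c)) - \<i> * (a / c\<^sup>2) * y = a * b * (c - s) / (s * c\<^sup>2)"
      if "c \<noteq> 0" "b = \<i> * y" for a b c y :: complex
      using s that by (simp add: field_simps power2_eq_square)
    show ?thesis unfolding 1 2 by (rule gen) (use assms in auto)
  qed
  also have "of_real \<sigma> - s = \<i> * of_real x" by (simp add: s_def)
  also have "of_real A * (\<i> * of_real x) * (\<i> * of_real x) = - (of_real A * (of_real x)\<^sup>2)"
    by (simp add: power2_eq_square algebra_simps)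
  also have "\<dots> / (s * of_real \<sigma> ^ 2) = - of_real (u\<^sup>2) * (of_real \<sigma> / s)"
    unfolding xx using s assms by (simp add: field_simps power2_eq_square power3_eq_cube)
  finally show ?thesis by (simp add: s_def)
qed

lemma exp_ge_one_plus_cube:
  fixes z :: real assumes "z \<ge> 0" shows "1 + z ^ 3 / 27 \<le> exp z"
proof -
  have "1 + z ^ 3 / 27 \<le> (1 + z / 3) ^ 3" using assms by (simp add: power3_eq_cube field_simps)
  also have "\<dots> \<le> exp (z / 3) ^ 3" using assms exp_ge_add_one_self[of "z / 3"] by (intro power_mono) auto
  also have "\<dots> = exp z" by (simp flip: exp_of_nat_mult)
  finally show ?thesis .
qed

text \<open>An integrable majorant in u. As long as the minimum is its second argument, the exponent
  is c u^2/A. Otherwise it is the constant c/sigma; but |x| <= pi confines u^2 to O(sigma^(-3)), and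
  the exponential of c/sigma exceeds its cube divided by 27.\<close>

lemma exp_min_bound:
  assumes "c > 0" "A > 0"
  obtains d where "d > 0" and
    "\<And>\<sigma> u. 0 < \<sigma> \<Longrightarrow> \<bar>\<sigma> * sqrt (\<sigma> / A) * u\<bar> \<le> pi \<Longrightarrow>
       exp (- (c * (min 1 ((sqrt (\<sigma> / A) * u)\<^sup>2) / \<sigma>))) \<le> inverse d * inverse (1 + u\<^sup>2)"
proof -
  define d where "d = min 1 (min (c / A) (c ^ 3 / (27 * (pi\<^sup>2 * A))))"
  have d: "d > 0" "d \<le> 1" "d \<le> c / A" "d \<le> c ^ 3 / (27 * (pi\<^sup>2 * A))"
    using assms by (auto simp: d_def)
  show thesis
  proof (rule that[OF d(1)])
    fix \<sigma> u :: real assume s: "0 < \<sigma>" and u: "\<bar>\<sigma> * sqrt (\<sigma> / A) * u\<bar> \<le> pi"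
    define z where "z = c * (min 1 ((sqrt (\<sigma> / A) * u)\<^sup>2) / \<sigma>)"
    have sq: "(sqrt (\<sigma> / A) * u)\<^sup>2 = \<sigma> / A * u\<^sup>2" using s assms by (simp add: power_mult_distrib)
    have "1 + d * u\<^sup>2 \<le> exp z"
    proof (cases "(sqrt (\<sigma> / A) * u)\<^sup>2 \<le> 1")
      case True
      then have z: "z = c / A * u\<^sup>2" using s by (simp add: z_def sq min_def)
      have "d * u\<^sup>2 \<le> c / A * u\<^sup>2" using d by (intro mult_right_mono) auto
      then show ?thesis unfolding z using exp_ge_add_one_self[of "c / A * u\<^sup>2"] by linarith
    next
      case False
      then have z: "z = c / \<sigma>" by (simp add: z_def min_def)
      have "\<bar>\<sigma> * sqrt (\<sigma> / A) * u\<bar>\<^sup>2 \<le> pi\<^sup>2" using u by (intro power_mono) auto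
      then have "\<sigma> ^ 3 * u\<^sup>2 \<le> pi\<^sup>2 * A" using s assms
        by (simp add: power_mult_distrib field_simps power2_eq_square power3_eq_cube)
      then have "u\<^sup>2 / (pi\<^sup>2 * A) \<le> 1 / \<sigma> ^ 3" using s assms by (simp add: field_simps)
      then have "c ^ 3 / 27 * (u\<^sup>2 / (pi\<^sup>2 * A)) \<le> c ^ 3 / 27 * (1 / \<sigma> ^ 3)"
        using assms by (intro mult_left_mono) auto
      moreover have "d * u\<^sup>2 \<le> c ^ 3 / (27 * (pi\<^sup>2 * A)) * u\<^sup>2" using d by (intro mult_right_mono) auto
      moreover have "z ^ 3 / 27 = c ^ 3 / 27 * (1 / \<sigma> ^ 3)" by (simp add: z power_divide)
      moreover have "1 + z ^ 3 / 27 \<le> exp z" using z s assms by (intro exp_ge_one_plus_cube) simp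
      ultimately show ?thesis by simp
    qed
    moreover have "d * (1 + u\<^sup>2) \<le> 1 + d * u\<^sup>2" using d by (simp add: algebra_simps)
    ultimately have "d * (1 + u\<^sup>2) \<le> exp z" by linarith
    moreover have "0 < d * (1 + u\<^sup>2)" using d by (intro mult_pos_pos) (auto simp: add_pos_nonneg)
    ultimately have "inverse (exp z) \<le> inverse (d * (1 + u\<^sup>2))" by (rule le_imp_inverse_le)
    then show "exp (- (c * (min 1 ((sqrt (\<sigma> / A) * u)\<^sup>2) / \<sigma>))) \<le> inverse d * inverse (1 + u\<^sup>2)"
      by (simp add: exp_minus z_def)
  qed
qed

lemma gaussian_integral: "(LINT u|lborel. complex_of_real (exp (- u\<^sup>2))) = of_real (sqrt pi)"
proof -
  have "has_bochner_integral lborel (\<lambda>x::real. exp (- x\<^sup>2)) (2 *\<^sub>R (sqrt pi / 2))"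
    by (rule has_bochner_integral_even_function[OF gaussian_moment_0]) simp
  then have "(LINT u|lborel. exp (- u\<^sup>2 :: real)) = sqrt pi" by (simp add: has_bochner_integral_iff)
  then show ?thesis by (simp add: integral_complex_of_real)
qed

lemma borel_measurable_log_gf [measurable]:
  "(\<lambda>x. log_gf (complex_of_real \<sigma> - \<i> * complex_of_real (f x))) \<in> borel_measurable lborel"
  if [measurable]: "f \<in> borel_measurable lborel"
  unfolding log_gf_def by measurable

text \<open>\<open>\<sigma>\<close> is the minimum of A/sigma + n sigma, the main part of the
  exponent on the axis. \<open>h\<close> is the width at which the quadratic term of the exponent
  becomes u^2. \<open>g\<close> is the integrand divided by its value at x = 0, as a function of
  u.\<close>

context
  fixes t :: nat and A :: real and \<sigma> h :: "nat \<Rightarrow> real" and g :: "nat \<Rightarrow> real \<Rightarrow> complex"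
  assumes t: "t > 0"
  defines "A \<equiv> real t * pi\<^sup>2 / 6"
  defines "\<sigma> \<equiv> \<lambda>n. sqrt (A / real n)"
  defines "h \<equiv> \<lambda>n. \<sigma> n * sqrt (\<sigma> n / A)"
  defines "g \<equiv> \<lambda>n u. indicator {- pi..pi} (h n * u) *\<^sub>R
     exp (of_nat t * (log_gf (of_real (\<sigma> n) - \<i> * of_real (h n * u)) - of_real (log_gf (\<sigma> n)))
          - \<i> * of_nat n * of_real (h n * u))"
begin

lemma A_pos: "A > 0" using t by (simp add: A_def)

lemma sigma_pos: "n > 0 \<Longrightarrow> \<sigma> n > 0" using A_pos by (simp add: \<sigma>_def)

lemma sigma_tendsto: "filterlim \<sigma> (at_right 0) sequentially"
  unfolding \<sigma>_def using A_pos by real_asymp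

lemma n_sigma: "n > 0 \<Longrightarrow> real n = A / (\<sigma> n)\<^sup>2"
  using A_pos by (simp add: \<sigma>_def)

lemma integral_g:
  assumes "n > 0"
  shows "(LINT u|lborel. g n u) = of_real (2 * pi * real (tuple_count t n) * exp (- (real n * \<sigma> n)) / (h n * exp (real t * log_gf (\<sigma> n))))"
proof -
  have h: "h n > 0" using sigma_pos[OF assms] A_pos by (simp add: h_def)
  define F where "F = (\<lambda>x. indicator {- pi..pi} x *\<^sub>R
            exp (of_nat t * log_gf (of_real (\<sigma> n) - \<i> * of_real x) - \<i> * of_nat n * of_real x))"
  have F: "F (0 + h n * u) = exp (of_real (real t * log_gf (\<sigma> n))) * g n u" for u
    unfolding F_def g_def mult_scaleR_right exp_add[symmetric] by (simp add: algebra_simps)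
  have "of_real (2 * pi * real (tuple_count t n) * exp (- (real n * \<sigma> n))) = (LINT x|lborel. F x)"
    unfolding F_def tuple_count_integral[OF sigma_pos[OF assms]] ..
  also have "\<dots> = \<bar>h n\<bar> *\<^sub>R (LINT u|lborel. F (0 + h n * u))"
    by (rule lborel_integral_real_affine) (use h in simp)
  also have "\<dots> = of_real (h n * exp (real t * log_gf (\<sigma> n))) * (LINT u|lborel. g n u)"
    unfolding F exp_of_real using h by (simp add: scaleR_conv_of_real)
  finally have "of_real (h n * exp (real t * log_gf (\<sigma> n))) * (LINT u|lborel. g n u) =
    of_real (2 * pi * real (tuple_count t n) * exp (- (real n * \<sigma> n)))" ..
  moreover have "complex_of_real (h n * exp (real t * log_gf (\<sigma> n))) \<noteq> 0"
    using h by (simp del: of_real_mult)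
  ultimately show ?thesis unfolding of_real_divide by (metis nonzero_mult_div_cancel_left)
qed

lemma h_over_sigma: "(\<lambda>n. h n * u / \<sigma> n) \<longlonglongrightarrow> 0"
proof -
  have "(\<lambda>n. sqrt (\<sigma> n / A) * u) \<longlonglongrightarrow> sqrt (0 / A) * u"
    using sigma_tendsto A_pos by (intro tendsto_intros) (auto simp: filterlim_at)
  moreover have "\<forall>\<^sub>F n in sequentially. sqrt (\<sigma> n / A) * u = h n * u / \<sigma> n"
    using eventually_gt_at_top[of 0] by eventually_elim (use sigma_pos in \<open>force simp: h_def\<close>)
  ultimately show ?thesis by (simp add: tendsto_cong)
qed

text \<open>Replacing the increment of \<open>log_gf\<close> by that of pi^2/(6 s) costs K |x|
  sigma^(-5/4) by \<open>log_gf_diff\<close>. Since |x| is of order sigma^(3/2) for fixed u, this is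
  O(sigma^(1/4)).\<close>

lemma g_tendsto: "(\<lambda>n. g n u) \<longlonglongrightarrow> of_real (exp (- u\<^sup>2))"
proof -
  obtain K where K: "K > 0" "\<And>\<sigma> x. \<sigma> > 0 \<Longrightarrow> \<bar>x\<bar> \<le> \<sigma> \<Longrightarrow>
    norm (log_gf (of_real \<sigma> - \<i> * of_real x) - log_gf (of_real \<sigma>)
      - of_real (pi\<^sup>2 / 6) * (1 / (of_real \<sigma> - \<i> * of_real x) - 1 / of_real \<sigma>)) \<le> K * \<bar>x\<bar> * \<sigma> powr (- 5 / 4)"
    using log_gf_diff by metis
  define R where "R = (\<lambda>n. log_gf (of_real (\<sigma> n) - \<i> * of_real (h n * u)) - log_gf (of_real (\<sigma> n))
      - of_real (pi\<^sup>2 / 6) * (1 / (of_real (\<sigma> n) - \<i> * of_real (h n * u)) - 1 / of_real (\<sigma> n)))"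
  define y where "y = (\<lambda>n. h n * u / \<sigma> n)"
  have s0: "\<sigma> \<longlonglongrightarrow> 0" using sigma_tendsto by (simp add: filterlim_at)
  have ev_pos: "\<forall>\<^sub>F n in sequentially. \<sigma> n > 0"
    using eventually_gt_at_top[of 0] by eventually_elim (use sigma_pos in auto)
  have y0: "y \<longlonglongrightarrow> 0" unfolding y_def by (rule h_over_sigma)
  have "(\<lambda>n. \<bar>y n\<bar>) \<longlonglongrightarrow> 0" using y0 by (simp add: tendsto_rabs_zero)
  then have ev_y: "\<forall>\<^sub>F n in sequentially. \<bar>y n\<bar> < 1" by (rule order_tendstoD) simp
  have ev_x: "\<forall>\<^sub>F n in sequentially. \<bar>h n * u\<bar> \<le> \<sigma> n"
    using ev_pos ev_y by eventually_elim (simp add: y_def abs_mult)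
  have ev_s1: "\<forall>\<^sub>F n in sequentially. \<sigma> n < 1" using s0 by (rule order_tendstoD) simp
  have R0: "R \<longlonglongrightarrow> 0"
  proof (rule Lim_null_comparison)
    show "\<forall>\<^sub>F n in sequentially. norm (R n) \<le> K * \<bar>u\<bar> * A powr (- 1 / 2) * \<sigma> n powr (1 / 4)"
      using ev_pos ev_x
    proof eventually_elim
      case (elim n)
      have "norm (R n) \<le> K * \<bar>h n * u\<bar> * \<sigma> n powr (- 5 / 4)"
        unfolding R_def by (rule K(2)) (use elim in auto)
      also have "\<bar>h n * u\<bar> = \<sigma> n powr (3 / 2) * A powr (- 1 / 2) * \<bar>u\<bar>"
      proof -
        have "h n = \<sigma> n powr 1 * (\<sigma> n powr (1 / 2) * A powr (- 1 / 2))"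
          using elim A_pos by (simp add: h_def powr_half_sqrt powr_minus real_sqrt_divide divide_simps)
        also have "\<dots> = \<sigma> n powr (3 / 2) * A powr (- 1 / 2)"
          unfolding mult.assoc[symmetric] powr_add[symmetric] by simp
        finally show ?thesis by (simp add: abs_mult)
      qed
      also have "K * (\<sigma> n powr (3 / 2) * A powr (- 1 / 2) * \<bar>u\<bar>) * \<sigma> n powr (- 5 / 4) =
        K * \<bar>u\<bar> * A powr (- 1 / 2) * (\<sigma> n powr (3 / 2) * \<sigma> n powr (- 5 / 4))" by simp
      also have "\<sigma> n powr (3 / 2) * \<sigma> n powr (- 5 / 4) = \<sigma> n powr (1 / 4)"
        unfolding powr_add[symmetric] by simp
      finally show ?case .
    qed
    have "((\<lambda>s::real. s powr (1 / 4)) \<longlongrightarrow> 0) (at_right 0)" by real_asymp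
    from filterlim_compose[OF this sigma_tendsto]
    show "(\<lambda>n. K * \<bar>u\<bar> * A powr (- 1 / 2) * \<sigma> n powr (1 / 4)) \<longlonglongrightarrow> 0"
      by (rule tendsto_mult_right_zero)
  qed
  have "(\<lambda>n. exp (of_nat t * R n - of_real (u\<^sup>2) * (1 / (1 - \<i> * of_real (y n))))) \<longlonglongrightarrow>
     exp (of_nat t * 0 - of_real (u\<^sup>2) * (1 / (1 - \<i> * of_real 0)))"
    by (intro tendsto_intros R0 y0) auto
  moreover have "\<forall>\<^sub>F n in sequentially. exp (of_nat t * R n - of_real (u\<^sup>2) * (1 / (1 - \<i> * of_real (y n)))) = g n u"
    using ev_pos ev_x ev_s1 eventually_gt_at_top[of 0]
  proof eventually_elim
    case (elim n)
    let ?s = "of_real (\<sigma> n) - \<i> * of_real (h n * u)"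
    have "\<bar>h n * u\<bar> \<le> pi" using elim pi_ge_two by linarith
    then have ind: "indicator {- pi..pi} (h n * u) = (1 :: real)" by (auto simp: indicator_def)
    have e: "of_real A * (1 / ?s - 1 / of_real (\<sigma> n)) - \<i> * of_real (real n) * of_real (h n * u) =
       - of_real (u\<^sup>2) * (of_real (\<sigma> n) / ?s)"
      by (rule saddle_exponent) (use elim A_pos n_sigma in \<open>auto simp: h_def\<close>)
    have "?s = of_real (\<sigma> n) * (1 - \<i> * of_real (y n))" using elim by (simp add: y_def algebra_simps)
    then have q: "of_real (\<sigma> n) / ?s = 1 / (1 - \<i> * of_real (y n))" using elim by simp
    have tA: "of_nat t * of_real (pi\<^sup>2 / 6) = (of_real A :: complex)" by (simp add: A_def)
    have "of_nat t * (log_gf ?s - of_real (log_gf (\<sigma> n))) - \<i> * of_nat n * of_real (h n * u) =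
       of_nat t * R n + (of_nat t * of_real (pi\<^sup>2 / 6) * (1 / ?s - 1 / of_real (\<sigma> n)) - \<i> * of_real (real n) * of_real (h n * u))"
      unfolding R_def log_gf_of_real[OF elim(1)] by (simp add: algebra_simps)
    also have "\<dots> = of_nat t * R n - of_real (u\<^sup>2) * (1 / (1 - \<i> * of_real (y n)))"
      unfolding tA e q by simp
    finally show ?case by (simp add: g_def ind)
  qed
  ultimately have "(\<lambda>n. g n u) \<longlonglongrightarrow> exp (of_nat t * 0 - of_real (u\<^sup>2) * (1 / (1 - \<i> * of_real 0)))"
    by (rule Lim_transform_eventually)
  then show ?thesis by (simp add: exp_of_real[symmetric])
qed

lemma integral_g_tendsto: "(\<lambda>n. LINT u|lborel. g n u) \<longlonglongrightarrow> of_real (sqrt pi)"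
proof -
  obtain d where d: "d > 0" "\<And>s u. 0 < s \<Longrightarrow> \<bar>s * sqrt (s / A) * u\<bar> \<le> pi \<Longrightarrow>
       exp (- (real t / 170 * (min 1 ((sqrt (s / A) * u)\<^sup>2) / s))) \<le> inverse d * inverse (1 + u\<^sup>2)"
    using exp_min_bound[of "real t / 170" A] t A_pos by auto
  have s0: "\<sigma> \<longlonglongrightarrow> 0" using sigma_tendsto by (simp add: filterlim_at)
  have "\<forall>\<^sub>F n in sequentially. \<sigma> n < 1 \<and> n > 0"
    using order_tendstoD(2)[OF s0, of 1] eventually_gt_at_top[of 0] by (simp add: eventually_conj)
  then obtain N where N: "\<And>n. n \<ge> N \<Longrightarrow> \<sigma> n < 1 \<and> n > 0" by (auto simp: eventually_sequentially)
  have "(\<lambda>n. LINT u|lborel. g (n + N) u) \<longlonglongrightarrow> (LINT u|lborel. complex_of_real (exp (- u\<^sup>2)))"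
  proof (rule integral_dominated_convergence[where w = "\<lambda>u. inverse d * inverse (1 + u\<^sup>2)"])
    show "integrable lborel (\<lambda>u. inverse d * inverse (1 + u\<^sup>2))"
      using integrable_inverse_1_plus_square by (intro integrable_mult_right) (simp add: set_integrable_def)
    show "AE u in lborel. (\<lambda>n. g (n + N) u) \<longlonglongrightarrow> of_real (exp (- u\<^sup>2))"
      using g_tendsto by (intro AE_I2 LIMSEQ_ignore_initial_segment)
    show "g (n + N) \<in> borel_measurable lborel" for n
      unfolding g_def by measurable
    fix n
    show "AE u in lborel. norm (g (n + N) u) \<le> inverse d * inverse (1 + u\<^sup>2)"
    proof (rule AE_I2)
      fix u
      define m where "m = n + N"
      have m: "\<sigma> m < 1" "m > 0" "\<sigma> m > 0" using N[of m] sigma_pos[of m] by (auto simp: m_def)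
      show "norm (g (n + N) u) \<le> inverse d * inverse (1 + u\<^sup>2)"
      proof (cases "\<bar>h m * u\<bar> \<le> pi")
        case True
        have "norm (g m u) \<le> exp (real t * (Re (log_gf (of_real (\<sigma> m) - \<i> * of_real (h m * u))) - log_gf (\<sigma> m)))"
          by (simp add: g_def indicator_def algebra_simps)
        also have "\<dots> \<le> exp (real t * (- (min 1 ((h m * u / \<sigma> m)\<^sup>2) / (170 * \<sigma> m))))"
          using minor_arc[of "\<sigma> m" "h m * u"] m True by (intro exp_le_cancel_iff[THEN iffD2] mult_left_mono) auto
        also have "\<dots> = exp (- (real t / 170 * (min 1 ((sqrt (\<sigma> m / A) * u)\<^sup>2) / \<sigma> m)))"
          using m by (simp add: h_def)
        also have "\<dots> \<le> inverse d * inverse (1 + u\<^sup>2)"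
          by (rule d(2)) (use m True in \<open>auto simp: h_def\<close>)
        finally show ?thesis by (simp add: m_def)
      next
        case False
        then have "g m u = 0" by (auto simp: g_def indicator_def)
        then show ?thesis using d(1) by (simp add: m_def)
      qed
    qed
  qed auto
  then have "(\<lambda>n. LINT u|lborel. g n u) \<longlonglongrightarrow> (LINT u|lborel. complex_of_real (exp (- u\<^sup>2)))"
    by (rule LIMSEQ_offset)
  then show ?thesis by (simp only: gaussian_integral)
qed

text \<open>At the saddle n sigma and t pi^2/(6 sigma) both equal sqrt(A n), whence the exponent 2
  sqrt(A n). The remaining factors are sigma^(t/2) (2 pi)^(-t/2) from \<open>log_gf_asymp\<close>,
  sigma^(3/2) from the width \<open>h\<close>, and sqrt(pi)/(2 pi) from the Gaussian
  integral.\<close>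

lemma tuple_count_asymp_aux:
  "(\<lambda>n. real (tuple_count t n) * exp (- 2 * sqrt (A * real n)) * real n powr ((real t + 3) / 4)) \<longlonglongrightarrow>
     A powr ((real t + 1) / 4) / (2 * sqrt pi * (2 * pi) powr (real t / 2))"
proof -
  define Q where "Q = (\<lambda>n. 2 * pi * real (tuple_count t n) * exp (- (real n * \<sigma> n)) / (h n * exp (real t * log_gf (\<sigma> n))))"
  define E where "E = (\<lambda>s. log_gf s - pi\<^sup>2 / (6 * s) - ln s / 2 + ln (2 * pi) / 2 :: real)"
  define c where "c = A powr ((real t + 1) / 4) / (2 * pi * (2 * pi) powr (real t / 2))"
  have "(\<lambda>n. complex_of_real (Q n)) \<longlonglongrightarrow> of_real (sqrt pi)"
    using integral_g_tendsto
  proof (rule Lim_transform_eventually)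
    show "\<forall>\<^sub>F n in sequentially. (LINT u|lborel. g n u) = complex_of_real (Q n)"
      using eventually_gt_at_top[of 0] by eventually_elim (simp only: integral_g Q_def)
  qed
  then have Q: "Q \<longlonglongrightarrow> sqrt pi" by (simp only: tendsto_of_real_iff)
  have E: "(\<lambda>n. E (\<sigma> n)) \<longlonglongrightarrow> 0"
    unfolding E_def by (rule filterlim_compose[OF log_gf_asymp sigma_tendsto])
  have "(\<lambda>n. c * (Q n * exp (real t * E (\<sigma> n)))) \<longlonglongrightarrow> c * (sqrt pi * exp (real t * 0))"
    by (intro tendsto_intros Q E)
  then have lim: "(\<lambda>n. c * (Q n * exp (real t * E (\<sigma> n)))) \<longlonglongrightarrow> c * (sqrt pi * exp (real t * 0))" .
  have val: "c * (sqrt pi * exp (real t * 0)) = A powr ((real t + 1) / 4) / (2 * sqrt pi * (2 * pi) powr (real t / 2))"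
  proof -
    have e: "sqrt pi / pi = 1 / sqrt pi" by (simp add: frac_eq_eq)
    have "c * (sqrt pi * exp (real t * 0)) = A powr ((real t + 1) / 4) / (2 * (2 * pi) powr (real t / 2)) * (sqrt pi / pi)"
      by (simp add: c_def)
    then show ?thesis unfolding e by simp
  qed
  have ev: "\<forall>\<^sub>F n in sequentially. c * (Q n * exp (real t * E (\<sigma> n))) =
     real (tuple_count t n) * exp (- 2 * sqrt (A * real n)) * real n powr ((real t + 3) / 4)"
    using eventually_gt_at_top[of 0]
  proof eventually_elim
    case (elim n)
    define N where "N = real n"
    have N: "N > 0" using elim by (simp add: N_def)
    have A: "A > 0" by (rule A_pos)
    define S where "S = sqrt (A * N)"
    have s: "\<sigma> n > 0" using sigma_pos[OF elim] .
    have sg: "\<sigma> n = A powr (1 / 2) * N powr (- 1 / 2)"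
      using A N by (simp add: \<sigma>_def N_def[symmetric] real_sqrt_divide powr_half_sqrt powr_minus divide_simps)
    have h: "h n = \<sigma> n powr (3 / 2) * A powr (- 1 / 2)"
    proof -
      have "h n = \<sigma> n powr 1 * (\<sigma> n powr (1 / 2) * A powr (- 1 / 2))"
        using s A by (simp add: h_def powr_half_sqrt powr_minus real_sqrt_divide divide_simps)
      then show ?thesis unfolding mult.assoc[symmetric] powr_add[symmetric] by simp
    qed
    have nS: "N * \<sigma> n = S"
    proof -
      have "N * \<sigma> n = sqrt (N\<^sup>2) * sqrt (A / N)" using N by (simp add: \<sigma>_def N_def)
      also have "\<dots> = S" unfolding real_sqrt_mult[symmetric] S_def using N by (simp add: power2_eq_square)
      finally show ?thesis .
    qed
    have AS: "real t * (pi\<^sup>2 / (6 * \<sigma> n)) = S"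
    proof -
      have "real t * (pi\<^sup>2 / (6 * \<sigma> n)) = A / \<sigma> n" by (simp add: A_def)
      also have "A = N * (\<sigma> n)\<^sup>2" using n_sigma[OF elim] s by (simp add: N_def)
      finally show ?thesis using nS s by (simp add: power2_eq_square)
    qed
    have "exp (real t * E (\<sigma> n)) = exp (real t * log_gf (\<sigma> n) - S + (- (real t / 2)) * ln (\<sigma> n) + (real t / 2) * ln (2 * pi))"
      unfolding AS[symmetric] E_def by (simp add: algebra_simps)
    also have "\<dots> = exp (real t * log_gf (\<sigma> n)) * exp (- S) * \<sigma> n powr (- (real t / 2)) * (2 * pi) powr (real t / 2)"
      unfolding exp_add using s by (simp add: exp_diff exp_minus powr_def divide_simps)
    finally have ex: "exp (real t * E (\<sigma> n)) = \<dots>" .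
    have Qn: "Q n = 2 * pi * real (tuple_count t n) * exp (- S) / (h n * exp (real t * log_gf (\<sigma> n)))"
      by (simp add: Q_def nS[symmetric] N_def)
    have "Q n * exp (real t * E (\<sigma> n)) = 2 * pi * real (tuple_count t n) * (exp (- S) * exp (- S)) *
       (\<sigma> n powr (- (real t / 2)) / h n) * (2 * pi) powr (real t / 2)"
      unfolding ex Qn by simp
    also have "exp (- S) * exp (- S) = exp (- 2 * S)" by (simp flip: exp_add)
    also have "\<sigma> n powr (- (real t / 2)) / h n = A powr (1 / 2) * \<sigma> n powr (- ((real t + 3) / 2))"
    proof -
      have "\<sigma> n powr (- (real t / 2)) / h n = A powr (1 / 2) * (\<sigma> n powr (- (real t / 2)) * \<sigma> n powr (- (3 / 2)))"
        unfolding h using s A by (simp add: powr_minus divide_simps)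
      also have "\<dots> = A powr (1 / 2) * \<sigma> n powr (- ((real t + 3) / 2))"
      proof -
        have "- (real t / 2) + - (3 / 2) = - ((real t + 3) / 2)" by (simp add: field_simps)
        then show ?thesis unfolding powr_add[symmetric] by (simp only:)
      qed
      finally show ?thesis .
    qed
    also have "\<sigma> n powr (- ((real t + 3) / 2)) = A powr (- ((real t + 3) / 4)) * N powr ((real t + 3) / 4)"
      unfolding sg using A N by (simp add: powr_mult powr_powr field_simps)
    also have "A powr (1 / 2) * (A powr (- ((real t + 3) / 4)) * N powr ((real t + 3) / 4)) =
      A powr (- ((real t + 1) / 4)) * N powr ((real t + 3) / 4)"
    proof -
      have "1 / 2 + - ((real t + 3) / 4) = - ((real t + 1) / 4)" by (simp add: field_simps)
      then show ?thesis unfolding mult.assoc[symmetric] powr_add[symmetric] by (simp only:)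
    qed
    finally show ?case
      using A by (simp add: c_def S_def N_def powr_minus divide_simps mult_ac)
  qed
  show ?thesis using Lim_transform_eventually[OF lim ev] unfolding val .
qed

end

theorem tuple_count_asymp:
  assumes "t > 0"
  defines "A \<equiv> real t * pi\<^sup>2 / 6"
  shows "(\<lambda>n. real (tuple_count t n) * exp (- 2 * sqrt (A * real n)) * real n powr ((real t + 3) / 4)) \<longlonglongrightarrow>
     A powr ((real t + 1) / 4) / (2 * sqrt pi * (2 * pi) powr (real t / 2))"
  unfolding A_def by (rule tuple_count_asymp_aux[OF assms(1)])

theorem hardy_ramanujan:
  "(\<lambda>n. real (npart n) * exp (- (pi * sqrt (2 * real n / 3))) * real n) \<longlonglongrightarrow> 1 / (4 * sqrt 3)"
proof -
  define A where "A = real 1 * pi\<^sup>2 / 6"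
  have sq: "2 * sqrt (A * real n) = pi * sqrt (2 * real n / 3)" for n
  proof -
    have "2 * sqrt (A * real n) = sqrt (4 * (A * real n))" by (simp add: real_sqrt_mult)
    also have "4 * (A * real n) = pi\<^sup>2 * (2 * real n / 3)" by (simp add: A_def)
    also have "sqrt \<dots> = pi * sqrt (2 * real n / 3)" by (simp only: real_sqrt_mult real_sqrt_abs) simp
    finally show ?thesis .
  qed
  have val: "A powr ((real 1 + 1) / 4) / (2 * sqrt pi * (2 * pi) powr (real 1 / 2)) = 1 / (4 * sqrt 3)"
  proof -
    have "A powr ((real 1 + 1) / 4) = pi / sqrt 6" by (simp add: A_def powr_half_sqrt real_sqrt_divide)
    moreover have "2 * sqrt pi * (2 * pi) powr (real 1 / 2) = 2 * sqrt 2 * pi"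
      by (simp add: powr_half_sqrt real_sqrt_mult)
    moreover have "sqrt 6 * sqrt 2 = 2 * sqrt (3 :: real)"
    proof -
      have "sqrt 6 * sqrt 2 = sqrt (4 * 3 :: real)" unfolding real_sqrt_mult[symmetric] by simp
      also have "\<dots> = 2 * sqrt 3" unfolding real_sqrt_mult by simp
      finally show ?thesis .
    qed
    ultimately have "A powr ((real 1 + 1) / 4) / (2 * sqrt pi * (2 * pi) powr (real 1 / 2)) = (pi / sqrt 6) / (2 * sqrt 2 * pi)"
      by (simp only:)
    also have "\<dots> = 1 / (2 * (sqrt 6 * sqrt 2))" by simp
    also have "\<dots> = 1 / (4 * sqrt 3)" unfolding \<open>sqrt 6 * sqrt 2 = 2 * sqrt (3 :: real)\<close> by simp
    finally show ?thesis .
  qed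
  have "(\<lambda>n. real (npart n) * exp (- 2 * sqrt (A * real n)) * real n powr ((real 1 + 3) / 4)) \<longlonglongrightarrow> 1 / (4 * sqrt 3)"
    using tuple_count_asymp[of 1] unfolding tuple_count_1 A_def[symmetric] val by simp
  then show ?thesis
  proof (rule Lim_transform_eventually)
    show "\<forall>\<^sub>F n in sequentially. real (npart n) * exp (- 2 * sqrt (A * real n)) * real n powr ((real 1 + 3) / 4)
       = real (npart n) * exp (- (pi * sqrt (2 * real n / 3))) * real n"
      using eventually_gt_at_top[of 0]
    proof eventually_elim
      case (elim n)
      have "real n powr ((real 1 + 3) / 4) = real n" using elim by simp
      moreover have "- 2 * sqrt (A * real n) = - (pi * sqrt (2 * real n / 3))" using sq[of n] by simp
      ultimately show ?case by (simp only:)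
    qed
  qed
qed

subsection \<open>Equidistribution of the charge vectors\<close>

lemma npart_mono: "npart n \<le> npart (Suc n)"
proof -
  have "inj_on (\<lambda>xs. xs @ [1]) {xs. partition_of n xs}" by (rule inj_onI) simp
  moreover have "(\<lambda>xs. xs @ [1]) ` {xs. partition_of n xs} \<subseteq> {xs. partition_of (Suc n) xs}"
    by (auto simp: partition_of_def sorted_wrt_append Suc_le_eq intro!: gr0I)
  ultimately show ?thesis unfolding npart_def by (metis card_inj_on_le finite_partitions)
qed

lemma tuple_count_mono_Suc: "tuple_count (Suc t) w \<le> tuple_count (Suc t) (Suc w)"
proof -
  have e: "tuple_count (Suc t) w = (\<Sum>v\<le>w. npart (w - v) * tuple_count t v)" for w
    unfolding tuple_count_Suc by (rule sum.reindex_bij_witness[of _ "\<lambda>v. w - v" "\<lambda>v. w - v"]) auto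
  have "(\<Sum>v\<le>w. npart (w - v) * tuple_count t v) \<le> (\<Sum>v\<le>w. npart (Suc w - v) * tuple_count t v)"
    by (intro sum_mono mult_right_mono) (auto simp: Suc_diff_le npart_mono)
  also have "\<dots> \<le> (\<Sum>v\<le>Suc w. npart (Suc w - v) * tuple_count t v)"
    by (rule sum_mono2) auto
  finally show ?thesis unfolding e .
qed

lemma tuple_count_mono: "t > 0 \<Longrightarrow> v \<le> w \<Longrightarrow> tuple_count t v \<le> tuple_count t w"
proof -
  assume t: "t > 0" and vw: "v \<le> w"
  obtain s where s: "t = Suc s" using t by (cases t) auto
  show ?thesis unfolding s by (rule lift_Suc_mono_le[where f = "tuple_count (Suc s)", OF tuple_count_mono_Suc vw])
qed

lemma tuple_count_upper:
  assumes "t > 0"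
  obtains K where "K > 0" "\<And>w. real (tuple_count t w) \<le> K * exp (2 * sqrt (real t * pi\<^sup>2 / 6 * real w))"
proof -
  define A where "A = real t * pi\<^sup>2 / 6"
  define \<beta> where "\<beta> = (real t + 3) / 4"
  define T where "T = (\<lambda>n. real (tuple_count t n) * exp (- 2 * sqrt (A * real n)) * real n powr \<beta>)"
  have "convergent T" using tuple_count_asymp[OF assms] unfolding T_def A_def \<beta>_def convergent_def by blast
  then have "Bseq T" by (rule convergent_imp_Bseq)
  then obtain K where "\<forall>n. norm (T n) \<le> K" by (rule BseqE)
  then have K: "norm (T n) \<le> K" for n by blast
  \<comment> \<open>At w = 0 the factor \<open>real w powr \<beta>\<close> is 0 and T carries no
    information, hence the summand \<open>tuple_count t 0\<close>.\<close>
  show thesis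
  proof (rule that[of "K + real (tuple_count t 0) + 1"])
    have "0 \<le> K" using K[of 0] norm_ge_zero order_trans by blast
    then show "0 < K + real (tuple_count t 0) + 1" by simp
    fix w
    show "real (tuple_count t w) \<le> (K + real (tuple_count t 0) + 1) * exp (2 * sqrt (real t * pi\<^sup>2 / 6 * real w))"
    proof (cases "w = 0")
      case True
      then show ?thesis using \<open>0 \<le> K\<close> by simp
    next
      case False
      then have "real w powr 0 \<le> real w powr \<beta>" by (intro powr_mono) (auto simp: \<beta>_def)
      then have "1 \<le> real w powr \<beta>" using False by simp
      then have "real (tuple_count t w) * exp (- 2 * sqrt (A * real w)) * 1 \<le> T w"
        unfolding T_def by (intro mult_left_mono) auto
      also have "\<dots> \<le> K" using K[of w] by auto
      also have "\<dots> \<le> K + real (tuple_count t 0) + 1" by simp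
      finally have "real (tuple_count t w) / exp (2 * sqrt (A * real w)) \<le> K + real (tuple_count t 0) + 1"
        by (simp add: exp_minus divide_inverse)
      then show ?thesis by (simp add: divide_le_eq A_def)
    qed
  qed
qed

text \<open>Lowering w by j <= delta sqrt(w) lowers sqrt(w) by at most delta, so the exponent 2
  sqrt(A w) by at most 2 delta sqrt(A) = epsilon/2, while the power of w only grows. A bound for
  decreasing w suffices, as increasing w is covered by monotonicity.\<close>

lemma tuple_count_slowly_varying:
  assumes t: "t > 0" and \<epsilon>: "0 < \<epsilon>" "\<epsilon> < 1"
  obtains \<delta> W where "\<delta> > 0" "\<And>w j. w \<ge> W \<Longrightarrow> real j \<le> \<delta> * sqrt (real w) \<Longrightarrow>
     j \<le> w \<and> (1 - \<epsilon>) * real (tuple_count t w) \<le> real (tuple_count t (w - j))"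
proof -
  define A where "A = real t * pi\<^sup>2 / 6"
  define \<beta> where "\<beta> = (real t + 3) / 4"
  define T where "T = (\<lambda>n. real (tuple_count t n) * exp (- 2 * sqrt (A * real n)) * real n powr \<beta>)"
  define L where "L = A powr ((real t + 1) / 4) / (2 * sqrt pi * (2 * pi) powr (real t / 2))"
  have A: "A > 0" using t by (simp add: A_def)
  have L: "L > 0" using A by (simp add: L_def)
  have lim: "T \<longlonglongrightarrow> L" using tuple_count_asymp[OF t] unfolding T_def A_def \<beta>_def L_def .
  define \<eta> where "\<eta> = \<epsilon> / 4"
  have \<eta>: "0 < \<eta>" "\<eta> < 1 / 4" using \<epsilon> by (auto simp: \<eta>_def)
  have "\<forall>\<^sub>F n in sequentially. L * (1 - \<eta>) < T n \<and> T n < L * (1 + \<eta>)"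
    using order_tendstoD[OF lim] L \<eta> by (intro eventually_conj) auto
  then obtain N where N: "\<And>n. n \<ge> N \<Longrightarrow> L * (1 - \<eta>) < T n \<and> T n < L * (1 + \<eta>)"
    by (auto simp: eventually_sequentially)
  define \<delta> where "\<delta> = \<epsilon> / (4 * sqrt A)"
  have \<delta>: "\<delta> > 0" using \<epsilon> A by (simp add: \<delta>_def)
  \<comment> \<open>Ensures 2 delta <= sqrt(w), so that j <= w/2 and w - j still exceeds the
    threshold N.\<close>
  obtain M :: nat where M: "4 * \<delta>\<^sup>2 \<le> real M" using real_arch_simple by blast
  show thesis
  proof (rule that[OF \<delta>])
    fix w j assume w: "w \<ge> M + 2 * N + 2" and j: "real j \<le> \<delta> * sqrt (real w)"
    have w0: "real w > 0" using w by simp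
    have "sqrt (4 * \<delta>\<^sup>2) \<le> sqrt (real w)" using M w by (intro real_sqrt_le_mono) linarith
    then have d2: "2 * \<delta> \<le> sqrt (real w)" using \<delta> by (simp add: real_sqrt_mult)
    have "2 * real j \<le> (2 * \<delta>) * sqrt (real w)" using j by simp
    also have "\<dots> \<le> sqrt (real w) * sqrt (real w)" using d2 by (intro mult_right_mono) auto
    finally have jw: "2 * real j \<le> real w" by simp
    define v where "v = w - j"
    have v: "real v = real w - real j" "v \<ge> N" "v > 0" "j \<le> w" using jw w by (auto simp: v_def)
    have v0: "real v > 0" using v by simp
    have "sqrt (real w) - sqrt (real v) \<le> \<delta>"
    proof -
      have "(sqrt (real w) - sqrt (real v)) * sqrt (real w) \<le> (sqrt (real w) - sqrt (real v)) * (sqrt (real w) + sqrt (real v))"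
        using v by (intro mult_left_mono) auto
      also have "\<dots> = real j" using v by (simp add: algebra_simps)
      also have "\<dots> \<le> \<delta> * sqrt (real w)" by (rule j)
      finally show ?thesis using w0 by simp
    qed
    then have "sqrt A * (sqrt (real w) - sqrt (real v)) \<le> sqrt A * \<delta>" using A by (intro mult_left_mono) auto
    also have "sqrt A * \<delta> = \<epsilon> / 4" using A by (simp add: \<delta>_def)
    finally have "1 - \<epsilon> / 2 \<le> 1 + - 2 * (sqrt A * (sqrt (real w) - sqrt (real v)))" by simp
    also have "\<dots> \<le> exp (- 2 * (sqrt A * (sqrt (real w) - sqrt (real v))))" by (rule exp_ge_add_one_self)
    also have "- 2 * (sqrt A * (sqrt (real w) - sqrt (real v))) = 2 * sqrt (A * real v) - 2 * sqrt (A * real w)"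
      by (simp add: real_sqrt_mult algebra_simps)
    finally have ex: "1 - \<epsilon> / 2 \<le> exp (2 * sqrt (A * real v) - 2 * sqrt (A * real w))" .
    have tv: "real (tuple_count t m) = T m * exp (2 * sqrt (A * real m)) * real m powr (- \<beta>)" if "m > 0" for m
      using that by (simp add: T_def exp_minus powr_minus field_simps)
    have TT: "(1 - \<epsilon> / 2) * T w \<le> T v"
    proof -
      have "(1 - \<epsilon> / 2) * T w \<le> (1 - 2 * \<eta>) * (L * (1 + \<eta>))"
        using N[of w] w \<epsilon> by (intro mult_mono) (auto simp: \<eta>_def T_def)
      also have "\<dots> = L * ((1 - \<eta>) - 2 * \<eta>\<^sup>2)" by (simp add: algebra_simps power2_eq_square)
      also have "\<dots> \<le> L * (1 - \<eta>)" using L by (intro mult_left_mono) auto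
      finally show ?thesis using N[OF v(2)] by linarith
    qed
    have "(1 - \<epsilon>) * real (tuple_count t w) \<le> ((1 - \<epsilon> / 2) * (1 - \<epsilon> / 2)) * real (tuple_count t w)"
      by (intro mult_right_mono) (auto simp: algebra_simps)
    also have "\<dots> = ((1 - \<epsilon> / 2) * T w) * ((1 - \<epsilon> / 2) * exp (2 * sqrt (A * real w))) * real w powr (- \<beta>)"
      using tv[of w] w by simp
    also have "\<dots> \<le> T v * exp (2 * sqrt (A * real v)) * real v powr (- \<beta>)"
    proof (intro mult_mono)
      show "(1 - \<epsilon> / 2) * exp (2 * sqrt (A * real w)) \<le> exp (2 * sqrt (A * real v))"
        using mult_right_mono[OF ex, of "exp (2 * sqrt (A * real w))"] by (simp flip: exp_add)
      show "real w powr (- \<beta>) \<le> real v powr (- \<beta>)"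
        using v v0 by (intro powr_mono2') (auto simp: \<beta>_def)
    qed (use TT \<epsilon> in \<open>auto simp: T_def\<close>)
    also have "\<dots> = real (tuple_count t v)" using tv[of v] v by simp
    finally show "j \<le> w \<and> (1 - \<epsilon>) * real (tuple_count t w) \<le> real (tuple_count t (w - j))"
      using v by (simp add: v_def)
  qed
qed

lemma abs_times_pred_nonneg: "0 \<le> \<bar>x\<bar> * (\<bar>x\<bar> - 1)" for x :: int
proof (cases "x = 0")
  case False
  then have "1 \<le> \<bar>x\<bar>" by linarith
  then show ?thesis by (intro mult_nonneg_nonneg) auto
qed simp

text \<open>For x < 0 the term is t |x| (|x| + 1) - 2 r |x|, and r < t leaves at least t |x| (|x| -
  1): the linear part cannot defeat the square.\<close>

lemma core_size_term_nonneg: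
  fixes x t r :: int
  assumes "0 \<le> r" "r < t"
  shows "t * (\<bar>x\<bar> * (\<bar>x\<bar> - 1)) \<le> t * (x * (x - 1)) + 2 * r * x" and "0 \<le> t * (x * (x - 1)) + 2 * r * x"
proof -
  show *: "t * (\<bar>x\<bar> * (\<bar>x\<bar> - 1)) \<le> t * (x * (x - 1)) + 2 * r * x"
  proof (cases "x \<ge> 0")
    case True
    then have "0 \<le> 2 * r * x" using assms by (intro mult_nonneg_nonneg) auto
    moreover have "\<bar>x\<bar> = x" using True by simp
    ultimately show ?thesis by simp
  next
    case False
    have "r * (- x) \<le> t * (- x)" using False assms by (intro mult_right_mono) auto
    moreover have "t * (x * (x - 1)) + 2 * r * x - t * (- x * (- x - 1)) = 2 * (t * (- x) - r * (- x))"
      by (simp add: algebra_simps)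
    moreover have "\<bar>x\<bar> = - x" using False by simp
    ultimately show ?thesis by simp
  qed
  have "0 \<le> \<bar>x\<bar> * (\<bar>x\<bar> - 1)" by (rule abs_times_pred_nonneg)
  then have "0 \<le> t * (\<bar>x\<bar> * (\<bar>x\<bar> - 1))" by (rule mult_nonneg_nonneg[rotated]) (use assms in simp)
  then show "0 \<le> t * (x * (x - 1)) + 2 * r * x" using * by linarith
qed

lemma core_size_nonneg: "0 \<le> core_size t c"
proof -
  have "0 \<le> 2 * core_size t c" unfolding two_core_size
    by (rule sum_nonneg) (use core_size_term_nonneg(2) in auto)
  then show ?thesis by simp
qed

lemma core_size_ge:
  assumes "r < t"
  shows "int t * (\<bar>c r\<bar> * (\<bar>c r\<bar> - 1)) \<le> 2 * core_size t c"
proof -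
  have "int t * (\<bar>c r\<bar> * (\<bar>c r\<bar> - 1)) \<le> int t * (c r * (c r - 1)) + 2 * int r * c r"
    by (rule core_size_term_nonneg(1)) (use assms in auto)
  also have "\<dots> \<le> (\<Sum>r<t. int t * (c r * (c r - 1)) + 2 * int r * c r)"
    by (rule member_le_sum) (use assms core_size_term_nonneg(2) in auto)
  finally show ?thesis by (simp add: two_core_size)
qed

text \<open>All summands of twice the core size are nonnegative, so each coordinate is controlled on
  its own. The linear bound serves to count cores, the square root bound to control
  translations.\<close>

lemma abs_le_core_size:
  assumes "r < t"
  shows "\<bar>c r\<bar> \<le> 2 * core_size t c + 1" "real_of_int \<bar>c r\<bar> \<le> 1 + sqrt (2 * real_of_int (core_size t c))"
proof -
  define x where "x = \<bar>c r\<bar>"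
  have p: "0 \<le> x * (x - 1)" unfolding x_def by (rule abs_times_pred_nonneg)
  have "1 * (x * (x - 1)) \<le> int t * (x * (x - 1))" using p assms by (intro mult_right_mono) auto
  then have b: "x * (x - 1) \<le> 2 * core_size t c" using core_size_ge[OF assms, of c] by (simp add: x_def)
  show "\<bar>c r\<bar> \<le> 2 * core_size t c + 1"
  proof (cases "x = 0")
    case False
    then have "1 * (x - 1) \<le> x * (x - 1)" by (intro mult_right_mono) (auto simp: x_def)
    then show ?thesis using b by (simp add: x_def)
  qed (use core_size_nonneg[of t c] in \<open>simp add: x_def\<close>)
  show "real_of_int \<bar>c r\<bar> \<le> 1 + sqrt (2 * real_of_int (core_size t c))"
  proof (cases "x = 0")
    case False
    then have "(x - 1) * (x - 1) \<le> x * (x - 1)" by (intro mult_right_mono) (auto simp: x_def)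
    then have "(x - 1)\<^sup>2 \<le> 2 * core_size t c" using b by (simp add: power2_eq_square)
    then have "real_of_int ((x - 1)\<^sup>2) \<le> real_of_int (2 * core_size t c)" by (simp only: of_int_le_iff)
    then have "(real_of_int (x - 1))\<^sup>2 \<le> 2 * real_of_int (core_size t c)" by simp
    then have "real_of_int (x - 1) \<le> sqrt (2 * real_of_int (core_size t c))" by (rule real_le_rsqrt)
    then show ?thesis by (simp add: x_def)
  qed (use core_size_nonneg[of t c] in \<open>simp add: x_def\<close>)
qed

definition small_cores :: "nat \<Rightarrow> nat \<Rightarrow> (nat \<Rightarrow> int) set" where
  "small_cores t n = {c \<in> charge_vectors t. core_size t c \<le> int n}"

lemma small_cores_subset: "small_cores t n \<subseteq> {..<t} \<rightarrow>\<^sub>E {- (2 * int n + 1)..2 * int n + 1}"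
proof
  fix c assume c: "c \<in> small_cores t n"
  have "\<bar>c r\<bar> \<le> 2 * int n + 1" if "r < t" for r
    using abs_le_core_size(1)[OF that, of c] c by (simp add: small_cores_def)
  then show "c \<in> {..<t} \<rightarrow>\<^sub>E {- (2 * int n + 1)..2 * int n + 1}"
    using c by (force simp: small_cores_def charge_vectors_def PiE_def Pi_def abs_le_iff)
qed

lemma finite_small_cores: "finite (small_cores t n)"
  by (rule finite_subset[OF small_cores_subset]) (auto intro: finite_PiE)

lemma card_small_cores: "card (small_cores t n) \<le> (4 * n + 3) ^ t"
proof -
  have "card (small_cores t n) \<le> card ({..<t} \<rightarrow>\<^sub>E {- (2 * int n + 1)..2 * int n + 1})"
    by (rule card_mono[OF _ small_cores_subset]) (auto intro: finite_PiE)
  also have "\<dots> = (4 * n + 3) ^ t" by (simp add: card_PiE nat_add_distrib nat_mult_distrib add.commute)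
  finally show ?thesis .
qed

text \<open>The number of partitions of \<open>n\<close> whose \<open>t\<close>-core has charge vector \<open>c\<close>.\<close>

definition core_weight :: "nat \<Rightarrow> nat \<Rightarrow> (nat \<Rightarrow> int) \<Rightarrow> nat" where
  "core_weight t n c = (if int t dvd int n - core_size t c \<and> core_size t c \<le> int n
     then tuple_count t (nat ((int n - core_size t c) div int t)) else 0)"

definition core_sum :: "nat \<Rightarrow> nat \<Rightarrow> (nat \<Rightarrow> int) set \<Rightarrow> nat" where
  "core_sum t n X = (\<Sum>c\<in>small_cores t n \<inter> X. core_weight t n c)"

lemma core_sum_mono: "X \<inter> {c. core_weight t n c \<noteq> 0} \<subseteq> Y \<Longrightarrow> core_sum t n X \<le> core_sum t n Y"
  unfolding core_sum_def
  using finite_small_cores[of t n]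
  by (subst sum.mono_neutral_cong_left[of "small_cores t n \<inter> X" "small_cores t n \<inter> X \<inter> {c. core_weight t n c \<noteq> 0}", symmetric])
     (auto intro!: sum_mono2)

text \<open>The sums over w and over charge vectors are exchanged: a charge vector leaves the single
  value w = (n - core size) / t, if that is an integer.\<close>

lemma card_hook_pred_core_sum:
  assumes t: "t > 0"
  shows "card {xs. partition_of n xs \<and> P (size (t_hooks (int t) xs))} =
     core_sum t n {c. P (nat ((int n - core_size t c) div int t))}"
proof -
  have cc: "core_count t (int n - int (t * w)) = (\<Sum>c\<in>small_cores t n. if core_size t c = int n - int (t * w) then 1 else 0)" for w
  proof -
    have "{c \<in> charge_vectors t. core_size t c = int n - int (t * w)} = {c \<in> small_cores t n. core_size t c = int n - int (t * w)}"
      by (auto simp: small_cores_def)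
    then show ?thesis using finite_small_cores[of t n] by (simp add: core_count_def flip: sum.inter_filter)
  qed
  have "card {xs. partition_of n xs \<and> P (size (t_hooks (int t) xs))} =
      (\<Sum>w | w \<le> n \<and> P w. \<Sum>c\<in>small_cores t n. if core_size t c = int n - int (t * w) then tuple_count t w else 0)"
    unfolding card_partitions_hook_pred[OF t] cc sum_distrib_right by (intro sum.cong refl) auto
  also have "\<dots> = (\<Sum>c\<in>small_cores t n. \<Sum>w | w \<le> n \<and> P w. if core_size t c = int n - int (t * w) then tuple_count t w else 0)"
    by (rule sum.swap)
  also have "\<dots> = (\<Sum>c\<in>small_cores t n. if P (nat ((int n - core_size t c) div int t)) then core_weight t n c else 0)"
  proof (rule sum.cong[OF refl])
    fix c assume c: "c \<in> small_cores t n"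
    define w0 where "w0 = nat ((int n - core_size t c) div int t)"
    have q: "core_size t c \<le> int n" using c by (simp add: small_cores_def)
    have eq: "core_size t c = int n - int (t * w) \<longleftrightarrow> int t dvd int n - core_size t c \<and> w = w0" for w
    proof
      assume e: "core_size t c = int n - int (t * w)"
      then have "int n - core_size t c = int t * int w" by simp
      then show "int t dvd int n - core_size t c \<and> w = w0" using t by (simp add: w0_def)
    next
      assume e: "int t dvd int n - core_size t c \<and> w = w0"
      then obtain k where k: "int n - core_size t c = int t * k" by blast
      then have "k \<ge> 0" using q t by (metis diff_ge_0_iff_ge of_nat_0_less_iff zero_le_mult_iff not_less)
      moreover have "w = nat k" using e k t by (simp add: w0_def)
      ultimately show "core_size t c = int n - int (t * w)" using k by simp
    qed
    have w0n: "w0 \<le> n"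
    proof -
      have "(int n - core_size t c) div int t \<le> int n"
      proof -
        define x where "x = int n - core_size t c"
        have x: "0 \<le> x" "x \<le> int n" using q core_size_nonneg[of t c] by (auto simp: x_def)
        have "x div int t * 1 \<le> x div int t * int t"
          using x t by (intro mult_left_mono) (auto simp: pos_imp_zdiv_nonneg_iff)
        also have "\<dots> \<le> x" using div_mult_mod_eq[of x "int t"] t pos_mod_sign[of "int t" x] by linarith
        finally show ?thesis using x by (simp add: x_def)
      qed
      then show ?thesis by (simp add: w0_def)
    qed
    have "(\<Sum>w | w \<le> n \<and> P w. if core_size t c = int n - int (t * w) then tuple_count t w else 0) =
      (\<Sum>w | w \<le> n \<and> P w. if w = w0 then (if int t dvd int n - core_size t c then tuple_count t w0 else 0) else 0)"
      unfolding eq by (intro sum.cong) auto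
    also have "\<dots> = (if P w0 then core_weight t n c else 0)"
      using w0n q by (subst sum.delta) (auto simp: core_weight_def w0_def)
    finally show "(\<Sum>w | w \<le> n \<and> P w. if core_size t c = int n - int (t * w) then tuple_count t w else 0) =
      (if P (nat ((int n - core_size t c) div int t)) then core_weight t n c else 0)" by (simp add: w0_def)
  qed
  also have "\<dots> = core_sum t n {c. P (nat ((int n - core_size t c) div int t))}"
    unfolding core_sum_def using finite_small_cores[of t n]
    by (subst sum.inter_filter[symmetric]) (auto intro!: sum.cong)
  finally show ?thesis .
qed

lemma npart_core_sum: "t > 0 \<Longrightarrow> npart n = core_sum t n UNIV"
  using card_hook_pred_core_sum[of t n "\<lambda>_. True"] by (simp add: npart_def)

lemma npart_pos: "npart n > 0"
proof (induction n)
  case 0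
  have "{xs. partition_of 0 xs} = {[]}" by (auto simp: partition_of_def) (metis list.set_intros(1) neq_Nil_conv)
  then show ?case by (simp add: npart_def)
next
  case (Suc n) then show ?case using npart_mono[of n] by linarith
qed

section \<open>Translation of charge vectors by multiples of t\<close>

definition shift_core :: "nat \<Rightarrow> (nat \<Rightarrow> int) \<Rightarrow> (nat \<Rightarrow> int) \<Rightarrow> (nat \<Rightarrow> int)" where
  "shift_core t v c = (\<lambda>r\<in>{..<t}. c r + int t * v r)"

text \<open>The increase of the core size under translation by t v, divided by t; hence the decrease
  of w. It is affine in c, so of the order of the square root of the core size.\<close>

definition shift_size :: "nat \<Rightarrow> (nat \<Rightarrow> int) \<Rightarrow> (nat \<Rightarrow> int) \<Rightarrow> int" where
  "shift_size t v c = (\<Sum>r<t. c r * (int t * v r) + (int t * v r) * (int t * v r - 1) div 2 + int r * v r)"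

lemma shift_core_charge_vectors:
  assumes "c \<in> charge_vectors t" "sum v {..<t} = 0"
  shows "shift_core t v c \<in> charge_vectors t"
  using assms by (simp add: charge_vectors_def shift_core_def sum.distrib flip: sum_distrib_left)

lemma inj_on_shift_core: "inj_on (shift_core t v) (charge_vectors t)"
proof (rule inj_onI)
  fix c d assume cd: "c \<in> charge_vectors t" "d \<in> charge_vectors t" "shift_core t v c = shift_core t v d"
  show "c = d"
  proof (rule PiE_ext[of _ "{..<t}" "\<lambda>_. UNIV"])
    fix r assume "r \<in> {..<t}"
    then show "c r = d r" using fun_cong[OF cd(3), of r] by (simp add: shift_core_def)
  qed (use cd in \<open>auto simp: charge_vectors_def\<close>)
qed

lemma core_size_shift: "core_size t (shift_core t v c) = core_size t c + int t * shift_size t v c"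
proof -
  have e: "2 * (x * (x - 1) div 2) = x * (x - 1)" for x :: int by simp
  have "2 * core_size t (shift_core t v c) = 2 * core_size t c + int t * (2 * shift_size t v c)"
    unfolding two_core_size shift_size_def sum_distrib_left sum.distrib[symmetric]
  proof (rule sum.cong[OF refl])
    fix r assume "r \<in> {..<t}"
    define u where "u = int t * v r"
    have "int t * (2 * (c r * u + u * (u - 1) div 2 + int r * v r)) = int t * (2 * c r * u + u * (u - 1)) + 2 * int r * u"
      unfolding distrib_left e[of u] by (simp add: u_def algebra_simps)
    then show "int t * (shift_core t v c r * (shift_core t v c r - 1)) + 2 * int r * shift_core t v c r =
        int t * (c r * (c r - 1)) + 2 * int r * c r + int t * (2 * (c r * (int t * v r) + int t * v r * (int t * v r - 1) div 2 + int r * v r))"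
      using \<open>r \<in> {..<t}\<close> by (simp add: shift_core_def u_def[symmetric] algebra_simps)
  qed
  then show ?thesis by simp
qed

lemma shift_size_bound:
  obtains L :: real where "L > 0" "\<And>c. \<bar>real_of_int (shift_size t v c)\<bar> \<le> L * (1 + sqrt (real_of_int (core_size t c)))"
proof -
  define M where "M = (\<Sum>r<t. \<bar>real_of_int (int t * v r)\<bar>)"
  define N where "N = (\<Sum>r<t. \<bar>real_of_int ((int t * v r) * (int t * v r - 1) div 2 + int r * v r)\<bar>)"
  have MN: "M \<ge> 0" "N \<ge> 0" by (auto simp: M_def N_def sum_nonneg)
  show thesis
  proof (rule that[of "2 * M + N + 1"])
    fix c
    define q where "q = sqrt (real_of_int (core_size t c))"
    have q: "q \<ge> 0" using core_size_nonneg[of t c] by (simp add: q_def)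
    have "sqrt (2 * real_of_int (core_size t c)) = sqrt 2 * q" by (simp add: real_sqrt_mult q_def)
    also have "\<dots> \<le> 2 * q" using q sqrt2_less_2 by (intro mult_right_mono) auto
    finally have s2: "sqrt (2 * real_of_int (core_size t c)) \<le> 2 * q" .
    have "\<bar>real_of_int (shift_size t v c)\<bar> \<le> (\<Sum>r<t. \<bar>real_of_int (c r * (int t * v r) + (int t * v r) * (int t * v r - 1) div 2 + int r * v r)\<bar>)"
      unfolding shift_size_def of_int_sum by (rule sum_abs)
    also have "\<dots> \<le> (\<Sum>r<t. (1 + 2 * q) * \<bar>real_of_int (int t * v r)\<bar> + \<bar>real_of_int ((int t * v r) * (int t * v r - 1) div 2 + int r * v r)\<bar>)"
    proof (rule sum_mono)
      fix r assume "r \<in> {..<t}"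
      then have "\<bar>real_of_int (c r)\<bar> \<le> 1 + 2 * q" using abs_le_core_size(2)[of r t c] s2 by simp
      then have "\<bar>real_of_int (c r)\<bar> * \<bar>real_of_int (int t * v r)\<bar> \<le> (1 + 2 * q) * \<bar>real_of_int (int t * v r)\<bar>"
        by (intro mult_right_mono) auto
      moreover have "\<bar>real_of_int (c r * (int t * v r) + ((int t * v r) * (int t * v r - 1) div 2 + int r * v r))\<bar> \<le>
        \<bar>real_of_int (c r)\<bar> * \<bar>real_of_int (int t * v r)\<bar> + \<bar>real_of_int ((int t * v r) * (int t * v r - 1) div 2 + int r * v r)\<bar>"
        unfolding of_int_add[of "c r * (int t * v r)"] of_int_mult[of "c r"] abs_mult[symmetric] by (rule abs_triangle_ineq)
      ultimately show "\<bar>real_of_int (c r * (int t * v r) + (int t * v r) * (int t * v r - 1) div 2 + int r * v r)\<bar>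
         \<le> (1 + 2 * q) * \<bar>real_of_int (int t * v r)\<bar> + \<bar>real_of_int ((int t * v r) * (int t * v r - 1) div 2 + int r * v r)\<bar>"
        unfolding add.assoc by linarith
    qed
    also have "\<dots> = (1 + 2 * q) * M + N" by (simp only: sum.distrib M_def N_def sum_distrib_left)
    also have "\<dots> \<le> (2 * M + N + 1) * (1 + q)"
      using MN q mult_nonneg_nonneg[of N q] by (simp add: algebra_simps)
    finally show "\<bar>real_of_int (shift_size t v c)\<bar> \<le> (2 * M + N + 1) * (1 + sqrt (real_of_int (core_size t c)))"
      by (simp add: q_def)
  qed (use MN in simp)
qed

lemma exp_poly_decay:
  fixes a k :: real assumes "k > 0"
  shows "(\<lambda>n. exp (a * ln (4 * real n + 3) - k * sqrt (real n)) * real n) \<longlonglongrightarrow> 0"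
  using assms by real_asymp

text \<open>With w at most (1 - eta) n/t the factor t cancels in the exponent, which becomes sqrt(1
  - eta) times the exponent of p(n). The gap k sqrt(n) absorbs the polynomial number of charge
  vectors.\<close>

lemma tail_small:
  assumes t: "t > 0" and \<eta>: "0 < \<eta>" "\<eta> < 1" and K: "K > 0" and \<epsilon>: "\<epsilon> > 0"
  shows "\<forall>\<^sub>F n in sequentially. real ((4 * n + 3) ^ t) * (K * exp (2 * sqrt (real t * pi\<^sup>2 / 6 * ((1 - \<eta>) * real n / real t)))) \<le> \<epsilon> * real (npart n)"
proof -
  define \<kappa> where "\<kappa> = pi * sqrt (2 / 3)"
  define k where "k = (1 - sqrt (1 - \<eta>)) * \<kappa>"
  have \<kappa>: "\<kappa> > 0" by (simp add: \<kappa>_def)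
  have k: "k > 0" using \<eta> \<kappa> by (simp add: k_def)
  have "pi * sqrt (2 * real n / 3) = \<kappa> * sqrt (real n)" for n
    by (simp add: \<kappa>_def real_sqrt_mult real_sqrt_divide)
  then have "(\<lambda>n. real (npart n) * exp (- (\<kappa> * sqrt (real n))) * real n) \<longlonglongrightarrow> 1 / (4 * sqrt 3)"
    using hardy_ramanujan by simp
  \<comment> \<open>A convenient positive number below the limit.\<close>
  moreover have "1 / 16 < 1 / (4 * sqrt (3 :: real))"
  proof -
    have "sqrt 3 < sqrt (16 :: real)" by (rule real_sqrt_less_mono) simp
    then have "sqrt 3 < (4 :: real)" by simp
    then show ?thesis by (simp add: field_simps)
  qed
  ultimately have ev1: "\<forall>\<^sub>F n in sequentially. 1 / 16 < real (npart n) * exp (- (\<kappa> * sqrt (real n))) * real n"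
    by (rule order_tendstoD)
  have "\<forall>\<^sub>F n in sequentially. exp (real t * ln (4 * real n + 3) - k * sqrt (real n)) * real n < \<epsilon> / (16 * K)"
    using exp_poly_decay[OF k] by (rule order_tendstoD) (use K \<epsilon> in simp)
  then show ?thesis using ev1 eventually_gt_at_top[of 0]
  proof eventually_elim
    case (elim n)
    define s where "s = sqrt (real n)"
    have "2 * sqrt (real t * pi\<^sup>2 / 6 * ((1 - \<eta>) * real n / real t)) = sqrt (1 - \<eta>) * \<kappa> * s"
    proof -
      have "real t * pi\<^sup>2 / 6 * ((1 - \<eta>) * real n / real t) = (1 - \<eta>) * (\<kappa> / 2)\<^sup>2 * real n"
        using t by (simp add: \<kappa>_def power_mult_distrib power_divide)
      also have "sqrt \<dots> = sqrt (1 - \<eta>) * (\<kappa> / 2) * s"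
        unfolding real_sqrt_mult s_def using \<kappa> by simp
      finally show ?thesis by simp
    qed
    then have e1: "exp (2 * sqrt (real t * pi\<^sup>2 / 6 * ((1 - \<eta>) * real n / real t))) = exp (\<kappa> * s) * exp (- (k * s))"
      by (simp add: k_def algebra_simps flip: exp_add)
    have e2: "real ((4 * n + 3) ^ t) = exp (real t * ln (4 * real n + 3))"
    proof -
      have "exp (real t * ln (4 * real n + 3)) = exp (ln (4 * real n + 3)) ^ t" by (rule exp_of_nat_mult)
      then show ?thesis by simp
    qed
    have "exp (real t * ln (4 * real n + 3)) * exp (- (k * s)) * real n < \<epsilon> / (16 * K)"
      using elim(1) unfolding exp_add[symmetric] s_def by (simp only: diff_conv_add_uminus)
    then have b: "exp (real t * ln (4 * real n + 3)) * exp (- (k * s)) * real n * K \<le> \<epsilon> / 16" using K by (simp add: field_simps)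
    have "exp (\<kappa> * s) / 16 \<le> real (npart n) * real n"
      using elim(2) by (simp add: s_def exp_minus field_simps)
    then have "\<epsilon> * exp (\<kappa> * s) / 16 \<le> \<epsilon> * (real (npart n) * real n)" using \<epsilon> by simp
    moreover have "exp (\<kappa> * s) * (exp (real t * ln (4 * real n + 3)) * exp (- (k * s)) * real n * K) \<le> exp (\<kappa> * s) * (\<epsilon> / 16)"
      using b by (intro mult_left_mono) auto
    ultimately have "(real ((4 * n + 3) ^ t) * (K * (exp (\<kappa> * s) * exp (- (k * s))))) * real n \<le> (\<epsilon> * real (npart n)) * real n"
    proof -
      have "(real ((4 * n + 3) ^ t) * (K * (exp (\<kappa> * s) * exp (- (k * s))))) * real n =
        exp (\<kappa> * s) * (exp (real t * ln (4 * real n + 3)) * exp (- (k * s)) * real n * K)"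
        unfolding e2 by (simp only: mult_ac)
      also have "\<dots> \<le> exp (\<kappa> * s) * (\<epsilon> / 16)" by fact
      also have "\<dots> = \<epsilon> * exp (\<kappa> * s) / 16" by simp
      also have "\<dots> \<le> \<epsilon> * (real (npart n) * real n)" by fact
      also have "\<dots> = (\<epsilon> * real (npart n)) * real n" by (simp only: mult_ac)
      finally show ?thesis .
    qed
    then show ?case unfolding e1 using elim by simp
  qed
qed

text \<open>For core size at most eta n, w is at least n/(2 t) and moves by at most delta sqrt(w),
  so the weight drops at most by the factor 1 - e. All other charge vectors are negligible by
  \<open>tail_small\<close>. X is quantified inside the eventuality because classes defined through
  w depend on n.\<close>

lemma core_sum_shift:
  assumes t: "t > 0" and v: "sum v {..<t} = 0" and \<epsilon>: "(\<epsilon> :: real) > 0"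
  shows "\<forall>\<^sub>F n in sequentially. \<forall>X. real (core_sum t n X) \<le> real (core_sum t n (shift_core t v ` X)) + \<epsilon> * real (npart n)"
proof -
  define e where "e = min (\<epsilon> / 2) (1 / 2)"
  have e: "0 < e" "e < 1" "e \<le> \<epsilon> / 2" using \<epsilon> by (auto simp: e_def)
  obtain \<delta> W where \<delta>: "\<delta> > 0" and reg: "\<And>w j. w \<ge> W \<Longrightarrow> real j \<le> \<delta> * sqrt (real w) \<Longrightarrow>
     j \<le> w \<and> (1 - e) * real (tuple_count t w) \<le> real (tuple_count t (w - j))"
    using tuple_count_slowly_varying[OF t e(1,2)] by metis
  obtain L where L: "L > 0" "\<And>c. \<bar>real_of_int (shift_size t v c)\<bar> \<le> L * (1 + sqrt (real_of_int (core_size t c)))"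
    using shift_size_bound[of t v] by metis
  obtain K where K: "K > 0" "\<And>w. real (tuple_count t w) \<le> K * exp (2 * sqrt (real t * pi\<^sup>2 / 6 * real w))"
    using tuple_count_upper[OF t] by metis
  \<comment> \<open>Chosen to make 2 L tau sqrt(n) equal to delta sqrt(n/(2 t)), which is at most
    delta sqrt(w).\<close>
  define \<tau> where "\<tau> = \<delta> / (2 * L * sqrt (2 * real t))"
  have \<tau>: "\<tau> > 0" using \<delta> L t by (simp add: \<tau>_def)
  define \<eta> where "\<eta> = min (1 / 2) (\<tau>\<^sup>2)"
  have \<eta>: "0 < \<eta>" "\<eta> \<le> 1 / 2" "\<eta> \<le> \<tau>\<^sup>2" using \<tau> by (auto simp: \<eta>_def)
  have "\<forall>\<^sub>F n in sequentially. 1 \<le> \<tau> * sqrt (real n)" using \<tau> by real_asymp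
  moreover have "\<forall>\<^sub>F n in sequentially. real ((4 * n + 3) ^ t) * (K * exp (2 * sqrt (real t * pi\<^sup>2 / 6 * ((1 - \<eta>) * real n / real t)))) \<le> \<epsilon> / 2 * real (npart n)"
    by (rule tail_small) (use t \<eta> K \<epsilon> in auto)
  ultimately show ?thesis using eventually_ge_at_top[of "2 * t * W + 1"]
  proof eventually_elim
    case (elim n)
    have "2 * t * W \<le> n" "n > 0" using elim(3) by auto
    then have "real (2 * t * W) \<le> real n" by (simp only: of_nat_le_iff)
    with \<open>n > 0\<close> have n: "n > 0" "real n \<ge> 2 * real t * real W" by simp_all
    define G where "G = {c \<in> small_cores t n. real_of_int (core_size t c) \<le> \<eta> * real n}"
    have near: "(1 - e) * real (core_weight t n c) \<le> real (core_weight t n (shift_core t v c)) \<and>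
       (core_weight t n c \<noteq> 0 \<longrightarrow> shift_core t v c \<in> small_cores t n)" if c: "c \<in> G" for c
    proof (cases "int t dvd int n - core_size t c")
      case False
      then show ?thesis by (simp add: core_weight_def)
    next
      case True
      have cs: "c \<in> charge_vectors t" "core_size t c \<le> int n" and Q: "real_of_int (core_size t c) \<le> \<eta> * real n"
        using c by (auto simp: G_def small_cores_def)
      obtain k where k: "int n - core_size t c = int t * k" using True by blast
      have "0 \<le> int t * k" using cs k by linarith
      then have k0: "k \<ge> 0" using t by (simp add: zero_le_mult_iff)
      define w where "w = nat k"
      have kw: "k = int w" using k0 by (simp add: w_def)
      have "real n - \<eta> * real n \<le> real_of_int (int n - core_size t c)" using Q by simp
      also have "\<dots> = real t * real w" using k kw by simp
      finally have "real n - \<eta> * real n \<le> real t * real w" .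
      moreover have "\<eta> * real n \<le> 1 / 2 * real n" using \<eta> by (intro mult_right_mono) auto
      ultimately have "real n / 2 \<le> real t * real w" by simp
      then have w: "real n / (2 * real t) \<le> real w" using t by (simp add: field_simps)
      have "real W \<le> real n / (2 * real t)" using n t by (simp add: field_simps)
      then have wW: "w \<ge> W" using w by linarith
      define D where "D = shift_size t v c"
      have "sqrt (real_of_int (core_size t c)) \<le> sqrt (\<tau>\<^sup>2 * real n)"
        using Q \<eta> by (intro real_sqrt_le_mono) (meson mult_right_mono of_nat_0_le_iff order_trans)
      also have "\<dots> = \<tau> * sqrt (real n)" using \<tau> by (simp add: real_sqrt_mult)
      finally have "1 + sqrt (real_of_int (core_size t c)) \<le> 2 * \<tau> * sqrt (real n)" using elim(1) by linarith
      then have "L * (1 + sqrt (real_of_int (core_size t c))) \<le> L * (2 * \<tau> * sqrt (real n))" using L by (intro mult_left_mono) auto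
      also have "\<dots> = \<delta> * sqrt (real n / (2 * real t))" using L t by (simp add: \<tau>_def real_sqrt_divide)
      also have "\<dots> \<le> \<delta> * sqrt (real w)" using \<delta> w by (intro mult_left_mono real_sqrt_le_mono) auto
      finally have Db: "\<bar>real_of_int D\<bar> \<le> \<delta> * sqrt (real w)" using L(2)[of c] by (simp add: D_def)
      \<comment> \<open>Both signs occur: a decrease of w is handled by slow variation, an increase
        by monotonicity.\<close>
      have Dw: "D \<le> int w \<and> (1 - e) * real (tuple_count t w) \<le> real (tuple_count t (nat (int w - D)))"
      proof (cases "D \<ge> 0")
        case True
        then have "real (nat D) \<le> \<delta> * sqrt (real w)" using Db by simp
        from reg[OF wW this] True show ?thesis by (simp add: nat_diff_distrib' nat_le_iff)
      next
        case False
        have "(1 - e) * real (tuple_count t w) \<le> 1 * real (tuple_count t w)" using e by (intro mult_right_mono) auto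
        also have "\<dots> \<le> real (tuple_count t (nat (int w - D)))"
          using False by (simp add: tuple_count_mono[OF t])
        finally show ?thesis using False by simp
      qed
      have sz: "int n - core_size t (shift_core t v c) = int t * (int w - D)"
        unfolding core_size_shift D_def[symmetric] using k kw by (simp add: algebra_simps)
      have le: "core_size t (shift_core t v c) \<le> int n"
      proof -
        have "0 \<le> int t * (int w - D)" using Dw by simp
        then show ?thesis using sz by linarith
      qed
      have "core_weight t n c = tuple_count t w" using k kw t cs True by (simp add: core_weight_def)
      moreover have "core_weight t n (shift_core t v c) = tuple_count t (nat (int w - D))"
        using le t by (simp add: core_weight_def sz)
      ultimately show ?thesis using Dw le shift_core_charge_vectors[OF cs(1) v] by (simp add: small_cores_def)
    qed
    have far: "real (core_weight t n c) \<le> K * exp (2 * sqrt (real t * pi\<^sup>2 / 6 * ((1 - \<eta>) * real n / real t)))"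
      if c: "c \<in> small_cores t n - G" for c
    proof (cases "int t dvd int n - core_size t c")
      case False
      then show ?thesis using K by (simp add: core_weight_def)
    next
      case True
      have cs: "core_size t c \<le> int n" and Q: "real_of_int (core_size t c) > \<eta> * real n"
        using c by (auto simp: G_def small_cores_def)
      obtain k where k: "int n - core_size t c = int t * k" using True by blast
      have "0 \<le> int t * k" using cs k by linarith
      then have k0: "k \<ge> 0" using t by (simp add: zero_le_mult_iff)
      define w where "w = nat k"
      have kw: "k = int w" using k0 by (simp add: w_def)
      have "real t * real w = real_of_int (int n - core_size t c)" using k kw by simp
      also have "\<dots> \<le> (1 - \<eta>) * real n" using Q by (simp add: algebra_simps)
      finally have "real w \<le> (1 - \<eta>) * real n / real t" using t by (simp add: field_simps)
      then have "K * exp (2 * sqrt (real t * pi\<^sup>2 / 6 * real w)) \<le> K * exp (2 * sqrt (real t * pi\<^sup>2 / 6 * ((1 - \<eta>) * real n / real t)))"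
        using K by (intro mult_left_mono exp_le_cancel_iff[THEN iffD2] real_sqrt_le_mono mult_left_mono) auto
      moreover have "core_weight t n c = tuple_count t w" using k kw t cs True by (simp add: core_weight_def)
      ultimately show ?thesis using K(2)[of w] by simp
    qed
    show ?case
    proof (intro allI)
      fix X
      let ?f = "\<lambda>c. real (core_weight t n c)"
      have fin: "finite (small_cores t n)" by (rule finite_small_cores)
      have G: "G \<subseteq> small_cores t n" by (auto simp: G_def)
      define Y where "Y = {c \<in> G \<inter> X. core_weight t n c \<noteq> 0}"
      have Y: "Y \<subseteq> charge_vectors t" "finite Y" using G fin finite_subset[of Y] by (auto simp: Y_def small_cores_def)
      have "real (core_sum t n X) = sum ?f (small_cores t n \<inter> X \<inter> G) + sum ?f (small_cores t n \<inter> X - G)"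
        unfolding core_sum_def of_nat_sum by (rule sum.Int_Diff) (use fin in auto)
      also have "sum ?f (small_cores t n \<inter> X - G) \<le> sum ?f (small_cores t n - G)"
        by (rule sum_mono2) (use fin in auto)
      also have "\<dots> \<le> (\<Sum>c\<in>small_cores t n - G. K * exp (2 * sqrt (real t * pi\<^sup>2 / 6 * ((1 - \<eta>) * real n / real t))))"
        by (rule sum_mono[OF far])
      also have "\<dots> \<le> real ((4 * n + 3) ^ t) * (K * exp (2 * sqrt (real t * pi\<^sup>2 / 6 * ((1 - \<eta>) * real n / real t))))"
      proof -
        have "card (small_cores t n - G) \<le> card (small_cores t n)" by (rule card_mono[OF fin]) auto
        then have "card (small_cores t n - G) \<le> (4 * n + 3) ^ t" using card_small_cores[of t n] by linarith
        then have "real (card (small_cores t n - G)) \<le> real ((4 * n + 3) ^ t)" by (simp only: of_nat_le_iff)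
        then show ?thesis unfolding sum_constant using K by (intro mult_right_mono) auto
      qed
      also have "\<dots> \<le> \<epsilon> / 2 * real (npart n)" by (rule elim(2))
      finally have 1: "real (core_sum t n X) \<le> sum ?f (small_cores t n \<inter> X \<inter> G) + \<epsilon> / 2 * real (npart n)" by simp
      have "sum ?f (small_cores t n \<inter> X \<inter> G) = sum ?f Y"
        by (rule sum.mono_neutral_right) (use fin G in \<open>auto simp: Y_def\<close>)
      also have "\<dots> = (1 - e) * sum ?f Y + e * sum ?f Y" by (simp add: algebra_simps)
      also have "(1 - e) * sum ?f Y \<le> (\<Sum>c\<in>Y. ?f (shift_core t v c))"
        unfolding sum_distrib_left by (rule sum_mono) (use near in \<open>auto simp: Y_def\<close>)
      also have "\<dots> = sum ?f (shift_core t v ` Y)"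
        by (rule sum.reindex[symmetric, unfolded o_def]) (rule inj_on_subset[OF inj_on_shift_core Y(1)])
      also have "\<dots> \<le> real (core_sum t n (shift_core t v ` X))"
        unfolding core_sum_def of_nat_sum by (rule sum_mono2) (use fin near in \<open>auto simp: Y_def\<close>)
      also have "e * sum ?f Y \<le> \<epsilon> / 2 * real (npart n)"
      proof (rule mult_mono)
        show "sum ?f Y \<le> real (npart n)" unfolding npart_core_sum[OF t] core_sum_def of_nat_sum
          by (rule sum_mono2) (use fin G in \<open>auto simp: Y_def\<close>)
      qed (use e \<epsilon> in \<open>auto intro: sum_nonneg\<close>)
      finally have "sum ?f (small_cores t n \<inter> X \<inter> G) \<le> real (core_sum t n (shift_core t v ` X)) + \<epsilon> / 2 * real (npart n)" by simp
      with 1 show "real (core_sum t n X) \<le> real (core_sum t n (shift_core t v ` X)) + \<epsilon> * real (npart n)" by simp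
    qed
  qed
qed

text \<open>The total p is compared with card J copies of one class. The one-sided hypothesis gives
  both directions because it holds for all ordered pairs of classes.\<close>

lemma equidistribution:
  fixes a :: "'j \<Rightarrow> nat \<Rightarrow> real" and p :: "nat \<Rightarrow> real"
  assumes J: "finite J" "j \<in> J" and p: "\<And>n. p n > 0" and sum: "\<And>n. (\<Sum>j\<in>J. a j n) = p n"
    and near: "\<And>i j \<epsilon>. i \<in> J \<Longrightarrow> j \<in> J \<Longrightarrow> \<epsilon> > 0 \<Longrightarrow> \<forall>\<^sub>F n in sequentially. a i n \<le> a j n + \<epsilon> * p n"
  shows "(\<lambda>n. a j n / p n) \<longlonglongrightarrow> 1 / real (card J)"
proof (rule tendstoI)
  fix \<epsilon> :: real assume \<epsilon>: "\<epsilon> > 0"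
  have cJ: "real (card J) > 0" using J by (auto simp: card_gt_0_iff)
  have "\<forall>\<^sub>F n in sequentially. \<forall>i\<in>J. a i n \<le> a j n + \<epsilon> / 2 * p n \<and> a j n \<le> a i n + \<epsilon> / 2 * p n"
  proof (intro eventually_ball_finite J(1) ballI eventually_conj)
    fix i assume "i \<in> J"
    then show "\<forall>\<^sub>F n in sequentially. a i n \<le> a j n + \<epsilon> / 2 * p n"
      "\<forall>\<^sub>F n in sequentially. a j n \<le> a i n + \<epsilon> / 2 * p n"
      using near J(2) \<epsilon> half_gt_zero by blast+
  qed
  then show "\<forall>\<^sub>F n in sequentially. dist (a j n / p n) (1 / real (card J)) < \<epsilon>"
  proof eventually_elim
    case (elim n)
    have "p n \<le> (\<Sum>i\<in>J. a j n + \<epsilon> / 2 * p n)" unfolding sum[symmetric] by (rule sum_mono) (use elim in \<open>simp add: sum\<close>)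
    also have "\<dots> = real (card J) * (a j n + \<epsilon> / 2 * p n)" by simp
    finally have 1: "p n / real (card J) \<le> a j n + \<epsilon> / 2 * p n" using cJ by (simp add: field_simps)
    have "real (card J) * (a j n - \<epsilon> / 2 * p n) = (\<Sum>i\<in>J. a j n - \<epsilon> / 2 * p n)" by simp
    also have "\<dots> \<le> p n" unfolding sum[symmetric, of n] by (rule sum_mono) (use elim in \<open>auto simp: sum algebra_simps\<close>)
    finally have 2: "a j n - \<epsilon> / 2 * p n \<le> p n / real (card J)" using cJ by (simp add: field_simps)
    have "\<bar>a j n / p n - 1 / real (card J)\<bar> \<le> \<epsilon> / 2"
    proof -
      have "(p n / real (card J)) / p n \<le> (a j n + \<epsilon> / 2 * p n) / p n"
        using 1 p[of n] by (intro divide_right_mono) auto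
      moreover have "(a j n - \<epsilon> / 2 * p n) / p n \<le> (p n / real (card J)) / p n"
        using 2 p[of n] by (intro divide_right_mono) auto
      ultimately have "1 / real (card J) \<le> a j n / p n + \<epsilon> / 2" "a j n / p n - \<epsilon> / 2 \<le> 1 / real (card J)"
        using p[of n] by (simp_all add: add_divide_distrib diff_divide_distrib)
      then show ?thesis by linarith
    qed
    then show ?case using \<epsilon> by (simp add: dist_real_def)
  qed
qed

subsection \<open>Gauss sums\<close>

text \<open>Gauss's lemma: \<open>E\<close> consists of the numbers 2 x with (p - 1)/4 < x <= (p -
  1)/2, and the parity of their number depends on p mod 8. The symbol of 2 enters because the
  congruence to be counted is for twice the core size.\<close>

lemma legendre_two:
  assumes p: "prime p" "2 < p"
  shows "Legendre 2 (int p) = (if p mod 8 = 1 \<or> p mod 8 = 7 then 1 else -1)"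
proof -
  have odd: "odd p" using p prime_odd_nat by auto
  have "\<not> int p dvd 2" using p zdvd_imp_le[of "int p" 2] by auto
  then interpret GAUSS p 2
    by unfold_locales (use p in \<open>auto simp: cong_0_iff\<close>)
  have C: "C = (\<lambda>x. 2 * x) ` A"
  proof -
    have "(2 * x) mod int p = 2 * x" if "x \<in> A" for x
      using that p by (intro mod_pos_pos_trivial) (auto simp: A_def)
    then show ?thesis unfolding C_def B_def image_image by (intro image_cong) (auto simp: mult.commute)
  qed
  have E: "E = (\<lambda>x. 2 * x) ` {(int p - 1) div 4<..(int p - 1) div 2}"
  proof -
    have "(int p - 1) div 2 < 2 * x \<longleftrightarrow> (int p - 1) div 4 < x" for x
    proof -
      have e: "(int p - 1) div 4 = ((int p - 1) div 2) div 2" by (simp add: div_mult2_eq[of _ 2 2, simplified])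
      show ?thesis unfolding e by linarith
    qed
    moreover have "0 \<le> (int p - 1) div 4" using p by simp
    ultimately show ?thesis unfolding E_def C A_def by force
  qed
  have "card E = nat ((int p - 1) div 2 - (int p - 1) div 4)"
    unfolding E by (subst card_image) (auto simp: inj_on_def)
  moreover have "p mod 8 = 1 \<or> p mod 8 = 3 \<or> p mod 8 = 5 \<or> p mod 8 = 7" using odd by presburger
  moreover define k where "k = p div 8"
  moreover have "p = 8 * k + p mod 8" by (simp add: k_def)
  ultimately have "even (card E) \<longleftrightarrow> p mod 8 = 1 \<or> p mod 8 = 7"
  proof (elim disjE)
    assume "p mod 8 = 1" and c: "card E = nat ((int p - 1) div 2 - (int p - 1) div 4)" "p = 8 * k + p mod 8"
    then have "int p = 8 * int k + 1" by presburger
    then have "card E = 2 * k" using c by simp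
    then show ?thesis using \<open>p mod 8 = 1\<close> by simp
  next
    assume "p mod 8 = 3" and c: "card E = nat ((int p - 1) div 2 - (int p - 1) div 4)" "p = 8 * k + p mod 8"
    then have "int p = 8 * int k + 3" by presburger
    then have "(int p - 1) div 2 = 4 * int k + 1" "(int p - 1) div 4 = 2 * int k" by auto
    then have "card E = 2 * k + 1" using c by simp
    then show ?thesis using \<open>p mod 8 = 3\<close> by simp
  next
    assume "p mod 8 = 5" and c: "card E = nat ((int p - 1) div 2 - (int p - 1) div 4)" "p = 8 * k + p mod 8"
    then have "int p = 8 * int k + 5" by presburger
    then have "(int p - 1) div 2 = 4 * int k + 2" "(int p - 1) div 4 = 2 * int k + 1" by auto
    then have "card E = 2 * k + 1" using c by simp
    then show ?thesis using \<open>p mod 8 = 5\<close> by simp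
  next
    assume "p mod 8 = 7" and c: "card E = nat ((int p - 1) div 2 - (int p - 1) div 4)" "p = 8 * k + p mod 8"
    then have "int p = 8 * int k + 7" by presburger
    then have "(int p - 1) div 2 = 4 * int k + 3" "(int p - 1) div 4 = 2 * int k + 1" by auto
    then have "card E = 2 * k + 2" using c by simp
    then show ?thesis using \<open>p mod 8 = 7\<close> by simp
  qed
  then show ?thesis using gauss_lemma by (auto simp: uminus_power_if)
qed

section \<open>The Legendre symbol and additive characters modulo b\<close>

locale odd_prime =
  fixes b :: int
  assumes prime_b: "prime b" and odd_b: "odd b"
begin

lemma b_ge_3: "b \<ge> 3"
  using prime_gt_1_int[OF prime_b] odd_b by presburger

lemma b_pos: "b > 0" using b_ge_3 by simp

abbreviation \<eta> :: "int \<Rightarrow> int" where "\<eta> x \<equiv> Legendre x b"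

lemma eta_cases: "\<eta> x = 0 \<or> \<eta> x = 1 \<or> \<eta> x = -1"
  by (auto simp: Legendre_def)

lemma eta_eq_0_iff: "\<eta> x = 0 \<longleftrightarrow> b dvd x"
  by (auto simp: Legendre_def cong_0_iff)

lemma eta_cong: "[x = y] (mod b) \<Longrightarrow> \<eta> x = \<eta> y"
  unfolding Legendre_def QuadRes_def cong_def by simp

lemma prime_nat_b: "prime (nat b)" "2 < nat b"
proof -
  show "prime (nat b)" using prime_int_nat_transfer[of b] prime_b by blast
  show "2 < nat b" using b_ge_3 by linarith
qed

lemma int_nat_b: "int (nat b) = b"
  using b_pos by (rule nat_0_le[OF less_imp_le])

lemma eta_euler: "[\<eta> x = x ^ ((nat b - 1) div 2)] (mod b)"
  using euler_criterion[OF prime_nat_b, of x] unfolding int_nat_b .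

lemma small_cong_eq:
  assumes "[x = y] (mod b)" "\<bar>x - y\<bar> < b" shows "x = y"
proof (rule ccontr)
  assume "x \<noteq> y"
  then have "\<bar>b\<bar> \<le> \<bar>x - y\<bar>" using assms(1) by (intro dvd_imp_le_int) (auto simp: cong_iff_dvd_diff)
  then show False using assms(2) b_pos by simp
qed

lemma eta_mult: "\<eta> (x * y) = \<eta> x * \<eta> y"
proof (rule small_cong_eq)
  have "[\<eta> x * \<eta> y = x ^ ((nat b - 1) div 2) * y ^ ((nat b - 1) div 2)] (mod b)"
    by (intro cong_mult eta_euler)
  then have "[\<eta> x * \<eta> y = (x * y) ^ ((nat b - 1) div 2)] (mod b)" by (simp only: power_mult_distrib)
  then show "[\<eta> (x * y) = \<eta> x * \<eta> y] (mod b)" using eta_euler[of "x * y"] cong_sym cong_trans by blast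
  have "\<bar>\<eta> (x * y) - \<eta> x * \<eta> y\<bar> \<le> 2"
    using eta_cases[of "x * y"] eta_cases[of x] eta_cases[of y] by (elim disjE) simp_all
  then show "\<bar>\<eta> (x * y) - \<eta> x * \<eta> y\<bar> < b" using b_ge_3 by linarith
qed

lemma eta_1 [simp]: "\<eta> 1 = 1"
  using b_ge_3 by (auto simp: Legendre_def QuadRes_def cong_0_iff intro!: exI[of _ 1])

lemma eta_square: "\<not> b dvd x \<Longrightarrow> \<eta> x * \<eta> x = 1"
  using eta_cases[of x] eta_eq_0_iff[of x] by auto

lemma eta_minus_1: "\<eta> (- 1) = (if b mod 4 = 1 then 1 else - 1)"
proof -
  have "\<eta> (- 1) = (- 1) ^ ((nat b - 1) div 2)"
  proof (rule small_cong_eq[OF eta_euler])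
    show "\<bar>\<eta> (- 1) - (- 1) ^ ((nat b - 1) div 2)\<bar> < b"
      using eta_cases[of "- 1"] b_ge_3 by (auto simp: uminus_power_if)
  qed
  moreover have "even ((nat b - 1) div 2) \<longleftrightarrow> b mod 4 = 1"
  proof -
    obtain B where B: "b = int B" using b_pos by (metis zero_less_imp_eq_int)
    have "odd B" using odd_b B by simp
    then have "even ((B - 1) div 2) \<longleftrightarrow> B mod 4 = 1" by presburger
    moreover have "b mod 4 = 1 \<longleftrightarrow> B mod 4 = 1" unfolding B by presburger
    ultimately show ?thesis by (simp add: B)
  qed
  ultimately show ?thesis by (simp add: uminus_power_if)
qed

lemma eta_2: "\<eta> 2 = (if b mod 8 = 1 \<or> b mod 8 = 7 then 1 else - 1)"
proof -
  have "int (nat b mod 8) = b mod 8" unfolding zmod_int int_nat_b by simp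
  then have "nat b mod 8 = k \<longleftrightarrow> b mod 8 = int k" for k by auto
  then show ?thesis using legendre_two[OF prime_nat_b] unfolding int_nat_b by simp
qed

definition e :: "int \<Rightarrow> complex" where
  "e k = cis (2 * pi * of_int k / of_int b)"

lemma e_add: "e (j + k) = e j * e k"
  by (simp add: e_def cis_mult add_divide_distrib distrib_left)

lemma e_0 [simp]: "e 0 = 1" by (simp add: e_def)

lemma e_eq_1_iff: "e k = 1 \<longleftrightarrow> b dvd k"
proof
  assume "e k = 1"
  then have "cos (2 * pi * of_int k / of_int b) = 1" by (simp add: e_def complex_eq_iff)
  then obtain n :: int where "2 * pi * of_int k / of_int b = of_int n * 2 * pi" by (auto simp: cos_one_2pi_int)
  then have "real_of_int k = real_of_int (n * b)" using b_pos by (simp add: field_simps)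
  then show "b dvd k" by (simp only: of_int_eq_iff) simp
next
  assume "b dvd k"
  then obtain n where "k = b * n" by blast
  then have "2 * pi * of_int k / of_int b = 2 * pi * of_int n" using b_pos by simp
  then show "e k = 1" unfolding e_def by (simp only: cis_multiple_2pi Ints_of_int)
qed

lemma e_cong: "[j = k] (mod b) \<Longrightarrow> e j = e k"
proof -
  assume "[j = k] (mod b)"
  then have "e (j - k) = 1" by (simp add: e_eq_1_iff cong_iff_dvd_diff)
  then show ?thesis using e_add[of "j - k" k] by simp
qed

lemma e_sum: "finite A \<Longrightarrow> e (sum f A) = (\<Prod>x\<in>A. e (f x))"
  by (induction A rule: finite_induct) (auto simp: e_add)

end

context odd_prime
begin

text \<open>A map injective modulo b permutes the residues, and f depends on the residue
  only.\<close>

lemma sum_residues: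
  fixes f :: "int \<Rightarrow> complex"
  assumes per: "\<And>x y. [x = y] (mod b) \<Longrightarrow> f x = f y"
    and inj: "\<And>x y. [g x = g y] (mod b) \<Longrightarrow> [x = y] (mod b)"
  shows "(\<Sum>m\<in>{0..<b}. f (g m)) = (\<Sum>m\<in>{0..<b}. f m)"
proof -
  have "inj_on (\<lambda>m. g m mod b) {0..<b}"
  proof (rule inj_onI)
    fix x y assume xy: "x \<in> {0..<b}" "y \<in> {0..<b}" "g x mod b = g y mod b"
    from xy(3) have "[g x = g y] (mod b)" by (simp only: cong_def)
    from inj[OF this] have "x mod b = y mod b" by (simp only: cong_def)
    then show "x = y" using xy by simp
  qed
  moreover have sub: "(\<lambda>m. g m mod b) ` {0..<b} \<subseteq> {0..<b}" using b_pos by auto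
  ultimately have "bij_betw (\<lambda>m. g m mod b) {0..<b} {0..<b}"
    unfolding bij_betw_def using endo_inj_surj[OF _ sub] by simp
  then have "(\<Sum>m\<in>{0..<b}. f (g m mod b)) = (\<Sum>m\<in>{0..<b}. f m)"
    by (rule sum.reindex_bij_betw)
  moreover have "f (g m mod b) = f (g m)" for m by (rule per) simp
  ultimately show ?thesis by simp
qed

lemma sum_residues_shift:
  fixes f :: "int \<Rightarrow> complex"
  assumes "\<And>x y. [x = y] (mod b) \<Longrightarrow> f x = f y"
  shows "(\<Sum>m\<in>{0..<b}. f (m + s)) = (\<Sum>m\<in>{0..<b}. f m)"
  by (rule sum_residues[OF assms]) (auto simp: cong_add_rcancel)

lemma sum_residues_mult:
  fixes f :: "int \<Rightarrow> complex"
  assumes "\<And>x y. [x = y] (mod b) \<Longrightarrow> f x = f y" "\<not> b dvd u"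
  shows "(\<Sum>m\<in>{0..<b}. f (u * m)) = (\<Sum>m\<in>{0..<b}. f m)"
proof (rule sum_residues[OF assms(1)])
  have "coprime u b" using prime_imp_coprime[OF prime_b assms(2)] by (simp add: coprime_commute)
  then show "[u * x = u * y] (mod b) \<Longrightarrow> [x = y] (mod b)" for x y by (simp add: cong_mult_lcancel)
qed

lemma sum_e: "(\<Sum>m\<in>{0..<b}. e (k * m)) = (if b dvd k then of_int b else 0)"
proof (cases "b dvd k")
  case True
  then have "e (k * m) = 1" for m by (simp add: e_eq_1_iff)
  then show ?thesis using True b_pos by simp
next
  case False
  have "(\<Sum>m\<in>{0..<b}. e (k * (m + 1))) = (\<Sum>m\<in>{0..<b}. e (k * m))"
    by (rule sum_residues_shift[of "\<lambda>m. e (k * m)"]) (auto intro!: e_cong cong_scalar_left)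
  then have "e k * (\<Sum>m\<in>{0..<b}. e (k * m)) = (\<Sum>m\<in>{0..<b}. e (k * m))"
    by (simp add: distrib_left e_add sum_distrib_left mult.commute)
  then have "(e k - 1) * (\<Sum>m\<in>{0..<b}. e (k * m)) = 0" by (simp add: algebra_simps)
  then show ?thesis using False by (simp add: e_eq_1_iff)
qed

lemma card_square_roots:
  assumes "x \<in> {0..<b}"
  shows "int (card {m \<in> {0..<b}. m\<^sup>2 mod b = x}) = 1 + \<eta> x"
proof (cases "b dvd x")
  case True
  then have x: "x = 0" using assms zdvd_not_zless[of x b] by force
  have "{m \<in> {0..<b}. m\<^sup>2 mod b = x} = {0}"
  proof (intro equalityI subsetI)
    fix m assume m: "m \<in> {m \<in> {0..<b}. m\<^sup>2 mod b = x}"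
    then have "b dvd m\<^sup>2" using x by auto
    then have "b dvd m" using prime_b prime_dvd_power_int by blast
    then show "m \<in> {0}" using m zdvd_not_zless[of m b] by force
  qed (use x b_pos in auto)
  then show ?thesis using True eta_eq_0_iff[of x] by simp
next
  case nd: False
  show ?thesis
  proof (cases "\<eta> x = 1")
    case True
    then obtain y where y: "[y\<^sup>2 = x] (mod b)" using nd by (auto simp: Legendre_def QuadRes_def cong_0_iff split: if_splits)
    define z where "z = y mod b"
    have z: "z \<in> {0..<b}" "[z\<^sup>2 = x] (mod b)"
      using y b_pos by (auto simp: z_def cong_def power_mod)
    have z0: "z \<noteq> 0" using z(2) nd by (auto simp: cong_def mod_0_imp_dvd)
    have "{m \<in> {0..<b}. m\<^sup>2 mod b = x} = {z, b - z}"
    proof (intro equalityI subsetI)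
      fix m assume m: "m \<in> {m \<in> {0..<b}. m\<^sup>2 mod b = x}"
      then have "[m\<^sup>2 = z\<^sup>2] (mod b)" using z assms by (simp add: cong_def)
      then have "b dvd (m - z) * (m + z)" by (simp add: cong_iff_dvd_diff power2_eq_square algebra_simps)
      then consider "b dvd m - z" | "b dvd m + z" using prime_dvd_mult_iff[OF prime_b] by blast
      then show "m \<in> {z, b - z}"
      proof cases
        case 1
        then have "[m = z] (mod b)" by (simp add: cong_iff_dvd_diff)
        then show ?thesis using m z by (simp add: cong_def)
      next
        case 2
        then have "b dvd m - (b - z)" using dvd_diff[OF 2 dvd_refl] by (simp add: algebra_simps)
        then have "[m = b - z] (mod b)" by (simp add: cong_iff_dvd_diff)
        then have "m = b - z" by (rule small_cong_eq) (use m z z0 in auto)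
        then show ?thesis by simp
      qed
    next
      fix m assume "m \<in> {z, b - z}"
      moreover have "[(b - z)\<^sup>2 = z\<^sup>2] (mod b)"
        by (simp add: cong_iff_dvd_diff power2_eq_square algebra_simps)
      ultimately show "m \<in> {m \<in> {0..<b}. m\<^sup>2 mod b = x}"
        using z z0 assms by (auto simp: cong_def)
    qed
    moreover have "z \<noteq> b - z" using odd_b by presburger
    ultimately show ?thesis using True by simp
  next
    case False
    then have m1: "\<eta> x = - 1" using eta_cases[of x] eta_eq_0_iff nd by blast
    have em: "{m \<in> {0..<b}. m\<^sup>2 mod b = x} = {}"
    proof (rule ccontr)
      assume "{m \<in> {0..<b}. m\<^sup>2 mod b = x} \<noteq> {}"
      then obtain m where "m\<^sup>2 mod b = x" by auto
      then have "[m\<^sup>2 = x] (mod b)" using assms by (auto simp: cong_def)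
      then have "QuadRes b x" by (auto simp: QuadRes_def)
      then show False using m1 by (auto simp: Legendre_def split: if_splits)
    qed
    show ?thesis unfolding em using m1 by simp
  qed
qed

lemma sum_over_squares:
  fixes f :: "int \<Rightarrow> complex"
  assumes per: "\<And>x y. [x = y] (mod b) \<Longrightarrow> f x = f y"
  shows "(\<Sum>m\<in>{0..<b}. f (m\<^sup>2)) = (\<Sum>x\<in>{0..<b}. (1 + of_int (\<eta> x)) * f x)"
proof -
  have "(\<Sum>m\<in>{0..<b}. f (m\<^sup>2)) = (\<Sum>m\<in>{0..<b}. f (m\<^sup>2 mod b))"
    by (intro sum.cong refl per) simp
  also have "\<dots> = (\<Sum>x\<in>{0..<b}. \<Sum>m\<in>{m \<in> {0..<b}. m\<^sup>2 mod b = x}. f (m\<^sup>2 mod b))"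
    by (rule sum.group[symmetric]) (use b_pos in auto)
  also have "\<dots> = (\<Sum>x\<in>{0..<b}. (1 + of_int (\<eta> x)) * f x)"
  proof (rule sum.cong[OF refl])
    fix x assume x: "x \<in> {0..<b}"
    have "(\<Sum>m\<in>{m \<in> {0..<b}. m\<^sup>2 mod b = x}. f (m\<^sup>2 mod b)) = of_nat (card {m \<in> {0..<b}. m\<^sup>2 mod b = x}) * f x"
      by simp
    also have "of_nat (card {m \<in> {0..<b}. m\<^sup>2 mod b = x}) = (of_int (1 + \<eta> x) :: complex)"
      by (simp only: card_square_roots[OF x, symmetric] of_int_of_nat_eq)
    finally show "(\<Sum>m\<in>{m \<in> {0..<b}. m\<^sup>2 mod b = x}. f (m\<^sup>2 mod b)) = (1 + of_int (\<eta> x)) * f x" by simp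
  qed
  finally show ?thesis .
qed

definition gauss :: complex where "gauss = (\<Sum>x\<in>{0..<b}. of_int (\<eta> x) * e x)"

lemma sum_eta: "(\<Sum>x\<in>{0..<b}. of_int (\<eta> x) :: complex) = 0"
  using sum_over_squares[of "\<lambda>_. 1"] b_pos by (simp add: sum.distrib)

lemma twisted_gauss: "(\<Sum>x\<in>{0..<b}. of_int (\<eta> x) * e (x * k)) = of_int (\<eta> k) * gauss"
proof (cases "b dvd k")
  case True
  then have "e (x * k) = 1" for x by (simp add: e_eq_1_iff)
  then show ?thesis using sum_eta True eta_eq_0_iff[of k] by simp
next
  case False
  have "of_int (\<eta> k) * (\<Sum>x\<in>{0..<b}. of_int (\<eta> x) * e (x * k)) = (\<Sum>x\<in>{0..<b}. of_int (\<eta> (k * x)) * e (k * x))"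
    by (simp add: sum_distrib_left eta_mult mult_ac)
  also have "\<dots> = gauss" unfolding gauss_def
    by (rule sum_residues_mult[of "\<lambda>x. of_int (\<eta> x) * e x"]) (use False eta_cong e_cong in metis)+
  finally have "of_int (\<eta> k) * (of_int (\<eta> k) * (\<Sum>x\<in>{0..<b}. of_int (\<eta> x) * e (x * k))) = of_int (\<eta> k) * gauss" by simp
  moreover have "of_int (\<eta> k) * of_int (\<eta> k) = (1 :: complex)"
    using eta_square[OF False] by (metis of_int_1 of_int_mult)
  ultimately show ?thesis by (simp add: mult.assoc[symmetric])
qed

text \<open>Counting square roots by 1 + eta splits the sum into a complete character sum, which
  vanishes, and a twisted Gauss sum.\<close>

lemma quadratic_gauss:
  assumes "\<not> b dvd k"
  shows "(\<Sum>m\<in>{0..<b}. e (k * m\<^sup>2)) = of_int (\<eta> k) * gauss"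
proof -
  have "(\<Sum>m\<in>{0..<b}. e (k * m\<^sup>2)) = (\<Sum>x\<in>{0..<b}. (1 + of_int (\<eta> x)) * e (k * x))"
    by (rule sum_over_squares[of "\<lambda>x. e (k * x)"]) (auto intro!: e_cong cong_scalar_left)
  also have "\<dots> = (\<Sum>x\<in>{0..<b}. e (k * x)) + (\<Sum>x\<in>{0..<b}. of_int (\<eta> x) * e (x * k))"
    by (simp only: distrib_right mult_1 sum.distrib mult.commute[of k])
  finally show ?thesis using assms by (simp add: sum_e twisted_gauss)
qed

text \<open>\<open>gauss\<close> and its product with eta(-1) are quadratic sums over m^2 and -k^2.
  Substituting m = d + k makes the exponent d^2 + 2 d k, linear in k, so orthogonality leaves d = 0
  only. In both parities of t the solution count contains an even total power of
  \<open>gauss\<close>, which this turns into an integer.\<close>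

lemma gauss_square: "gauss\<^sup>2 = of_int (\<eta> (- 1) * b)"
proof -
  have nd1: "\<not> b dvd 1" "\<not> b dvd - 1" using b_ge_3 by auto
  have g: "gauss = (\<Sum>m\<in>{0..<b}. e (m\<^sup>2))" using quadratic_gauss[OF nd1(1)] by simp
  have g': "of_int (\<eta> (- 1)) * gauss = (\<Sum>k\<in>{0..<b}. e (- k\<^sup>2))" using quadratic_gauss[OF nd1(2)] by simp
  have "gauss * (of_int (\<eta> (- 1)) * gauss) = (\<Sum>m\<in>{0..<b}. e (m\<^sup>2)) * (\<Sum>k\<in>{0..<b}. e (- k\<^sup>2))"
    unfolding g' by (subst g) (rule refl)
  also have "\<dots> = (\<Sum>k\<in>{0..<b}. \<Sum>m\<in>{0..<b}. e (m\<^sup>2) * e (- k\<^sup>2))"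
    unfolding sum_product by (rule sum.swap)
  also have "\<dots> = (\<Sum>k\<in>{0..<b}. \<Sum>d\<in>{0..<b}. e ((d + k)\<^sup>2) * e (- k\<^sup>2))"
  proof (rule sum.cong[OF refl])
    fix k
    show "(\<Sum>m\<in>{0..<b}. e (m\<^sup>2) * e (- k\<^sup>2)) = (\<Sum>d\<in>{0..<b}. e ((d + k)\<^sup>2) * e (- k\<^sup>2))"
    proof (rule sum_residues_shift[symmetric, of "\<lambda>m. e (m\<^sup>2) * e (- k\<^sup>2)"])
      fix x y :: int assume "[x = y] (mod b)"
      then have "e (x\<^sup>2) = e (y\<^sup>2)" by (intro e_cong cong_pow)
      then show "e (x\<^sup>2) * e (- k\<^sup>2) = e (y\<^sup>2) * e (- k\<^sup>2)" by simp
    qed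
  qed
  also have "\<dots> = (\<Sum>k\<in>{0..<b}. \<Sum>d\<in>{0..<b}. e (d\<^sup>2) * e (2 * d * k))"
    by (intro sum.cong refl) (simp add: e_add[symmetric] power2_eq_square algebra_simps)
  also have "\<dots> = (\<Sum>d\<in>{0..<b}. e (d\<^sup>2) * (\<Sum>k\<in>{0..<b}. e (2 * d * k)))"
    by (subst sum.swap) (simp add: sum_distrib_left)
  also have "\<dots> = (\<Sum>d\<in>{0..<b}. if d = 0 then of_int b else 0)"
  proof (rule sum.cong[OF refl])
    fix d assume d: "d \<in> {0..<b}"
    have "\<not> b dvd 2" using b_ge_3 zdvd_imp_le[of b 2] by auto
    then have "b dvd 2 * d \<longleftrightarrow> d = 0"
      using prime_dvd_mult_iff[OF prime_b] d zdvd_not_zless[of d b] by force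
    then show "e (d\<^sup>2) * (\<Sum>k\<in>{0..<b}. e (2 * d * k)) = (if d = 0 then of_int b else 0)"
      by (simp add: sum_e)
  qed
  also have "\<dots> = of_int b" using b_pos by simp
  finally have "of_int (\<eta> (- 1)) * gauss\<^sup>2 = of_int b" by (simp add: power2_eq_square mult_ac)
  then have "of_int (\<eta> (- 1)) * (of_int (\<eta> (- 1)) * gauss\<^sup>2) = of_int (\<eta> (- 1) * b)" by simp
  moreover have "of_int (\<eta> (- 1)) * of_int (\<eta> (- 1)) = (1 :: complex)"
    using eta_square[OF nd1(2)] by (metis of_int_1 of_int_mult)
  ultimately show ?thesis by (simp add: mult.assoc[symmetric])
qed


text \<open>Twice \<open>core_size\<close> on vectors of sum zero. Doubling removes the halves in c
  (c - 1)/2, so that the value modulo b depends on the residues of the coordinates alone.\<close>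

definition qform :: "nat \<Rightarrow> (nat \<Rightarrow> int) \<Rightarrow> int" where
  "qform t \<rho> = (\<Sum>r<t. int t * (\<rho> r)\<^sup>2 + 2 * int r * \<rho> r)"

definition residue_vectors :: "nat \<Rightarrow> (nat \<Rightarrow> int) set" where
  "residue_vectors t = {..<t} \<rightarrow>\<^sub>E {0..<b}"

lemma finite_residue_vectors: "finite (residue_vectors t)"
  unfolding residue_vectors_def by (auto intro: finite_PiE)

lemma not_dvd_2: "\<not> b dvd 2"
  using b_ge_3 zdvd_imp_le[of b 2] by auto

lemma dvd_2_mult_iff: "b dvd 2 * k \<longleftrightarrow> b dvd k"
  using prime_dvd_mult_iff[OF prime_b] not_dvd_2 by blast

text \<open>Orthogonality: a nonzero frequency y annihilates every factor of the product, and there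
  is a factor since t > 0.\<close>

lemma card_charge_residues:
  "int (card {\<rho> \<in> residue_vectors t. b dvd sum \<rho> {..<t}}) * b = b ^ t" if "t > 0"
proof -
  have "of_int (int (card {\<rho> \<in> residue_vectors t. b dvd sum \<rho> {..<t}}) * b) =
      (\<Sum>\<rho>\<in>residue_vectors t. if b dvd sum \<rho> {..<t} then of_int b else (0 :: complex))"
    using finite_residue_vectors[of t] by (simp add: sum.If_cases Int_def)
  also have "\<dots> = (\<Sum>\<rho>\<in>residue_vectors t. \<Sum>y\<in>{0..<b}. e (sum \<rho> {..<t} * y))" by (simp add: sum_e)
  also have "\<dots> = (\<Sum>y\<in>{0..<b}. \<Sum>\<rho>\<in>residue_vectors t. \<Prod>r<t. e (y * \<rho> r))"
    by (subst sum.swap) (simp add: sum_distrib_left e_sum mult.commute[of _ "_ :: int"])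
  also have "\<dots> = (\<Sum>y\<in>{0..<b}. \<Prod>r<t. \<Sum>m\<in>{0..<b}. e (y * m))"
    unfolding residue_vectors_def by (intro sum.cong refl prod_sum_PiE[symmetric]) auto
  also have "\<dots> = (\<Sum>y\<in>{0..<b}. if y = 0 then of_int b ^ t else 0)"
  proof (rule sum.cong[OF refl])
    fix y assume y: "y \<in> {0..<b}"
    then have "b dvd y \<longleftrightarrow> y = 0" using zdvd_not_zless[of y b] by force
    then show "(\<Prod>r<t. \<Sum>m\<in>{0..<b}. e (y * m)) = (if y = 0 then of_int b ^ t else 0)"
      using that by (simp add: sum_e)
  qed
  also have "\<dots> = of_int (b ^ t)" using b_pos by simp
  finally show ?thesis by (simp only: of_int_eq_iff)
qed

lemma complete_square:
  assumes "[s * \<alpha> = 1] (mod b)"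
  shows "(\<Sum>m\<in>{0..<b}. e (\<alpha> * m\<^sup>2 + 2 * \<beta> * m)) = e (- (s * \<beta>\<^sup>2)) * (of_int (\<eta> \<alpha>) * gauss)"
proof -
  have nd: "\<not> b dvd \<alpha>"
  proof
    assume "b dvd \<alpha>"
    then have "b dvd s * \<alpha>" by simp
    then have "b dvd 1" using assms by (metis cong_dvd_iff cong_sym)
    then show False using b_ge_3 by simp
  qed
  have d: "b dvd s * \<alpha> - 1" using assms by (simp add: cong_iff_dvd_diff)
  have "e (\<alpha> * m\<^sup>2 + 2 * \<beta> * m) = e (- (s * \<beta>\<^sup>2)) * e (\<alpha> * (m + s * \<beta>)\<^sup>2)" for m
  proof -
    have "- (s * \<beta>\<^sup>2) + \<alpha> * (m + s * \<beta>)\<^sup>2 - (\<alpha> * m\<^sup>2 + 2 * \<beta> * m) = (s * \<alpha> - 1) * (2 * \<beta> * m + s * \<beta>\<^sup>2)"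
      by (simp add: power2_eq_square algebra_simps)
    then have "b dvd - (s * \<beta>\<^sup>2) + \<alpha> * (m + s * \<beta>)\<^sup>2 - (\<alpha> * m\<^sup>2 + 2 * \<beta> * m)" using d by simp
    then have "[- (s * \<beta>\<^sup>2) + \<alpha> * (m + s * \<beta>)\<^sup>2 = \<alpha> * m\<^sup>2 + 2 * \<beta> * m] (mod b)"
      by (simp only: cong_iff_dvd_diff)
    then show ?thesis unfolding e_add[symmetric] by (rule e_cong[symmetric])
  qed
  then have "(\<Sum>m\<in>{0..<b}. e (\<alpha> * m\<^sup>2 + 2 * \<beta> * m)) = e (- (s * \<beta>\<^sup>2)) * (\<Sum>m\<in>{0..<b}. e (\<alpha> * (m + s * \<beta>)\<^sup>2))"
    by (simp add: sum_distrib_left)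
  also have "(\<Sum>m\<in>{0..<b}. e (\<alpha> * (m + s * \<beta>)\<^sup>2)) = (\<Sum>m\<in>{0..<b}. e (\<alpha> * m\<^sup>2))"
    by (rule sum_residues_shift[of "\<lambda>m. e (\<alpha> * m\<^sup>2)"]) (auto intro!: e_cong cong_scalar_left cong_pow)
  finally show ?thesis using quadratic_gauss[OF nd] by simp
qed

lemma inverse_exists:
  assumes "\<not> b dvd x" obtains x' where "[x' * x = 1] (mod b)"
proof -
  have "coprime x b" using prime_imp_coprime[OF prime_b assms] by (simp add: coprime_commute)
  then obtain x' where "[x * x' = 1] (mod b)" using cong_solve_coprime_int by blast
  then show thesis using that[of x'] by (simp add: mult.commute)
qed

text \<open>\<open>T'\<close> and \<open>h\<close> stand for 1/t and 1/2 modulo b.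
  \<open>\<kappa>\<close> is the constant left after completing squares in the coordinates and then
  in the frequency y of the sum condition; over the rationals it would be (1 - t^2)/12.\<close>

context
  fixes t :: nat and T T' h \<kappa> S2 :: int
  assumes t: "t > 0" and T: "T = int t" and T': "[T' * T = 1] (mod b)" and h: "[2 * h = 1] (mod b)"
  defines "S2 \<equiv> \<Sum>r<t. (int r)\<^sup>2"
  defines "\<kappa> \<equiv> h\<^sup>2 * (T - 1)\<^sup>2 - T' * S2"
begin

lemma sum_squares_shift: "(\<Sum>r<t. (x * int r + y)\<^sup>2) = x\<^sup>2 * S2 + x * y * (T * (T - 1)) + T * y\<^sup>2"
proof -
  have S1: "2 * (\<Sum>r<t. int r) = T * (T - 1)"
    unfolding T by (induction t) (auto simp: algebra_simps)
  have "(\<Sum>r<t. (x * int r + y)\<^sup>2) = (\<Sum>r<t. x\<^sup>2 * (int r)\<^sup>2 + x * y * (2 * int r) + y\<^sup>2)"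
    by (intro sum.cong refl) (simp add: power2_eq_square algebra_simps)
  also have "\<dots> = x\<^sup>2 * S2 + x * y * (2 * (\<Sum>r<t. int r)) + T * y\<^sup>2"
    by (simp add: sum.distrib S2_def T flip: sum_distrib_left)
  finally show ?thesis by (simp only: S1)
qed

lemma quadratic_exponent:
  assumes "[x' * x = 1] (mod b)"
  shows "e (- (x' * T' * (\<Sum>r<t. (x * int r + y)\<^sup>2))) = e (x * \<kappa>) * e (- x' * (y + h * x * (T - 1))\<^sup>2)"
  unfolding e_add[symmetric]
proof (rule e_cong)
  have d: "b dvd x' * x - 1" "b dvd T' * T - 1" "b dvd 2 * h - 1"
    using assms T' h by (simp_all add: cong_iff_dvd_diff)
  \<comment> \<open>The two exponents differ by a combination of the defects of the three inverses
    x', T' and h, each divisible by b.\<close>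
  have "- (x' * T' * (x\<^sup>2 * S2 + x * y * (T * (T - 1)) + T * y\<^sup>2)) - (x * \<kappa> + - x' * (y + h * x * (T - 1))\<^sup>2)
    = (x' * x - 1) * (x * h\<^sup>2 * (T - 1)\<^sup>2 - x * T' * S2) + (T' * T - 1) * (- (x' * x * y * (T - 1)) - x' * y\<^sup>2)
      + (2 * h - 1) * (x' * x * y * (T - 1))"
    unfolding \<kappa>_def by (simp add: power2_eq_square algebra_simps)
  also have "b dvd \<dots>" using d by (intro dvd_add dvd_mult2)
  finally show "[- (x' * T' * (\<Sum>r<t. (x * int r + y)\<^sup>2)) = x * \<kappa> + - x' * (y + h * x * (T - 1))\<^sup>2] (mod b)"
    unfolding sum_squares_shift by (simp only: cong_iff_dvd_diff)
qed

lemma vector_sum: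
  "(\<Sum>\<rho>\<in>residue_vectors t. e (x * (qform t \<rho> - w) + 2 * y * sum \<rho> {..<t})) =
   e (- (x * w)) * (\<Prod>r<t. \<Sum>m\<in>{0..<b}. e (x * T * m\<^sup>2 + 2 * (x * int r + y) * m))"
proof -
  have "e (x * (qform t \<rho> - w) + 2 * y * sum \<rho> {..<t}) =
      e (- (x * w)) * (\<Prod>r<t. e (x * T * (\<rho> r)\<^sup>2 + 2 * (x * int r + y) * \<rho> r))" for \<rho>
  proof -
    have "x * (qform t \<rho> - w) + 2 * y * sum \<rho> {..<t} = - (x * w) + (\<Sum>r<t. x * T * (\<rho> r)\<^sup>2 + 2 * (x * int r + y) * \<rho> r)"
      unfolding qform_def T by (simp add: sum.distrib sum_distrib_left algebra_simps)
    then show ?thesis by (simp only: e_add e_sum finite_lessThan)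
  qed
  then have "(\<Sum>\<rho>\<in>residue_vectors t. e (x * (qform t \<rho> - w) + 2 * y * sum \<rho> {..<t})) =
    e (- (x * w)) * (\<Sum>\<rho>\<in>residue_vectors t. \<Prod>r<t. e (x * T * (\<rho> r)\<^sup>2 + 2 * (x * int r + y) * \<rho> r))"
    by (simp only: sum_distrib_left)
  also have "(\<Sum>\<rho>\<in>residue_vectors t. \<Prod>r<t. e (x * T * (\<rho> r)\<^sup>2 + 2 * (x * int r + y) * \<rho> r)) =
    (\<Prod>r<t. \<Sum>m\<in>{0..<b}. e (x * T * m\<^sup>2 + 2 * (x * int r + y) * m))"
    unfolding residue_vectors_def by (rule prod_sum_PiE[symmetric]) auto
  finally show ?thesis .
qed

text \<open>Each of the t coordinates contributes one Gauss sum, and the quadratic sum over y that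
  remains contributes another, whence the power t + 1. The inverse of x has the same Legendre symbol
  as x.\<close>

lemma nonzero_frequency:
  assumes x: "\<not> b dvd x"
  shows "(\<Sum>y\<in>{0..<b}. \<Prod>r<t. \<Sum>m\<in>{0..<b}. e (x * T * m\<^sup>2 + 2 * (x * int r + y) * m)) =
    gauss ^ (t + 1) * of_int (\<eta> (- 1) * \<eta> T ^ t) * (of_int (\<eta> x) ^ (t + 1) * e (x * \<kappa>))"
proof -
  obtain x' where x': "[x' * x = 1] (mod b)" using inverse_exists[OF x] .
  define s where "s = x' * T'"
  have "[(x' * x) * (T' * T) = 1 * 1] (mod b)" by (rule cong_mult[OF x' T'])
  then have s: "[s * (x * T) = 1] (mod b)" by (simp add: s_def mult_ac)
  have ndx': "\<not> b dvd x'"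
  proof
    assume "b dvd x'"
    then have "b dvd x' * x" by simp
    then have "b dvd 1" using x' by (metis cong_dvd_iff cong_sym)
    then show False using b_ge_3 by simp
  qed
  have ndm: "\<not> b dvd - x'" using ndx' by simp
  have "\<eta> x' * \<eta> x = 1" using eta_cong[OF x'] by (simp add: eta_mult)
  then have ex': "\<eta> x' = \<eta> x" using eta_cases[of x'] eta_cases[of x] by auto
  have etam: "\<eta> (- x') = \<eta> (- 1) * \<eta> x" using eta_mult[of "- 1" x'] ex' by simp
  have "(\<Prod>r<t. \<Sum>m\<in>{0..<b}. e (x * T * m\<^sup>2 + 2 * (x * int r + y) * m)) =
     (of_int (\<eta> (x * T)) * gauss) ^ t * (e (x * \<kappa>) * e (- x' * (y + h * x * (T - 1))\<^sup>2))" for y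
  proof -
    have "(\<Prod>r<t. \<Sum>m\<in>{0..<b}. e (x * T * m\<^sup>2 + 2 * (x * int r + y) * m)) =
       (\<Prod>r<t. e (- (s * (x * int r + y)\<^sup>2)) * (of_int (\<eta> (x * T)) * gauss))"
      by (intro prod.cong refl complete_square s)
    also have "\<dots> = (\<Prod>r<t. e (- (s * (x * int r + y)\<^sup>2))) * (of_int (\<eta> (x * T)) * gauss) ^ t"
      by (simp add: prod.distrib)
    also have "(\<Prod>r<t. e (- (s * (x * int r + y)\<^sup>2))) = e (- (x' * T' * (\<Sum>r<t. (x * int r + y)\<^sup>2)))"
      unfolding s_def by (simp add: e_sum[symmetric] sum_negf sum_distrib_left)
    finally show ?thesis unfolding quadratic_exponent[OF x'] by (simp only: mult_ac)
  qed
  then have "(\<Sum>y\<in>{0..<b}. \<Prod>r<t. \<Sum>m\<in>{0..<b}. e (x * T * m\<^sup>2 + 2 * (x * int r + y) * m)) =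
    (of_int (\<eta> (x * T)) * gauss) ^ t * (e (x * \<kappa>) * (\<Sum>y\<in>{0..<b}. e (- x' * (y + h * x * (T - 1))\<^sup>2)))"
    by (simp only: sum_distrib_left)
  also have "(\<Sum>y\<in>{0..<b}. e (- x' * (y + h * x * (T - 1))\<^sup>2)) = (\<Sum>y\<in>{0..<b}. e (- x' * y\<^sup>2))"
    by (rule sum_residues_shift[of "\<lambda>y. e (- x' * y\<^sup>2)"]) (rule e_cong, intro cong_scalar_left cong_pow)
  also have "\<dots> = of_int (\<eta> (- 1) * \<eta> x) * gauss" using quadratic_gauss[OF ndm] etam by simp
  also have "(of_int (\<eta> (x * T)) * gauss) ^ t * (e (x * \<kappa>) * (of_int (\<eta> (- 1) * \<eta> x) * gauss)) =
    gauss ^ (t + 1) * of_int (\<eta> (- 1) * \<eta> T ^ t) * (of_int (\<eta> x) ^ (t + 1) * e (x * \<kappa>))"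
    by (simp add: eta_mult power_mult_distrib)
  finally show ?thesis .
qed

lemma zero_frequency:
  "(\<Sum>y\<in>{0..<b}. \<Prod>r<t. \<Sum>m\<in>{0..<b}. e (0 * T * m\<^sup>2 + 2 * (0 * int r + y) * m)) = of_int b ^ t"
proof -
  have "(\<Sum>y\<in>{0..<b}. \<Prod>r<t. \<Sum>m\<in>{0..<b}. e (0 * T * m\<^sup>2 + 2 * (0 * int r + y) * m)) =
    (\<Sum>y\<in>{0..<b}. if y = 0 then of_int b ^ t else 0)"
  proof (rule sum.cong[OF refl])
    fix y assume y: "y \<in> {0..<b}"
    then have "b dvd y \<longleftrightarrow> y = 0" using zdvd_not_zless[of y b] by force
    then show "(\<Prod>r<t. \<Sum>m\<in>{0..<b}. e (0 * T * m\<^sup>2 + 2 * (0 * int r + y) * m)) = (if y = 0 then of_int b ^ t else 0)"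
      using t by (simp add: sum_e dvd_2_mult_iff)
  qed
  then show ?thesis using b_pos by simp
qed

text \<open>Both conditions are detected by characters, with frequency x for the quadratic form and
  2 y for the sum; the factor 2, harmless for odd b, suits the completion of squares. The term x = 0
  gives b^t.\<close>

lemma count_solutions:
  "of_int (b\<^sup>2 * int (card {\<rho> \<in> residue_vectors t. b dvd sum \<rho> {..<t} \<and> b dvd qform t \<rho> - w})) =
     of_int b ^ t + gauss ^ (t + 1) * of_int (\<eta> (- 1) * \<eta> T ^ t) *
       (\<Sum>x\<in>{0..<b}. of_int (\<eta> x) ^ (t + 1) * e (x * (\<kappa> - w)))"
proof -
  let ?C = "gauss ^ (t + 1) * of_int (\<eta> (- 1) * \<eta> T ^ t)"
  let ?P = "\<lambda>x. \<Sum>y\<in>{0..<b}. \<Prod>r<t. \<Sum>m\<in>{0..<b}. e (x * T * m\<^sup>2 + 2 * (x * int r + y) * m)"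
  have "of_int (b\<^sup>2 * int (card {\<rho> \<in> residue_vectors t. b dvd sum \<rho> {..<t} \<and> b dvd qform t \<rho> - w})) =
     (\<Sum>\<rho>\<in>residue_vectors t. if b dvd sum \<rho> {..<t} \<and> b dvd qform t \<rho> - w then of_int (b\<^sup>2) else (0 :: complex))"
    using finite_residue_vectors[of t] by (simp add: sum.If_cases Int_def mult.commute)
  also have "\<dots> = (\<Sum>\<rho>\<in>residue_vectors t. \<Sum>x\<in>{0..<b}. \<Sum>y\<in>{0..<b}. e (x * (qform t \<rho> - w) + 2 * y * sum \<rho> {..<t}))"
  proof (rule sum.cong[OF refl])
    fix \<rho>
    have "(\<Sum>x\<in>{0..<b}. \<Sum>y\<in>{0..<b}. e (x * (qform t \<rho> - w) + 2 * y * sum \<rho> {..<t})) =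
      (\<Sum>x\<in>{0..<b}. e ((qform t \<rho> - w) * x)) * (\<Sum>y\<in>{0..<b}. e ((2 * sum \<rho> {..<t}) * y))"
      unfolding sum_product by (intro sum.cong refl) (simp add: e_add[symmetric] mult_ac)
    also have "\<dots> = (if b dvd sum \<rho> {..<t} \<and> b dvd qform t \<rho> - w then of_int (b\<^sup>2) else 0)"
      unfolding sum_e dvd_2_mult_iff by (simp add: power2_eq_square)
    finally show "(if b dvd sum \<rho> {..<t} \<and> b dvd qform t \<rho> - w then of_int (b\<^sup>2) else 0) =
      (\<Sum>x\<in>{0..<b}. \<Sum>y\<in>{0..<b}. e (x * (qform t \<rho> - w) + 2 * y * sum \<rho> {..<t}))" ..
  qed
  also have "\<dots> = (\<Sum>x\<in>{0..<b}. \<Sum>\<rho>\<in>residue_vectors t. \<Sum>y\<in>{0..<b}. e (x * (qform t \<rho> - w) + 2 * y * sum \<rho> {..<t}))"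
    by (rule sum.swap)
  also have "\<dots> = (\<Sum>x\<in>{0..<b}. \<Sum>y\<in>{0..<b}. \<Sum>\<rho>\<in>residue_vectors t. e (x * (qform t \<rho> - w) + 2 * y * sum \<rho> {..<t}))"
    by (intro sum.cong refl sum.swap)
  also have "\<dots> = (\<Sum>x\<in>{0..<b}. e (- (x * w)) * ?P x)"
    unfolding vector_sum unfolding sum_distrib_left ..
  also have "\<dots> = (\<Sum>x\<in>{0..<b}. (if x = 0 then of_int b ^ t else 0) + ?C * (of_int (\<eta> x) ^ (t + 1) * e (x * (\<kappa> - w))))"
  proof (rule sum.cong[OF refl])
    fix x assume x: "x \<in> {0..<b}"
    show "e (- (x * w)) * ?P x = (if x = 0 then of_int b ^ t else 0) + ?C * (of_int (\<eta> x) ^ (t + 1) * e (x * (\<kappa> - w)))"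
    proof (cases "x = 0")
      case True
      have "\<eta> 0 = 0" using eta_eq_0_iff by simp
      then show ?thesis unfolding True zero_frequency by simp
    next
      case False
      then have "\<not> b dvd x" using x zdvd_not_zless[of x b] by force
      moreover have "e (x * (\<kappa> - w)) = e (- (x * w)) * e (x * \<kappa>)"
        unfolding e_add[symmetric] by (simp add: algebra_simps)
      ultimately show ?thesis unfolding nonzero_frequency[OF \<open>\<not> b dvd x\<close>] using False by simp
    qed
  qed
  also have "\<dots> = of_int b ^ t + ?C * (\<Sum>x\<in>{0..<b}. of_int (\<eta> x) ^ (t + 1) * e (x * (\<kappa> - w)))"
    using b_pos by (simp add: sum.distrib sum_distrib_left)
  finally show ?thesis .
qed

text \<open>For even t the power t + 1 of eta is eta itself, so the sum over x is a twisted Gauss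
  sum and \<open>gauss\<close> occurs t + 2 times.\<close>

lemma count_solutions_even:
  assumes "even t" and ndT: "\<not> b dvd T"
  shows "b\<^sup>2 * int (card {\<rho> \<in> residue_vectors t. b dvd sum \<rho> {..<t} \<and> b dvd qform t \<rho> - w}) =
     b ^ t + (\<eta> (- 1) * b) ^ (t div 2 + 1) * (\<eta> (- 1) * \<eta> (\<kappa> - w))"
proof -
  have tt: "t = 2 * (t div 2)" using assms by simp
  have pe: "\<eta> x ^ (t + 1) = \<eta> x" for x
    using eta_cases[of x] assms by auto
  have T1: "\<eta> T ^ t = 1"
    using eta_square[OF ndT] tt power_mult[of "\<eta> T" 2 "t div 2"] by (simp add: power2_eq_square)
  have "gauss ^ (t + 1) * gauss = (gauss\<^sup>2) ^ (t div 2 + 1)"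
    unfolding power_mult[symmetric] by (subst tt) simp
  then have g: "gauss ^ (t + 1) * gauss = of_int ((\<eta> (- 1) * b) ^ (t div 2 + 1))"
    unfolding gauss_square by (simp only: of_int_power)
  have "(of_int (\<eta> x) :: complex) ^ (t + 1) = of_int (\<eta> x)" for x
    unfolding of_int_power[symmetric] pe ..
  then have s: "(\<Sum>x\<in>{0..<b}. of_int (\<eta> x) ^ (t + 1) * e (x * (\<kappa> - w))) = of_int (\<eta> (\<kappa> - w)) * gauss"
    by (simp only: twisted_gauss)
  have "of_int (b\<^sup>2 * int (card {\<rho> \<in> residue_vectors t. b dvd sum \<rho> {..<t} \<and> b dvd qform t \<rho> - w})) =
     of_int b ^ t + gauss ^ (t + 1) * of_int (\<eta> (- 1)) * (of_int (\<eta> (\<kappa> - w)) * gauss)"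
    unfolding count_solutions T1 s by simp
  also have "\<dots> = of_int b ^ t + (gauss ^ (t + 1) * gauss) * of_int (\<eta> (- 1) * \<eta> (\<kappa> - w))"
    by (simp add: mult_ac)
  also have "\<dots> = of_int (b ^ t + (\<eta> (- 1) * b) ^ (t div 2 + 1) * (\<eta> (- 1) * \<eta> (\<kappa> - w)))"
    unfolding g by simp
  finally show ?thesis by (simp only: of_int_eq_iff)
qed

text \<open>For odd t the power t + 1 of eta is 1 off x = 0, so the sum over x is a Ramanujan sum
  with value b - 1 or -1, and the exponent t + 1 of \<open>gauss\<close> is even.\<close>

lemma count_solutions_odd:
  assumes "odd t" and ndT: "\<not> b dvd T"
  shows "b\<^sup>2 * int (card {\<rho> \<in> residue_vectors t. b dvd sum \<rho> {..<t} \<and> b dvd qform t \<rho> - w}) =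
     b ^ t + (\<eta> (- 1) * b) ^ (t div 2 + 1) * (\<eta> (- 1) * \<eta> T * (if b dvd \<kappa> - w then b - 1 else - 1))"
proof -
  have tt: "t + 1 = 2 * (t div 2 + 1)" using assms(1) by presburger
  have pe: "\<eta> x ^ (t + 1) = (if b dvd x then 0 else 1)" for x
    using eta_cases[of x] eta_eq_0_iff[of x] assms by auto
  have T1: "\<eta> T ^ t = \<eta> T" using eta_cases[of T] assms t by auto
  have "gauss ^ (t + 1) = (gauss\<^sup>2) ^ (t div 2 + 1)"
    unfolding power_mult[symmetric] by (subst tt) simp
  then have g: "gauss ^ (t + 1) = of_int ((\<eta> (- 1) * b) ^ (t div 2 + 1))"
    unfolding gauss_square by (simp only: of_int_power)
  have "(\<Sum>x\<in>{0..<b}. of_int (\<eta> x) ^ (t + 1) * e (x * (\<kappa> - w))) = (\<Sum>x\<in>{0..<b}. e ((\<kappa> - w) * x) - (if x = 0 then 1 else 0))"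
  proof (rule sum.cong[OF refl])
    fix x assume x: "x \<in> {0..<b}"
    then have "b dvd x \<longleftrightarrow> x = 0" using zdvd_not_zless[of x b] by force
    then show "of_int (\<eta> x) ^ (t + 1) * e (x * (\<kappa> - w)) = e ((\<kappa> - w) * x) - (if x = 0 then 1 else 0)"
      unfolding of_int_power[symmetric] pe by (simp add: mult.commute)
  qed
  also have "\<dots> = of_int (if b dvd \<kappa> - w then b - 1 else - 1)"
    using b_pos by (simp add: sum_subtractf sum_e)
  finally have s: "(\<Sum>x\<in>{0..<b}. of_int (\<eta> x) ^ (t + 1) * e (x * (\<kappa> - w))) = of_int (if b dvd \<kappa> - w then b - 1 else - 1)" .
  have "of_int (b\<^sup>2 * int (card {\<rho> \<in> residue_vectors t. b dvd sum \<rho> {..<t} \<and> b dvd qform t \<rho> - w})) =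
     (of_int (b ^ t + (\<eta> (- 1) * b) ^ (t div 2 + 1) * (\<eta> (- 1) * \<eta> T * (if b dvd \<kappa> - w then b - 1 else - 1))) :: complex)"
    unfolding count_solutions T1 s g by (simp only: of_int_add of_int_mult of_int_power mult.assoc)
  then show ?thesis by (simp only: of_int_eq_iff)
qed

end

end

subsection \<open>The main theorem\<close>

lemma core_sum_fibres:
  assumes "finite J"
  shows "core_sum t n {c. \<phi> c \<in> J} = (\<Sum>j\<in>J. core_sum t n {c. \<phi> c = j})"
proof -
  have "(\<Sum>j\<in>J. \<Sum>c\<in>{c \<in> small_cores t n \<inter> {c. \<phi> c \<in> J}. \<phi> c = j}. core_weight t n c) =
    (\<Sum>c\<in>small_cores t n \<inter> {c. \<phi> c \<in> J}. core_weight t n c)"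
    by (rule sum.group) (use finite_small_cores assms in auto)
  moreover have "{c \<in> small_cores t n \<inter> {c. \<phi> c \<in> J}. \<phi> c = j} = small_cores t n \<inter> {c. \<phi> c = j}" if "j \<in> J" for j
    using that by auto
  ultimately show ?thesis unfolding core_sum_def by (simp cong: sum.cong_simp)
qed

lemma core_sum_cong:
  assumes "\<And>c. c \<in> small_cores t n \<Longrightarrow> core_weight t n c \<noteq> 0 \<Longrightarrow> c \<in> X \<longleftrightarrow> c \<in> Y"
  shows "core_sum t n X = core_sum t n Y"
proof -
  have fin: "finite (small_cores t n)" by (rule finite_small_cores)
  have "core_sum t n Z = (\<Sum>c\<in>{c \<in> small_cores t n \<inter> Z. core_weight t n c \<noteq> 0}. core_weight t n c)" for Z
    unfolding core_sum_def by (rule sum.mono_neutral_right) (use fin in auto)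
  moreover have "{c \<in> small_cores t n \<inter> X. core_weight t n c \<noteq> 0} = {c \<in> small_cores t n \<inter> Y. core_weight t n c \<noteq> 0}"
    using assms by auto
  ultimately show ?thesis by simp
qed

lemma core_sum_restrict: "core_sum t n (X \<inter> small_cores t n) = core_sum t n X"
  by (rule core_sum_cong) auto

lemma core_weight_nonzeroD:
  assumes "core_weight t n c \<noteq> 0" "t > 0"
  obtains w where "int n - core_size t c = int t * int w" "nat ((int n - core_size t c) div int t) = w"
proof -
  have d: "int t dvd int n - core_size t c" "core_size t c \<le> int n"
    using assms by (auto simp: core_weight_def split: if_splits)
  obtain k where k: "int n - core_size t c = int t * k" using d(1) by blast
  have "0 \<le> int t * k" using d k by linarith
  then have "k \<ge> 0" using assms by (simp add: zero_le_mult_iff)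
  then show thesis using that[of "nat k"] k assms by simp
qed

text \<open>Asymptotic equivalence counts 0/0 as 1, so zeros of gamma are admissible if p vanishes
  there exactly. Elsewhere division by gamma >= delta turns the additive error into a relative
  one.\<close>

lemma asymp_equiv_of_proportion:
  fixes p q g \<gamma> :: "nat \<Rightarrow> real"
  assumes q: "\<And>n. q n > 0" and g: "\<And>n. n > 0 \<Longrightarrow> g n \<noteq> 0" and qg: "(\<lambda>n. q n / g n) \<longlonglongrightarrow> 1"
    and diff: "(\<lambda>n. p n / q n - \<gamma> n) \<longlonglongrightarrow> 0" and \<delta>: "\<delta> > 0"
    and \<gamma>: "\<And>n. \<gamma> n = 0 \<and> p n = 0 \<or> \<delta> \<le> \<gamma> n"
  shows "(\<lambda>n. complex_of_real (p n)) \<sim>[sequentially] (\<lambda>n. of_real (\<gamma> n) * of_real (g n))"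
proof -
  define F where "F = (\<lambda>n. if \<gamma> n = 0 then 1 else p n / q n / \<gamma> n)"
  have "F \<longlonglongrightarrow> 1"
  proof (rule LIM_zero_cancel, rule Lim_null_comparison)
    show "\<forall>\<^sub>F n in sequentially. norm (F n - 1) \<le> \<bar>p n / q n - \<gamma> n\<bar> / \<delta>"
    proof (rule always_eventually, rule allI)
      fix n
      show "norm (F n - 1) \<le> \<bar>p n / q n - \<gamma> n\<bar> / \<delta>"
      proof (cases "\<gamma> n = 0")
        case False
        then have d: "\<delta> \<le> \<gamma> n" using \<gamma>[of n] by simp
        have "F n - 1 = (p n / q n - \<gamma> n) / \<gamma> n" using False by (simp add: F_def diff_divide_distrib)
        then have "norm (F n - 1) = \<bar>p n / q n - \<gamma> n\<bar> / \<gamma> n" using d \<delta> by simp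
        also have "\<dots> \<le> \<bar>p n / q n - \<gamma> n\<bar> / \<delta>" using d \<delta> by (intro divide_left_mono mult_pos_pos) auto
        finally show ?thesis .
      qed (use \<delta> in \<open>simp add: F_def\<close>)
    qed
    have "(\<lambda>n. \<bar>p n / q n - \<gamma> n\<bar> / \<delta>) \<longlonglongrightarrow> \<bar>0\<bar> / \<delta>" using \<delta> by (intro tendsto_intros diff) auto
    then show "(\<lambda>n. \<bar>p n / q n - \<gamma> n\<bar> / \<delta>) \<longlonglongrightarrow> 0" by simp
  qed
  then have "(\<lambda>n. F n * (q n / g n)) \<longlonglongrightarrow> 1 * 1" using qg by (rule tendsto_mult)
  then have lim: "(\<lambda>n. \<bar>F n * (q n / g n) - 1\<bar>) \<longlonglongrightarrow> 0"
    by (intro tendsto_rabs_zero LIM_zero) simp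
  show ?thesis unfolding asymp_equiv_def
  proof (rule LIM_zero_cancel, rule Lim_null_comparison[OF _ lim])
    show "\<forall>\<^sub>F n in sequentially. norm ((if complex_of_real (p n) = 0 \<and> of_real (\<gamma> n) * of_real (g n) = (0 :: complex) then 1
        else complex_of_real (p n) / (of_real (\<gamma> n) * of_real (g n))) - 1) \<le> \<bar>F n * (q n / g n) - 1\<bar>"
      using eventually_gt_at_top[of 0]
    proof eventually_elim
      case (elim n)
      show ?case
      proof (cases "\<gamma> n = 0")
        case True
        then show ?thesis using \<gamma>[of n] \<delta> by auto
      next
        case False
        have "F n * (q n / g n) = p n / (\<gamma> n * g n)" using False q[of n] by (simp add: F_def)
        then have "complex_of_real (p n) / (of_real (\<gamma> n) * of_real (g n)) - 1 = of_real (F n * (q n / g n) - 1)"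
          by simp
        then have "norm (complex_of_real (p n) / (of_real (\<gamma> n) * of_real (g n)) - 1) = \<bar>F n * (q n / g n) - 1\<bar>"
          by (simp only: norm_of_real)
        then show ?thesis using False g[OF elim] by (auto simp: of_real_eq_0_iff)
      qed
    qed
  qed
qed

lemma npart_asymp:
  "(\<lambda>n. real (npart n) / (exp (pi * sqrt (2 * real n / 3)) / (4 * sqrt 3 * real n))) \<longlonglongrightarrow> 1"
proof -
  have "(\<lambda>n. 4 * sqrt 3 * (real (npart n) * exp (- (pi * sqrt (2 * real n / 3))) * real n)) \<longlonglongrightarrow> 4 * sqrt 3 * (1 / (4 * sqrt 3))"
    by (intro tendsto_mult tendsto_const hardy_ramanujan)
  then show ?thesis by (simp add: exp_minus field_simps)
qed

lemma p_hooks_core_sum: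
  assumes "t > 0"
  shows "p_hooks (int t) a b n = core_sum t n {c. [int (nat ((int n - core_size t c) div int t)) = a] (mod b)}"
  unfolding p_hooks_def by (rule card_hook_pred_core_sum[OF assms, of n "\<lambda>w. [int w = a] (mod b)"])

section \<open>Proportions of the residue classes\<close>

context odd_prime
begin

text \<open>The translation moves t k units of charge from runner 0 to runner 1. As b divides t and
  is odd, all terms of \<open>shift_size\<close> except r v(r) vanish modulo b, even the halved one,
  and these add up to k.\<close>

lemma dvd_shift_size:
  fixes k :: int
  assumes "b dvd int t" "1 < t"
  defines "v \<equiv> \<lambda>r. if r = 0 then - k else if r = (1::nat) then k else 0"
  shows "sum v {..<t} = 0" "[shift_size t v c = k] (mod b)"
proof -
  have sp: "sum f {..<t} = f 0 + f 1" if "\<And>r. r \<noteq> 0 \<Longrightarrow> r \<noteq> 1 \<Longrightarrow> f r = 0" for f :: "nat \<Rightarrow> int"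
  proof -
    have "sum f {..<t} = sum f {0, 1}" using assms(2) that by (intro sum.mono_neutral_right) auto
    then show ?thesis by simp
  qed
  show "sum v {..<t} = 0" by (subst sp) (auto simp: v_def)
  have "[shift_size t v c = (\<Sum>r<t. int r * v r)] (mod b)"
    unfolding shift_size_def
  proof (rule cong_sum)
    fix r
    have 1: "b dvd int t * v r" using assms(1) by simp
    have "2 * (x * (x - 1) div 2) = x * (x - 1)" for x :: int by simp
    from this[of "int t * v r"] have "b dvd 2 * (int t * v r * (int t * v r - 1) div 2)" using 1 by simp
    then have "b dvd int t * v r * (int t * v r - 1) div 2" by (simp only: dvd_2_mult_iff)
    then show "[c r * (int t * v r) + int t * v r * (int t * v r - 1) div 2 + int r * v r = int r * v r] (mod b)"
      using 1 by (simp add: cong_iff_dvd_diff)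
  qed
  moreover have "(\<Sum>r<t. int r * v r) = k" by (subst sp) (auto simp: v_def)
  ultimately show "[shift_size t v c = k] (mod b)" by simp
qed

lemma proportion_dvd:
  assumes t: "1 < t" and bt: "b dvd int t" and a: "0 \<le> a" "a < b"
  shows "(\<lambda>n. real (p_hooks (int t) a b n) / real (npart n)) \<longlonglongrightarrow> 1 / of_int b"
proof -
  have t0: "t > 0" using t by simp
  define \<phi> where "\<phi> = (\<lambda>n c. int (nat ((int n - core_size t c) div int t)) mod b)"
  define A where "A = (\<lambda>j n. real (core_sum t n {c. \<phi> n c = j}))"
  have "(\<lambda>n. A a n / real (npart n)) \<longlonglongrightarrow> 1 / real (card {0..<b})"
  proof (rule equidistribution)
    show "(\<Sum>j\<in>{0..<b}. A j n) = real (npart n)" for n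
    proof -
      have "{c. \<phi> n c \<in> {0..<b}} = UNIV" using b_pos by (auto simp: \<phi>_def)
      then show ?thesis unfolding npart_core_sum[OF t0] A_def
        using core_sum_fibres[of "{0..<b}" t n "\<phi> n"] by simp
    qed
    fix i j :: int and \<epsilon> :: real assume ij: "i \<in> {0..<b}" "j \<in> {0..<b}" "\<epsilon> > 0"
    define k where "k = i - j"
    define v where "v = (\<lambda>r. if r = 0 then - k else if r = (1::nat) then k else 0)"
    note v = dvd_shift_size[OF bt t, where k = k, folded v_def]
    show "\<forall>\<^sub>F n in sequentially. A i n \<le> A j n + \<epsilon> * real (npart n)"
      using core_sum_shift[OF t0 v(1) ij(3)]
    proof eventually_elim
      case (elim n)
      \<comment> \<open>The translation lowers w by \<open>shift_size\<close>, so class i goes to i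
        - k = j modulo b. Restricting to small cores guarantees n >= core size for the original
        vector, so that \<open>nat\<close> truncates nothing.\<close>
      have "core_sum t n (shift_core t v ` ({c. \<phi> n c = i} \<inter> small_cores t n)) \<le> core_sum t n {c. \<phi> n c = j}"
      proof (rule core_sum_mono, rule subsetI)
        fix d assume "d \<in> shift_core t v ` ({c. \<phi> n c = i} \<inter> small_cores t n) \<inter> {c. core_weight t n c \<noteq> 0}"
        then obtain c where d: "d = shift_core t v c"
          and c: "i = \<phi> n c" "c \<in> small_cores t n" "core_weight t n (shift_core t v c) \<noteq> 0"
          by blast
        obtain w' where w': "int n - core_size t (shift_core t v c) = int t * int w'"
            "nat ((int n - core_size t (shift_core t v c)) div int t) = w'"
          using core_weight_nonzeroD[OF c(3) t0] .
        have e: "int n - core_size t c = int t * (int w' + shift_size t v c)"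
          using w'(1) unfolding core_size_shift by (simp add: algebra_simps)
        moreover have "0 \<le> int n - core_size t c" using c(2) by (simp add: small_cores_def)
        ultimately have "0 \<le> int w' + shift_size t v c" using t0 by (simp add: zero_le_mult_iff)
        then have "int (nat ((int n - core_size t c) div int t)) = int w' + shift_size t v c"
          unfolding e using t0 by simp
        then have "[i = int w' + shift_size t v c] (mod b)" using c(1) by (simp add: \<phi>_def cong_def)
        moreover have "[int w' + shift_size t v c = int w' + k] (mod b)" by (intro cong_add cong_refl v(2))
        ultimately have "[i = int w' + (i - j)] (mod b)" unfolding k_def using cong_trans by blast
        then have "[int w' = j] (mod b)" by (simp add: cong_iff_dvd_diff dvd_diff_commute algebra_simps)
        then have "int w' mod b = j" using ij by (simp add: cong_def)
        then have "\<phi> n (shift_core t v c) = j" unfolding \<phi>_def w'(2) .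
        then show "d \<in> {c. \<phi> n c = j}" unfolding d by simp
      qed
      then have "real (core_sum t n (shift_core t v ` ({c. \<phi> n c = i} \<inter> small_cores t n))) \<le> A j n"
        by (simp add: A_def)
      moreover have "A i n = real (core_sum t n ({c. \<phi> n c = i} \<inter> small_cores t n))"
        by (simp only: A_def core_sum_restrict)
      moreover have "real (core_sum t n ({c. \<phi> n c = i} \<inter> small_cores t n)) \<le>
        real (core_sum t n (shift_core t v ` ({c. \<phi> n c = i} \<inter> small_cores t n))) + \<epsilon> * real (npart n)"
        using elim by blast
      ultimately show ?case by linarith
    qed
  qed (use a npart_pos in auto)
  moreover have "A a n = real (p_hooks (int t) a b n)" for n
    unfolding p_hooks_core_sum[OF t0] A_def \<phi>_def using a by (simp add: cong_def)
  ultimately show ?thesis using b_pos by simp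
qed

lemma not_dvd_imp_inverse_square:
  assumes "\<not> b dvd x" obtains x' where "[x' * x = 1] (mod b\<^sup>2)"
proof -
  have "coprime x (b\<^sup>2)" using prime_imp_coprime[OF prime_b assms] by (simp add: coprime_commute)
  then obtain x' where "[x * x' = 1] (mod b\<^sup>2)" using cong_solve_coprime_int by blast
  then show thesis using that[of x'] by (simp add: mult.commute)
qed

definition charge_residues :: "nat \<Rightarrow> (nat \<Rightarrow> int) set" where
  "charge_residues t = {\<rho> \<in> residue_vectors t. b dvd sum \<rho> {..<t}}"

definition solutions :: "nat \<Rightarrow> int \<Rightarrow> (nat \<Rightarrow> int) set" where
  "solutions t w = {\<rho> \<in> residue_vectors t. b dvd sum \<rho> {..<t} \<and> b dvd qform t \<rho> - w}"

lemma finite_charge_residues: "finite (charge_residues t)" and finite_solutions: "finite (solutions t w)"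
  and solutions_subset: "solutions t w \<subseteq> charge_residues t"
  using finite_residue_vectors[of t] by (auto simp: charge_residues_def solutions_def)

definition residue :: "nat \<Rightarrow> (nat \<Rightarrow> int) \<Rightarrow> (nat \<Rightarrow> int)" where
  "residue t c = (\<lambda>r\<in>{..<t}. c r mod b)"

lemma residue_in_charge_residues: "c \<in> charge_vectors t \<Longrightarrow> residue t c \<in> charge_residues t"
proof -
  assume c: "c \<in> charge_vectors t"
  have "[sum (residue t c) {..<t} = sum c {..<t}] (mod b)"
    by (rule cong_sum) (simp add: residue_def)
  then have "b dvd sum (residue t c) {..<t}" using c by (simp add: charge_vectors_def cong_0_iff)
  then show ?thesis using b_pos by (auto simp: charge_residues_def residue_vectors_def residue_def)
qed

lemma charge_residues_PiE: "\<rho> \<in> charge_residues t \<Longrightarrow> \<rho> \<in> {..<t} \<rightarrow>\<^sub>E {0..<b}"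
  by (simp add: charge_residues_def residue_vectors_def)

lemma residue_PiE: "residue t c \<in> {..<t} \<rightarrow>\<^sub>E {0..<b}"
  unfolding residue_def using b_pos by (intro restrict_PiE_iff[THEN iffD2]) simp

lemma residue_class_proportion:
  assumes t: "t > 0" and bt: "\<not> b dvd int t" and \<rho>: "\<rho> \<in> charge_residues t"
  shows "(\<lambda>n. real (core_sum t n {c. residue t c = \<rho>}) / real (npart n)) \<longlonglongrightarrow> 1 / real (card (charge_residues t))"
proof (rule equidistribution[where a = "\<lambda>\<rho> n. real (core_sum t n {c. residue t c = \<rho>})"])
  show "(\<Sum>\<rho>\<in>charge_residues t. real (core_sum t n {c. residue t c = \<rho>})) = real (npart n)" for n
  proof -
    have "core_sum t n UNIV = core_sum t n {c. residue t c \<in> charge_residues t}"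
      by (rule core_sum_cong) (auto simp: small_cores_def residue_in_charge_residues)
    then show ?thesis unfolding npart_core_sum[OF t]
      by (simp add: core_sum_fibres[OF finite_charge_residues])
  qed
  fix \<rho> \<rho>' :: "nat \<Rightarrow> int" and \<epsilon> :: real
  assume r: "\<rho> \<in> charge_residues t" "\<rho>' \<in> charge_residues t" "\<epsilon> > 0"
  obtain T' where T': "[T' * int t = 1] (mod b)" using inverse_exists[OF bt] .
  have "b dvd (\<Sum>r<t. \<rho>' r - \<rho> r)" using r by (simp add: sum_subtractf charge_residues_def)
  then obtain m where m: "(\<Sum>r<t. \<rho>' r - \<rho> r) = b * m" by blast
  \<comment> \<open>As T' inverts t modulo b, t v is congruent to the difference of the two residue
    vectors. The multiple of b subtracted at coordinate 0 makes the sum of v exactly zero, as charge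
    vectors demand.\<close>
  define v where "v = (\<lambda>r. T' * (\<rho>' r - \<rho> r) - (if r = 0 then b * (T' * m) else 0))"
  have v0: "sum v {..<t} = 0"
    using t m by (simp add: v_def sum_subtractf flip: sum_distrib_left)
  show "\<forall>\<^sub>F n in sequentially. real (core_sum t n {c. residue t c = \<rho>}) \<le> real (core_sum t n {c. residue t c = \<rho>'}) + \<epsilon> * real (npart n)"
    using core_sum_shift[OF t v0 r(3)]
  proof eventually_elim
    case (elim n)
    have "shift_core t v ` {c. residue t c = \<rho>} \<subseteq> {c. residue t c = \<rho>'}"
    proof safe
      fix c assume c: "\<rho> = residue t c"
      show "residue t (shift_core t v c) = \<rho>'"
      proof (rule PiE_ext[of _ "{..<t}" "\<lambda>_. {0..<b}"])
        fix s assume s: "s \<in> {..<t}"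
        have 1: "[c s = \<rho> s] (mod b)" using s unfolding c by (simp add: residue_def cong_def)
        have "b dvd T' * int t - 1" using T' by (simp add: cong_iff_dvd_diff)
        then have "b dvd (T' * int t - 1) * (\<rho>' s - \<rho> s) - b * (if s = 0 then int t * (T' * m) else 0)" by simp
        also have "(T' * int t - 1) * (\<rho>' s - \<rho> s) - b * (if s = 0 then int t * (T' * m) else 0) = int t * v s - (\<rho>' s - \<rho> s)"
          by (simp add: v_def algebra_simps)
        finally have 2: "[int t * v s = \<rho>' s - \<rho> s] (mod b)" by (simp add: cong_iff_dvd_diff)
        have "[c s + int t * v s = \<rho> s + (\<rho>' s - \<rho> s)] (mod b)" using 1 2 by (rule cong_add)
        moreover have "\<rho>' s \<in> {0..<b}" using PiE_mem[OF charge_residues_PiE[OF r(2)] s] .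
        ultimately have "(c s + int t * v s) mod b = \<rho>' s" by (simp add: cong_def)
        moreover have "residue t (shift_core t v c) s = (c s + int t * v s) mod b"
          using s by (simp add: residue_def shift_core_def)
        ultimately show "residue t (shift_core t v c) s = \<rho>' s" by simp
      qed (rule residue_PiE, rule charge_residues_PiE[OF r(2)])
    qed
    then have "core_sum t n (shift_core t v ` {c. residue t c = \<rho>}) \<le> core_sum t n {c. residue t c = \<rho>'}"
      by (intro core_sum_mono) auto
    then have "real (core_sum t n (shift_core t v ` {c. residue t c = \<rho>})) \<le> real (core_sum t n {c. residue t c = \<rho>'})" by simp
    moreover have "real (core_sum t n {c. residue t c = \<rho>}) \<le> real (core_sum t n (shift_core t v ` {c. residue t c = \<rho>})) + \<epsilon> * real (npart n)"
      using elim by blast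
    ultimately show ?case by linarith
  qed
qed (use \<rho> finite_charge_residues npart_pos in auto)

text \<open>Multiplying w = a by 2 t, a unit modulo b, turns the hook condition into a congruence
  for the quadratic form of the residues. It is an exact identity for each n, so without solutions
  the count is 0.\<close>

lemma p_hooks_solutions:
  assumes t: "t > 0" and bt: "\<not> b dvd int t"
  shows "p_hooks (int t) a b n = (\<Sum>\<rho>\<in>solutions t (2 * (int n - int t * a)). core_sum t n {c. residue t c = \<rho>})"
proof -
  have "p_hooks (int t) a b n = core_sum t n {c. residue t c \<in> solutions t (2 * (int n - int t * a))}"
    unfolding p_hooks_core_sum[OF t]
  proof (rule core_sum_cong)
    fix c assume c: "c \<in> small_cores t n" "core_weight t n c \<noteq> 0"
    obtain w where w: "int n - core_size t c = int t * int w" "nat ((int n - core_size t c) div int t) = w"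
      using core_weight_nonzeroD[OF c(2) t] .
    have ch: "c \<in> charge_vectors t" using c by (simp add: small_cores_def)
    have "2 * core_size t c = qform t c - int t * sum c {..<t}"
      unfolding two_core_size qform_def sum_distrib_left sum_subtractf[symmetric]
      by (intro sum.cong refl) (simp add: power2_eq_square algebra_simps)
    then have q: "qform t c = 2 * core_size t c" using ch by (simp add: charge_vectors_def)
    have qr: "[qform t (residue t c) = qform t c] (mod b)"
      unfolding qform_def
      by (intro cong_sum cong_add cong_mult cong_pow cong_refl) (auto simp: residue_def)
    have "[int w = a] (mod b) \<longleftrightarrow> b dvd int t * (int w - a)"
      using prime_dvd_mult_iff[OF prime_b] bt by (simp add: cong_iff_dvd_diff)
    also have "int t * (int w - a) = (int n - core_size t c) - int t * a" using w(1) by (simp add: algebra_simps)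
    also have "b dvd \<dots> \<longleftrightarrow> b dvd 2 * ((int n - core_size t c) - int t * a)" by (simp only: dvd_2_mult_iff)
    also have "2 * ((int n - core_size t c) - int t * a) = - (qform t c - 2 * (int n - int t * a))" using q by (simp add: algebra_simps)
    also have "b dvd \<dots> \<longleftrightarrow> [qform t c = 2 * (int n - int t * a)] (mod b)" by (simp only: dvd_minus_iff cong_iff_dvd_diff)
    also have "\<dots> \<longleftrightarrow> [qform t (residue t c) = 2 * (int n - int t * a)] (mod b)"
      using qr cong_sym cong_trans by blast
    also have "\<dots> \<longleftrightarrow> residue t c \<in> solutions t (2 * (int n - int t * a))"
      using residue_in_charge_residues[OF ch] by (simp add: solutions_def charge_residues_def cong_iff_dvd_diff)
    finally show "c \<in> {c. [int (nat ((int n - core_size t c) div int t)) = a] (mod b)} \<longleftrightarrow>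
       c \<in> {c. residue t c \<in> solutions t (2 * (int n - int t * a))}"
      unfolding w(2)[symmetric] by simp
  qed
  then show ?thesis by (simp only: core_sum_fibres[OF finite_solutions])
qed

text \<open>The solution set varies with n, so the error is bounded by the sum of the errors of all
  residue classes, a fixed finite family.\<close>

lemma proportion_not_dvd:
  assumes t: "t > 0" and bt: "\<not> b dvd int t"
  shows "(\<lambda>n. real (p_hooks (int t) a b n) / real (npart n) -
     real (card (solutions t (2 * (int n - int t * a)))) / real (card (charge_residues t))) \<longlonglongrightarrow> 0"
proof (rule Lim_null_comparison)
  let ?R = "\<lambda>\<rho> n. real (core_sum t n {c. residue t c = \<rho>}) / real (npart n) - 1 / real (card (charge_residues t))"
  show "\<forall>\<^sub>F n in sequentially. norm (real (p_hooks (int t) a b n) / real (npart n) -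
     real (card (solutions t (2 * (int n - int t * a)))) / real (card (charge_residues t))) \<le> (\<Sum>\<rho>\<in>charge_residues t. \<bar>?R \<rho> n\<bar>)"
  proof (rule always_eventually, rule allI)
    fix n
    let ?S = "solutions t (2 * (int n - int t * a))"
    have "real (p_hooks (int t) a b n) / real (npart n) - real (card ?S) / real (card (charge_residues t)) = (\<Sum>\<rho>\<in>?S. ?R \<rho> n)"
      unfolding p_hooks_solutions[OF t bt] by (simp add: sum_subtractf sum_divide_distrib)
    also have "norm \<dots> \<le> (\<Sum>\<rho>\<in>?S. \<bar>?R \<rho> n\<bar>)" unfolding real_norm_def by (rule sum_abs)
    also have "\<dots> \<le> (\<Sum>\<rho>\<in>charge_residues t. \<bar>?R \<rho> n\<bar>)"
      by (rule sum_mono2[OF finite_charge_residues solutions_subset]) simp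
    finally show "norm (real (p_hooks (int t) a b n) / real (npart n) - real (card ?S) / real (card (charge_residues t)))
      \<le> (\<Sum>\<rho>\<in>charge_residues t. \<bar>?R \<rho> n\<bar>)" .
  qed
  have "(\<lambda>n. \<Sum>\<rho>\<in>charge_residues t. \<bar>?R \<rho> n\<bar>) \<longlonglongrightarrow> (\<Sum>\<rho>\<in>charge_residues t. 0)"
    by (intro tendsto_sum tendsto_rabs_zero LIM_zero residue_class_proportion t bt)
  then show "(\<lambda>n. \<Sum>\<rho>\<in>charge_residues t. \<bar>?R \<rho> n\<bar>) \<longlonglongrightarrow> 0" by simp
qed

text \<open>For b > 3 the number 12 is a unit; for b = 3 it absorbs a single factor 3 and the other
  one remains.\<close>

lemma square_dvd_12_mult:
  assumes "b\<^sup>2 dvd 12 * x" shows "b dvd x"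
proof (rule ccontr)
  assume "\<not> b dvd x"
  then have "coprime (b\<^sup>2) x" using prime_imp_coprime[OF prime_b] by simp
  then have d: "b\<^sup>2 dvd 12" using assms by (simp add: coprime_dvd_mult_left_iff)
  then have "b\<^sup>2 \<le> 12" by (rule zdvd_imp_le) simp
  moreover have "4\<^sup>2 \<le> b\<^sup>2" if "b \<ge> 4" using that by (intro power_mono) auto
  ultimately have "b = 3" using b_ge_3 by force
  then show False using d by simp
qed

text \<open>Multiplied by 12, the difference of the two sides is a polynomial expression divisible
  by b^2. Inverses modulo b^2 are taken because 12 is not invertible for b = 3; after division by 12
  at least one factor b survives.\<close>

lemma completed_constant:
  assumes bt: "\<not> b dvd int t" and h: "2 * h = b\<^sup>2 + 1" and T': "[T' * int t = 1] (mod b\<^sup>2)"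
  shows "[h\<^sup>2 * (int t - 1)\<^sup>2 - T' * (\<Sum>r<t. (int r)\<^sup>2) = 2 * ((1 - (int t)\<^sup>2) * (1 - b\<^sup>2) div 24)] (mod b)"
proof -
  define T where "T = int t"
  define S where "S = (\<Sum>r<t. (int r)\<^sup>2)"
  define H where "H = (1 - T\<^sup>2) * (1 - b\<^sup>2) div 24"
  have "24 dvd (1 - T\<^sup>2) * (1 - b\<^sup>2)" using hook_shift_exact[OF prime_b odd_b bt] by (simp add: T_def)
  then have H: "24 * H = (1 - T\<^sup>2) * (1 - b\<^sup>2)" by (simp add: H_def)
  have S: "6 * S = (T - 1) * T * (2 * T - 1)"
    unfolding S_def T_def by (induction t) (auto simp: algebra_simps power2_eq_square)
  obtain j where j: "T' * T = 1 + b\<^sup>2 * j" using T' by (metis T_def add.commute cong_iff_lin cong_sym)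
  have "12 * (h\<^sup>2 * (T - 1)\<^sup>2 - T' * S - 2 * H) = 3 * (2 * h)\<^sup>2 * (T - 1)\<^sup>2 - 2 * T' * (6 * S) - 24 * H"
    by (simp add: power2_eq_square algebra_simps)
  also have "\<dots> = 3 * (b\<^sup>2 + 1)\<^sup>2 * (T - 1)\<^sup>2 - 2 * (T' * T) * ((T - 1) * (2 * T - 1)) - (1 - T\<^sup>2) * (1 - b\<^sup>2)"
    unfolding h S H by (simp add: algebra_simps)
  also have "\<dots> = b\<^sup>2 * (3 * (b\<^sup>2 + 2) * (T - 1)\<^sup>2 - 2 * j * ((T - 1) * (2 * T - 1)) + (1 - T\<^sup>2))"
    unfolding j by (simp add: power2_eq_square algebra_simps)
  finally have "b\<^sup>2 dvd 12 * (h\<^sup>2 * (T - 1)\<^sup>2 - T' * S - 2 * H)" by simp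
  then have "b dvd h\<^sup>2 * (T - 1)\<^sup>2 - T' * S - 2 * H" by (rule square_dvd_12_mult)
  then show ?thesis by (simp add: cong_iff_dvd_diff T_def S_def H_def)
qed

lemma neg_one_powi: "(- 1 :: complex) powi k = (if even k then 1 else - 1)"
  by (simp add: power_int_minus_left)

lemma i_powi_double: "\<i> powi (2 * k) = (if even k then 1 else - 1)"
proof -
  have "\<i> powi (2 * k) = (\<i> powi 2) powi k" by (simp add: power_int_mult)
  also have "\<i> powi 2 = - 1" by (simp add: power_int_def)
  finally show ?thesis by (simp add: neg_one_powi)
qed

lemma i_powi_pred: "\<i> powi (k - 1) * \<i> = \<i> powi k"
  using power_int_add_1[of \<i> "k - 1"] by simp

lemma half_double: "2 * x div 2 = (x :: int)"
  by simp

text \<open>Here t = 2 m. With b = 8 k + r the exponent of i becomes even, once the factor i of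
  \<open>eps\<close> is absorbed for r = 3 and r = 7, and the parity of its half depends on r and m
  only. The result is matched with the values of eta at -1 and 2.\<close>

lemma even_sign:
  "\<i> powi ((1 - 2 * int m) * (b - 1) div 2) * eps b = of_int (\<eta> (- 1) ^ m * \<eta> 2)"
proof -
  define k where "k = b div 8"
  have bk: "b = 8 * k + b mod 8" by (simp add: k_def)
  have "b mod 8 = 1 \<or> b mod 8 = 3 \<or> b mod 8 = 5 \<or> b mod 8 = 7" using odd_b by presburger
  then show ?thesis
  proof (elim disjE)
    assume r: "b mod 8 = 1"
    then have b: "b = 8 * k + 1" using bk by simp
    have "(1 - 2 * int m) * (b - 1) = 2 * (2 * (2 * k * (1 - 2 * int m)))" by (subst b) (simp add: algebra_simps)
    then have "(1 - 2 * int m) * (b - 1) div 2 = 2 * (2 * k * (1 - 2 * int m))" by (simp only: half_double)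
    moreover have "b mod 4 = 1" using b by presburger
    ultimately show ?thesis using r by (simp only: i_powi_double) (simp add: eta_minus_1 eta_2 eps_def cong_def)
  next
    assume r: "b mod 8 = 3"
    then have b: "b = 8 * k + 3" using bk by simp
    have m4: "b mod 4 = 3" using b by presburger
    have "(1 - 2 * int m) * (b - 1) = 2 * ((1 - 2 * int m) * (4 * k + 1))" by (subst b) (simp add: algebra_simps)
    then have "(1 - 2 * int m) * (b - 1) div 2 = (1 - 2 * int m) * (4 * k + 1)" by (simp only: half_double)
    also have "\<dots> = 2 * (2 * k * (1 - 2 * int m) + 1 - int m) - 1" by (simp add: algebra_simps)
    finally have "\<i> powi ((1 - 2 * int m) * (b - 1) div 2) * \<i> = \<i> powi (2 * (2 * k * (1 - 2 * int m) + 1 - int m))"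
      by (simp only: i_powi_pred)
    then show ?thesis using r m4 unfolding i_powi_double
      by (simp add: eta_minus_1 eta_2 eps_def cong_def uminus_power_if)
  next
    assume r: "b mod 8 = 5"
    then have b: "b = 8 * k + 5" using bk by simp
    have "(1 - 2 * int m) * (b - 1) = 2 * (2 * ((1 - 2 * int m) * (2 * k + 1)))" by (subst b) (simp add: algebra_simps)
    then have "(1 - 2 * int m) * (b - 1) div 2 = 2 * ((1 - 2 * int m) * (2 * k + 1))" by (simp only: half_double)
    moreover have "b mod 4 = 1" using b by presburger
    ultimately show ?thesis using r by (simp only: i_powi_double) (simp add: eta_minus_1 eta_2 eps_def cong_def)
  next
    assume r: "b mod 8 = 7"
    then have b: "b = 8 * k + 7" using bk by simp
    have m4: "b mod 4 = 3" using b by presburger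
    have "(1 - 2 * int m) * (b - 1) = 2 * ((1 - 2 * int m) * (4 * k + 3))" by (subst b) (simp add: algebra_simps)
    then have "(1 - 2 * int m) * (b - 1) div 2 = (1 - 2 * int m) * (4 * k + 3)" by (simp only: half_double)
    also have "\<dots> = 2 * (2 * k * (1 - 2 * int m) + 2 - 3 * int m) - 1" by (simp add: algebra_simps)
    finally have "\<i> powi ((1 - 2 * int m) * (b - 1) div 2) * \<i> = \<i> powi (2 * (2 * k * (1 - 2 * int m) + 2 - 3 * int m))"
      by (simp only: i_powi_pred)
    then show ?thesis using r m4 unfolding i_powi_double
      by (simp add: eta_minus_1 eta_2 eps_def cong_def uminus_power_if)
  qed
qed

lemma odd_sign:
  "(- 1 :: complex) powi ((1 - (2 * int m + 1)) * (b - 1) div 4) = of_int (\<eta> (- 1) ^ m)"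
proof -
  obtain k where k: "b = 2 * k + 1" using odd_b by (elim oddE)
  have e: "(1 - (2 * int m + 1)) * (b - 1) = 4 * (- int m * k)"
    if "odd b" unfolding k by simp
  have "(1 - (2 * int m + 1)) * (b - 1) div 4 = - int m * k" unfolding e[OF odd_b] by simp
  moreover have "b mod 4 = 1 \<longleftrightarrow> even k" unfolding k by presburger
  ultimately show ?thesis by (simp add: neg_one_powi eta_minus_1 uminus_power_if)
qed

lemma card_charge_residues_eq: "t > 0 \<Longrightarrow> real (card (charge_residues t)) * of_int b = of_int b ^ t"
  using card_charge_residues[of t] unfolding charge_residues_def[symmetric]
  by (metis of_int_mult of_int_of_nat_eq of_int_power)

lemma solutions_proportion:
  assumes t: "t > 0" and bt: "\<not> b dvd int t"
  shows "c_hooks (int t) a b n = of_real (real (card (solutions t (2 * (int n - int t * a)))) / real (card (charge_residues t)))"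
proof -
  define w where "w = 2 * (int n - int t * a)"
  define \<Delta> where "\<Delta> = hook_shift (int t) a b n"
  obtain T' where T': "[T' * int t = 1] (mod b\<^sup>2)" using not_dvd_imp_inverse_square[OF bt] .
  have T'b: "[T' * int t = 1] (mod b)" using T' by (rule cong_dvd_modulus) (simp add: power2_eq_square)
  obtain k where k: "b = 2 * k + 1" using odd_b by (elim oddE)
  \<comment> \<open>The inverse of 2 modulo b^2, chosen so that 2 h = b^2 + 1 holds exactly.\<close>
  define h where "h = 2 * k\<^sup>2 + 2 * k + 1"
  have h: "2 * h = b\<^sup>2 + 1" by (simp add: h_def k power2_eq_square algebra_simps)
  have hb: "[2 * h = 1] (mod b)" unfolding h by (simp add: cong_iff_dvd_diff power2_eq_square)
  define \<kappa> where "\<kappa> = h\<^sup>2 * (int t - 1)\<^sup>2 - T' * (\<Sum>r<t. (int r)\<^sup>2)"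
  have "[\<kappa> - w = 2 * ((1 - (int t)\<^sup>2) * (1 - b\<^sup>2) div 24) - w] (mod b)"
    unfolding \<kappa>_def by (intro cong_diff cong_refl completed_constant bt h T')
  also have "2 * ((1 - (int t)\<^sup>2) * (1 - b\<^sup>2) div 24) - w = 2 * \<Delta>"
    by (simp add: \<Delta>_def hook_shift_def w_def)
  finally have kw: "[\<kappa> - w = 2 * \<Delta>] (mod b)" .
  have eta_kw: "\<eta> (\<kappa> - w) = \<eta> 2 * \<eta> \<Delta>" using eta_cong[OF kw] by (simp add: eta_mult)
  have dvd_kw: "b dvd \<kappa> - w \<longleftrightarrow> [\<Delta> = 0] (mod b)"
    using cong_dvd_iff[OF kw] by (simp add: cong_0_iff dvd_2_mult_iff)
  define \<nu> where "\<nu> = card (solutions t w)"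
  have J: "real (card (charge_residues t)) * of_int b = of_int b ^ t" by (rule card_charge_residues_eq[OF t])
  have b0: "real_of_int b > 0" using b_pos by simp
  \<comment> \<open>The charge residues number b^(t-1), so a deviation X of b^2 times the count from
    b^t becomes X/b^(t+1) in the proportion.\<close>
  have ratio: "real \<nu> / real (card (charge_residues t)) = 1 / of_int b + of_int X / of_int b ^ (t + 1)"
    if "b\<^sup>2 * int \<nu> = b ^ t + X" for X
  proof -
    have Jv: "real (card (charge_residues t)) = of_int b ^ t / of_int b" using J b0 by (simp add: field_simps)
    have "real_of_int (b\<^sup>2 * int \<nu>) = real_of_int (b ^ t + X)" using that by (simp only:)
    then have "real \<nu> = (of_int b ^ t + of_int X) / (of_int b)\<^sup>2" using b0 by (simp add: field_simps)
    then show ?thesis unfolding Jv using b0 by (simp add: field_simps power2_eq_square)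
  qed
  have eta1: "\<eta> (- 1) * \<eta> (- 1) = 1" by (simp add: eta_minus_1)
  have powr_eq: "real_of_int b powr (- real m) = 1 / of_int b ^ m" for m
    using b0 by (simp add: powr_minus powr_realpow divide_inverse)
  show ?thesis
  proof (cases "even t")
    case True
    then obtain m where m: "t = 2 * m" by (elim evenE)
    have "b\<^sup>2 * int \<nu> = b ^ t + (\<eta> (- 1) * b) ^ (t div 2 + 1) * (\<eta> (- 1) * \<eta> (\<kappa> - w))"
      unfolding \<nu>_def solutions_def \<kappa>_def
      by (rule count_solutions_even[OF t refl T'b hb True bt])
    also have "(\<eta> (- 1) * b) ^ (t div 2 + 1) * (\<eta> (- 1) * \<eta> (\<kappa> - w)) = b ^ (m + 1) * (\<eta> (- 1) ^ m * \<eta> 2 * \<eta> \<Delta>) * (\<eta> (- 1) * \<eta> (- 1))"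
      unfolding eta_kw m by (simp add: power_mult_distrib)
    finally have "real \<nu> / real (card (charge_residues t)) = 1 / of_int b + of_int (b ^ (m + 1) * (\<eta> (- 1) ^ m * \<eta> 2 * \<eta> \<Delta>)) / of_int b ^ (t + 1)"
      unfolding eta1 by (intro ratio) simp
    also have "\<dots> = 1 / of_int b + of_int (\<eta> (- 1) ^ m * \<eta> 2) * (1 / of_int b ^ m) * of_int (\<eta> \<Delta>)"
    proof -
      have "real_of_int b ^ (t + 1) = of_int b ^ (m + 1) * of_int b ^ m" by (simp add: m mult_2 flip: power_add)
      then show ?thesis using b0 by simp
    qed
    finally have v: "real \<nu> / real (card (charge_residues t)) = 1 / of_int b + of_int (\<eta> (- 1) ^ m * \<eta> 2) * (1 / of_int b ^ m) * of_int (\<eta> \<Delta>)" .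
    have it: "int t = 2 * int m" by (simp add: m)
    have pw: "real_of_int b powr (- of_int (int t) / 2) = 1 / of_int b ^ m"
      using powr_eq[of m] by (simp add: m)
    have ev: "\<not> odd (int t)" using True by simp
    have "c_hooks (int t) a b n = 1 / of_int b + (\<i> powi ((1 - int t) * (b - 1) div 2) * eps b)
          * of_real (of_int b powr (- of_int (int t) / 2)) * of_int (\<eta> \<Delta>)"
      unfolding c_hooks_def \<Delta>_def using bt ev by (simp only: if_False)
    also have "\<i> powi ((1 - int t) * (b - 1) div 2) * eps b = of_int (\<eta> (- 1) ^ m * \<eta> 2)"
      unfolding it by (rule even_sign)
    finally show ?thesis unfolding pw w_def[symmetric] \<nu>_def[symmetric] v by simp
  next
    case False
    then obtain m where m: "t = 2 * m + 1" by (elim oddE)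
    define I where "I = I_hooks a b (int t) n"
    have I: "I = (if b dvd \<kappa> - w then b - 1 else - 1)"
      unfolding I_def I_hooks_def dvd_kw \<Delta>_def ..
    have "b\<^sup>2 * int \<nu> = b ^ t + (\<eta> (- 1) * b) ^ (t div 2 + 1) * (\<eta> (- 1) * \<eta> (int t) * I)"
      unfolding \<nu>_def solutions_def I \<kappa>_def
      by (rule count_solutions_odd[OF t refl T'b hb False bt])
    also have "(\<eta> (- 1) * b) ^ (t div 2 + 1) * (\<eta> (- 1) * \<eta> (int t) * I) = b ^ (m + 1) * (\<eta> (- 1) ^ m * I * \<eta> (int t)) * (\<eta> (- 1) * \<eta> (- 1))"
      unfolding m by (simp add: power_mult_distrib)
    finally have "real \<nu> / real (card (charge_residues t)) = 1 / of_int b + of_int (b ^ (m + 1) * (\<eta> (- 1) ^ m * I * \<eta> (int t))) / of_int b ^ (t + 1)"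
      unfolding eta1 by (intro ratio) simp
    also have "\<dots> = 1 / of_int b + of_int (\<eta> (- 1) ^ m) * of_int I * (1 / of_int b ^ (m + 1)) * of_int (\<eta> (int t))"
    proof -
      have "real_of_int b ^ (t + 1) = of_int b ^ (m + 1) * of_int b ^ (m + 1)" by (simp add: m mult_2 flip: power_add)
      then show ?thesis using b0 by simp
    qed
    finally have v: "real \<nu> / real (card (charge_residues t)) = 1 / of_int b + of_int (\<eta> (- 1) ^ m) * of_int I * (1 / of_int b ^ (m + 1)) * of_int (\<eta> (int t))" .
    have it: "int t = 2 * int m + 1" by (simp add: m)
    have "- (of_int (int t) + 1) / 2 = - real (m + 1)" by (simp add: m)
    then have pw: "real_of_int b powr (- (of_int (int t) + 1) / 2) = 1 / of_int b ^ (m + 1)"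
      using powr_eq[of "m + 1"] by (simp only:)
    have od: "odd (int t)" using False by simp
    have "c_hooks (int t) a b n = 1 / of_int b + (- 1) powi ((1 - int t) * (b - 1) div 4) * of_int I
          * of_real (of_int b powr (- (of_int (int t) + 1) / 2)) * of_int (\<eta> (int t))"
      unfolding c_hooks_def I_def using bt od by (simp only: if_False if_True not_False_eq_True)
    also have "(- 1 :: complex) powi ((1 - int t) * (b - 1) div 4) = of_int (\<eta> (- 1) ^ m)"
      unfolding it by (rule odd_sign)
    finally show ?thesis unfolding pw w_def[symmetric] \<nu>_def[symmetric] v by simp
  qed
qed

end

theorem theorem1p1:
  fixes t a b :: int
  assumes "t > 1" and "prime b" and "odd b" and "0 \<le> a" and "a < b"
  shows "(\<lambda>n. of_nat (p_hooks t a b n))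
    \<sim>[sequentially]
    (\<lambda>n. c_hooks t a b n / of_real (4 * sqrt 3 * real n) * of_real (exp (pi * sqrt (2 * real n / 3))))"
proof -
  interpret odd_prime b by unfold_locales (rule assms(2,3))+
  define s where "s = nat t"
  have s: "1 < s" "s > 0" "int s = t" using assms(1) by (auto simp: s_def)
  define g where "g = (\<lambda>n. exp (pi * sqrt (2 * real n / 3)) / (4 * sqrt 3 * real n))"
  have g: "g n \<noteq> 0" if "n > 0" for n using that by (simp add: g_def)
  have main: "(\<lambda>n. complex_of_real (real (p_hooks t a b n))) \<sim>[sequentially] (\<lambda>n. c_hooks t a b n * of_real (g n))"
  proof (cases "b dvd t")
    case True
    have "(\<lambda>n. complex_of_real (real (p_hooks t a b n))) \<sim>[sequentially] (\<lambda>n. of_real (1 / of_int b) * of_real (g n))"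
    proof (rule asymp_equiv_of_proportion[where q = "\<lambda>n. real (npart n)" and \<delta> = "1 / of_int b"])
      show "(\<lambda>n. real (npart n) / g n) \<longlonglongrightarrow> 1" unfolding g_def by (rule npart_asymp)
      show "(\<lambda>n. real (p_hooks t a b n) / real (npart n) - 1 / of_int b) \<longlonglongrightarrow> 0"
        using proportion_dvd[OF s(1) _ assms(4,5)] True s(3) by (intro LIM_zero) simp
    qed (use g npart_pos b_pos in auto)
    moreover have "c_hooks t a b n = of_real (1 / of_int b)" for n
      using True by (simp add: c_hooks_def)
    ultimately show ?thesis by (simp only:)
  next
    case False
    then have nd: "\<not> b dvd int s" using s by simp
    let ?\<gamma> = "\<lambda>n. real (card (solutions s (2 * (int n - int s * a)))) / real (card (charge_residues s))"
    have J: "real (card (charge_residues s)) > 0"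
      using card_charge_residues_eq[OF s(2)] b_pos
      by (metis mult_zero_left of_int_0_less_iff of_nat_0_le_iff order_le_less power_not_zero less_irrefl)
    have "(\<lambda>n. complex_of_real (real (p_hooks (int s) a b n))) \<sim>[sequentially] (\<lambda>n. of_real (?\<gamma> n) * of_real (g n))"
    proof (rule asymp_equiv_of_proportion[where q = "\<lambda>n. real (npart n)" and \<delta> = "1 / real (card (charge_residues s))"])
      show "(\<lambda>n. real (npart n) / g n) \<longlonglongrightarrow> 1" unfolding g_def by (rule npart_asymp)
      show "(\<lambda>n. real (p_hooks (int s) a b n) / real (npart n) - ?\<gamma> n) \<longlonglongrightarrow> 0"
        by (rule proportion_not_dvd[OF s(2) nd])
      fix n
      \<comment> \<open>The density is an integer over a fixed cardinality, hence 0 or at least the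
        reciprocal of that cardinality. If it is 0, \<open>p_hooks_solutions\<close> is an empty
        sum.\<close>
      show "?\<gamma> n = 0 \<and> real (p_hooks (int s) a b n) = 0 \<or> 1 / real (card (charge_residues s)) \<le> ?\<gamma> n"
      proof (cases "solutions s (2 * (int n - int s * a)) = {}")
        case True
        then show ?thesis using p_hooks_solutions[OF s(2) nd, of a n] by simp
      next
        case False
        then have "1 \<le> card (solutions s (2 * (int n - int s * a)))"
          using finite_solutions[of s "2 * (int n - int s * a)"] by (simp add: Suc_le_eq card_gt_0_iff)
        then have "1 \<le> real (card (solutions s (2 * (int n - int s * a))))" by simp
        then show ?thesis using J by (intro disjI2 divide_right_mono) auto
      qed
    qed (use g npart_pos J in auto)
    then show ?thesis unfolding solutions_proportion[OF s(2) nd, symmetric] unfolding s(3) .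
  qed
  have "c_hooks t a b n * of_real (g n) = c_hooks t a b n / of_real (4 * sqrt 3 * real n) * of_real (exp (pi * sqrt (2 * real n / 3)))" for n
    by (simp add: g_def)
  then show ?thesis using main by simp
qed

end
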